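(* Let $\mathcal M:[n]\times[d]_+\to[n]$ be $(\varepsilon/2,0)$-differentially private for counting queries and have $(a,\beta)$-accuracy, and let $b\in[n]$. Then ${\tt StabilityHistogram}_{\mathcal M,b}:\mathcal X^n\to\mathcal H_{n,n}(\mathcal X)$ satisfies: (i) it is $(\varepsilon,\delta)$-differentially private whenever $\delta\ge2\Pr[\mathcal M(1,U)>b]$ for $U\sim\mathrm{Unif}([d]_+)$; (ii) it has $(a,\beta)$-per-query accuracy on counts larger than $a+b$; (iii) it has $(a+b,\beta')$-simultaneous accuracy where $\beta'=1-(1-\beta)^n\le n\beta$; (iv) it has running time $O(n\log n\cdot\log|\mathcal X|+n\log d+n\cdot\mathrm{Time}(\mathcal M))$.
   Context: Notation: $[n]=\{0,\dots,n\}$, $[n]_+=\{1,\dots,n\}$. A dataset is $D\in\mathcal X^n$ over a finite universe $\mathcal X=\{1,\dots,m\}$; neighbors differ in exactly one row; $c_x(D)=|\{i:D_i=x\}|$. $(\varepsilon,\delta)$-differential privacy: for all neighbors $D,D'$ and output sets $S$, $\Pr[\mathcal M(D)\in S]\le e^\varepsilon\Pr[\mathcal M(D')\in S]+\delta$. A map $\mathcal M:[n]\times[d]_+\to[n]$ is $(\varepsilon,\delta)$-DP for counting queries if $D\in\{0,1\}^n\mapsto\mathcal M(\sum_iD_i,U)$, $U\sim\mathrm{Unif}([d]_+)$, is $(\varepsilon,\delta)$-DP; it has $(a,\beta)$-accuracy if $\Pr[|\mathcal M(c,U)-c|\le a]\ge1-\beta$ for all $c\in[n]$. $\mathcal H_{n,n'}(\mathcal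 X)$ is the set of histograms $h:\mathcal X\to[n]$ with at most $n'$ nonzero values; a released set of pairs $(x,\tilde c_x)$ is identified with the histogram equal to $\tilde c_x$ on listed $x$ and $0$ elsewhere. ${\tt StabilityHistogram}_{\mathcal M,b}(D)$: let $A=\{x:c_x(D)>0\}$; for each $x\in A$ independently sample $u_x\sim\mathrm{Unif}([d]_+)$ and set $\tilde c_x=\mathcal M(c_x(D),u_x)$; release $\{(x,\tilde c_x):x\in A,\ \tilde c_x>b\}$. A histogram algorithm $\mathcal H$ has $(a,\beta)$-per-query accuracy on counts larger than $t$ if $\Pr[|\mathcal H(D)_x-c_x(D)|\le a]\ge1-\beta$ for all $D$ and all $x$ with $c_x(D)>t$, and $(a,\beta)$-simultaneous accuracy if $\Pr[\forall x:|\mathcal H(D)_x-c_x(D)|\le a]\ge1-\beta$ for all $D$. Running times are in the $w$-bit word RAM model with $w=O(\log n+\log\log|\mathcal X|)$, with unit-cost access to an oracle returning a uniform element of $[d]_+$, partial histograms stored in balanced search trees. *)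

theory Defs
  imports "HOL-Probability.Probability" "HOL-Library.Tree"
begin

section \<open>Datasets, histograms and differential privacy\<close>

definition datasets :: "'r set \<Rightarrow> nat \<Rightarrow> 'r list set" where
  "datasets X n = {D. length D = n \<and> set D \<subseteq> X}"

definition neighbors :: "'r list \<Rightarrow> 'r list \<Rightarrow> bool" where
  "neighbors D D' \<longleftrightarrow> length D = length D' \<and> card {i. i < length D \<and> D ! i \<noteq> D' ! i} = 1"

definition differentially_private ::
    "'r set \<Rightarrow> nat \<Rightarrow> real \<Rightarrow> real \<Rightarrow> ('r list \<Rightarrow> 'o pmf) \<Rightarrow> bool" where
  "differentially_private X n \<epsilon> \<delta> A \<longleftrightarrow>
     (\<forall>D \<in> datasets X n. \<forall>D' \<in> datasets X n. neighbors D D' \<longrightarrow>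
        (\<forall>S. measure_pmf.prob (A D) S \<le> exp \<epsilon> * measure_pmf.prob (A D') S + \<delta>))"

definition uniform_seed :: "nat \<Rightarrow> nat pmf" where
  "uniform_seed d = pmf_of_set {1..d}"

definition counting_dp :: "nat \<Rightarrow> nat \<Rightarrow> real \<Rightarrow> real \<Rightarrow> (nat \<Rightarrow> nat \<Rightarrow> nat) \<Rightarrow> bool" where
  "counting_dp n d \<epsilon> \<delta> M \<longleftrightarrow>
     differentially_private {0, 1 :: nat} n \<epsilon> \<delta> (\<lambda>D. map_pmf (M (sum_list D)) (uniform_seed d))"

definition counting_accurate :: "nat \<Rightarrow> nat \<Rightarrow> real \<Rightarrow> real \<Rightarrow> (nat \<Rightarrow> nat \<Rightarrow> nat) \<Rightarrow> bool" where
  "counting_accurate n d a \<beta> M \<longleftrightarrow>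
     (\<forall>c \<le> n. measure_pmf.prob (uniform_seed d) {u. \<bar>real (M c u) - real c\<bar> \<le> a} \<ge> 1 - \<beta>)"

text \<open>Histograms over a universe \<open>X\<close> are total functions that vanish outside \<open>X\<close>.\<close>

type_synonym histogram = "nat \<Rightarrow> nat"

definition histograms :: "nat \<Rightarrow> nat \<Rightarrow> nat set \<Rightarrow> histogram set" where
  "histograms n n' X =
     {h. (\<forall>x \<in> X. h x \<le> n) \<and> (\<forall>x. x \<notin> X \<longrightarrow> h x = 0) \<and> card {x \<in> X. h x \<noteq> 0} \<le> n'}"

definition per_query_accurate ::
    "nat set \<Rightarrow> nat \<Rightarrow> real \<Rightarrow> real \<Rightarrow> real \<Rightarrow> (nat list \<Rightarrow> histogram pmf) \<Rightarrow> bool" where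
  "per_query_accurate X n a \<beta> t H \<longleftrightarrow>
     (\<forall>D \<in> datasets X n. \<forall>x \<in> X. real (count_list D x) > t \<longrightarrow>
        measure_pmf.prob (H D) {h. \<bar>real (h x) - real (count_list D x)\<bar> \<le> a} \<ge> 1 - \<beta>)"

definition simultaneously_accurate ::
    "nat set \<Rightarrow> nat \<Rightarrow> real \<Rightarrow> real \<Rightarrow> (nat list \<Rightarrow> histogram pmf) \<Rightarrow> bool" where
  "simultaneously_accurate X n a \<beta> H \<longleftrightarrow>
     (\<forall>D \<in> datasets X n.
        measure_pmf.prob (H D) {h. \<forall>x \<in> X. \<bar>real (h x) - real (count_list D x)\<bar> \<le> a} \<ge> 1 - \<beta>)"

definition stability_histogram ::
    "nat \<Rightarrow> (nat \<Rightarrow> nat \<Rightarrow> nat) \<Rightarrow> nat \<Rightarrow> nat list \<Rightarrow> histogram pmf" where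
  "stability_histogram d M b D =
     (let A = {x. count_list D x > 0} in
      map_pmf (\<lambda>u x. if x \<in> A \<and> M (count_list D x) (u x) > b then M (count_list D x) (u x) else 0)
        (Pi_pmf A 0 (\<lambda>_. uniform_seed d)))"

section \<open>The randomized word RAM\<close>

text \<open>
  A fixed program works on finitely many registers and a word-addressed memory; registers and
  addressable cells hold words below \<open>2 ^ w\<close>.  Control flow is structured (\<open>Cond\<close> and \<open>Loop\<close> test
  whether a register is nonzero), and a program is a list of commands.

  The machine is equipped with the sampling oracle for \<open>{1..d}\<close> and with the mechanism \<open>M\<close> as a
  subroutine; \<open>sub_time S c u\<close> is the time the subroutine spends on input \<open>(c, u)\<close>.
\<close>

record machine =
  word_size :: nat
  seed_range :: nat
  subroutine :: "nat \<Rightarrow> nat \<Rightarrow> nat"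
  sub_time :: "nat \<Rightarrow> nat \<Rightarrow> nat"

record state =
  reg :: "nat \<Rightarrow> nat"
  mem :: "nat \<Rightarrow> nat"
  clock :: nat

datatype binop = Add | Sub | Mul | Div | Mod | And | Or | Xor | Shl | Shr | Less | Eq

type_synonym register = nat

datatype com =
    Const register nat
  | Bin binop register register register
  | Load register register    \<comment> \<open>target, address\<close>
  | Store register register   \<comment> \<open>address, source\<close>
  | Rand register             \<comment> \<open>address of the block that receives the sample\<close>
  | Call register register register   \<comment> \<open>target, count, address of the block holding the seed\<close>
  | Cond register "com list" "com list"
  | Loop register "com list"

fun binop_val :: "binop \<Rightarrow> nat \<Rightarrow> nat \<Rightarrow> nat \<Rightarrow> nat" where
  "binop_val Add w x y = (x + y) mod 2 ^ w"
| "binop_val Sub w x y = (x + 2 ^ w - y) mod 2 ^ w"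
| "binop_val Mul w x y = (x * y) mod 2 ^ w"
| "binop_val Div w x y = x div y"
| "binop_val Mod w x y = x mod y"
| "binop_val And w x y = Bit_Operations.and x y"
| "binop_val Or w x y = Bit_Operations.or x y"
| "binop_val Xor w x y = Bit_Operations.xor x y"
| "binop_val Shl w x y = push_bit y x mod 2 ^ w"
| "binop_val Shr w x y = drop_bit y x"
| "binop_val Less w x y = (if x < y then 1 else 0) mod 2 ^ w"
| "binop_val Eq w x y = (if x = y then 1 else 0) mod 2 ^ w"

text \<open>Large numbers are stored as little-endian blocks of words.\<close>

definition num_words :: "nat \<Rightarrow> nat \<Rightarrow> nat" where
  "num_words w x = (LEAST l. x < 2 ^ (w * l))"

definition nth_word :: "nat \<Rightarrow> nat \<Rightarrow> nat \<Rightarrow> nat" where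
  "nth_word w x j = (x div 2 ^ (w * j)) mod 2 ^ w"

definition write_block :: "nat \<Rightarrow> nat \<Rightarrow> nat \<Rightarrow> nat \<Rightarrow> (nat \<Rightarrow> nat) \<Rightarrow> nat \<Rightarrow> nat" where
  "write_block w l p x \<mu> = (\<lambda>i. if p \<le> i \<and> i < p + l then nth_word w x (i - p) else \<mu> i)"

definition read_block :: "nat \<Rightarrow> nat \<Rightarrow> (nat \<Rightarrow> nat) \<Rightarrow> nat \<Rightarrow> nat" where
  "read_block w l \<mu> p = (\<Sum>j<l. \<mu> (p + j) * 2 ^ (w * j))"

definition seed_words :: "machine \<Rightarrow> nat" where
  "seed_words S = num_words (word_size S) (seed_range S)"

definition set_reg :: "register \<Rightarrow> nat \<Rightarrow> state \<Rightarrow> state" where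
  "set_reg r v s = s\<lparr>reg := (reg s)(r := v)\<rparr>"

definition tick :: "nat \<Rightarrow> state \<Rightarrow> state" where
  "tick t s = s\<lparr>clock := clock s + t\<rparr>"

text \<open>
  Every command and every test takes unit time, with two exceptions.  \<open>Rand\<close> takes one unit for the
  oracle query plus one for each word of the answer written to memory.  \<open>Call\<close> takes one
  unit plus the time of the subroutine.  The block for a seed may extend beyond the \<open>2 ^ w\<close> cells
  reachable by \<open>Load\<close> and \<open>Store\<close>, so that no relation between \<open>d\<close> and \<open>w\<close> is needed; those
  words are accessible to the oracle and to the subroutine only.
\<close>

fun step_com :: "machine \<Rightarrow> com \<Rightarrow> com list \<Rightarrow> state \<Rightarrow> (com list \<times> state) pmf" where
  "step_com S (Const r k) cs s =
     return_pmf (cs, tick 1 (set_reg r (k mod 2 ^ word_size S) s))"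
| "step_com S (Bin f r r1 r2) cs s =
     return_pmf (cs, tick 1 (set_reg r (binop_val f (word_size S) (reg s r1) (reg s r2)) s))"
| "step_com S (Load r ra) cs s =
     return_pmf (cs, tick 1 (set_reg r (mem s (reg s ra)) s))"
| "step_com S (Store ra r) cs s =
     return_pmf (cs, tick 1 (s\<lparr>mem := (mem s)(reg s ra := reg s r)\<rparr>))"
| "step_com S (Rand ra) cs s =
     map_pmf (\<lambda>u. (cs, tick (1 + seed_words S)
         (s\<lparr>mem := write_block (word_size S) (seed_words S) (reg s ra) u (mem s)\<rparr>)))
       (uniform_seed (seed_range S))"
| "step_com S (Call r rc ra) cs s =
     (let c = reg s rc; u = read_block (word_size S) (seed_words S) (mem s) (reg s ra)
      in return_pmf (cs, tick (1 + sub_time S c u)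
           (set_reg r (subroutine S c u mod 2 ^ word_size S) s)))"
| "step_com S (Cond r ps qs) cs s =
     return_pmf ((if reg s r \<noteq> 0 then ps else qs) @ cs, tick 1 s)"
| "step_com S (Loop r ps) cs s =
     return_pmf (if reg s r \<noteq> 0 then ps @ Loop r ps # cs else cs, tick 1 s)"

text \<open>A configuration consists of the commands still to be executed and the state.\<close>

fun step :: "machine \<Rightarrow> com list \<times> state \<Rightarrow> (com list \<times> state) pmf" where
  "step S ([], s) = return_pmf ([], s)"
| "step S (c # cs, s) = step_com S c cs s"

fun run :: "machine \<Rightarrow> nat \<Rightarrow> com list \<times> state \<Rightarrow> (com list \<times> state) pmf" where
  "run S 0 cfg = return_pmf cfg"
| "run S (Suc k) cfg = bind_pmf (step S cfg) (run S k)"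

section \<open>Computing a histogram on the word RAM\<close>

text \<open>
  The rows of the dataset occupy consecutive blocks of \<open>l\<close> words from address 0 on; registers 0, 1
  and 2 hold the number of rows, \<open>l\<close> and the threshold.
\<close>

definition initial_state :: "nat \<Rightarrow> nat \<Rightarrow> nat \<Rightarrow> nat list \<Rightarrow> state" where
  "initial_state w l b D =
     \<lparr>reg = (\<lambda>_. 0)(0 := length D, 1 := l, 2 := b),
      mem = (\<lambda>i. if i < length D * l then nth_word w (D ! (i div l)) (i mod l) else 0),
      clock = 0\<rparr>"

text \<open>
  A node at address \<open>p\<close> holds, in this order, the addresses of the two subtrees, the count, and the
  \<open>l\<close> words of the key; the address 0 stands for the empty tree.
\<close>

fun tree_at :: "nat \<Rightarrow> nat \<Rightarrow> (nat \<Rightarrow> nat) \<Rightarrow> nat \<Rightarrow> (nat \<times> nat) tree \<Rightarrow> bool" where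
  "tree_at w l \<mu> p \<langle>\<rangle> \<longleftrightarrow> p = 0"
| "tree_at w l \<mu> p \<langle>t1, (x, c), t2\<rangle> \<longleftrightarrow>
     p \<noteq> 0 \<and> p + 3 + l \<le> 2 ^ w \<and> \<mu> (p + 2) = c \<and> read_block w l \<mu> (p + 3) = x \<and>
     tree_at w l \<mu> (\<mu> p) t1 \<and> tree_at w l \<mu> (\<mu> (p + 1)) t2"

text \<open>
  Balanced means height at most \<open>2 * log\<^sub>2 (size + 1)\<close>, as for AVL and red-black trees.
\<close>

definition balanced_search_tree :: "(nat \<times> nat) tree \<Rightarrow> bool" where
  "balanced_search_tree t \<longleftrightarrow> bst (map_tree fst t) \<and> real (height t) \<le> 2 * log 2 (real (size1 t))"

text \<open>On termination register 0 points to a tree storing the partial histogram.\<close>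

definition stores_histogram :: "nat \<Rightarrow> nat \<Rightarrow> state \<Rightarrow> histogram \<Rightarrow> bool" where
  "stores_histogram w l s h \<longleftrightarrow>
     (\<exists>t. tree_at w l (mem s) (reg s 0) t \<and> balanced_search_tree t \<and>
          set_tree t = {(x, h x) |x. h x > 0})"

text \<open>
  The coupling expressed by \<^const>\<open>rel_pmf\<close> says that every possible run on \<open>D\<close> halts with its clock
  showing at most \<open>B\<close>, and that the histogram stored at the end is distributed as \<open>H\<close>.
\<close>

definition computes_histogram ::
    "machine \<Rightarrow> com list \<Rightarrow> nat \<Rightarrow> nat \<Rightarrow> nat list \<Rightarrow> histogram pmf \<Rightarrow> real \<Rightarrow> bool" where
  "computes_histogram S P m b D H B \<longleftrightarrow>
     (let w = word_size S; l = num_words w m in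
      \<exists>k. rel_pmf (\<lambda>(cs, s) h. cs = [] \<and> real (clock s) \<le> B \<and> stores_histogram w l s h)
            (run S k (P, initial_state w l b D)) H)"

definition worst_time :: "nat \<Rightarrow> nat \<Rightarrow> (nat \<Rightarrow> nat \<Rightarrow> nat) \<Rightarrow> nat" where
  "worst_time n d \<tau> = Max {\<tau> c u |c u. c \<le> n \<and> u \<in> {1..d}}"

text \<open>
  The machine only has to be large enough: word sizes \<open>w \<ge> K (log n + log log m)\<close> are admissible for
  a constant \<open>K\<close>, in particular \<open>w = O(log n + log log m)\<close>.  The program and the constants are
  uniform in all other data.  Sizes \<open>n, m \<ge> 2\<close> keep the logarithms in the bounds meaningful.
\<close>

definition runs_in_time :: "com list \<Rightarrow> real \<Rightarrow> real \<Rightarrow> nat \<Rightarrow> nat \<Rightarrow> nat \<Rightarrow> (nat \<Rightarrow> nat \<Rightarrow> nat) \<Rightarrow> nat \<Rightarrow> bool"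
  where
  "runs_in_time P K C n m d M b \<longleftrightarrow>
     (\<forall>w \<tau>. n \<ge> 2 \<longrightarrow> m \<ge> 2 \<longrightarrow> real w \<ge> K * (log 2 n + log 2 (log 2 m)) \<longrightarrow>
        (\<forall>D \<in> datasets {1..m} n.
           computes_histogram
             \<lparr>word_size = w, seed_range = d, subroutine = M, sub_time = \<tau>\<rparr> P m b D
             (stability_histogram d M b D)
             (C * (n * log 2 n * log 2 m + n * log 2 d + n * worst_time n d \<tau>))))"

end

(* The program copies each row into a tree node of its own and sorts an array of node addresses by binary
   radix sort, least significant bit of the least significant word first. For each word the number of
   passes is governed by the largest value occurring in it, so that the number of passes is O(log m) even on
   machines whose words are much longer than the keys. A scan over the sorted array then counts every
   group of equal keys, samples the noisy count once per group and keeps the nodes that pass the threshold;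
   these are linked bottom-up into a balanced tree without any comparison of keys.

   For privacy, the histogram is a product of independent coordinates, and exchanging a row changes two of
   them. A coordinate whose count stays positive changes by a factor exp (eps/2); a coordinate whose count
   moves between 0 and 1 changes by the additive error Pr[M(1,U) > b]. *)

theory Submission
  imports Defs
begin

section \<open>Reasoning about programs\<close>

text \<open>A key may span many words, and a word may be far longer than a key. Sorting bit by bit
  within words copes with both: a pass costs O(n), and the passes over all words together number
  O(log m).

  The obstacle is the interplay of control flow and randomness. From the first sample on, the
  branches taken, the number of kept nodes and the number of steps depend on the seeds.
  \<open>ends\<close> treats the deterministic pieces; \<open>achieves\<close> couples the rest of a
  run with the law of the final histogram. Seeds are drawn lazily: \<open>rest\<close> is a product
  over the keys not yet reached and loses one coordinate per group, in step with
  \<open>Rand\<close>.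

  The word size constant 6 comes from memory: fewer than 32 n log m cells are used, and 32 n log m
  is at most (n log m)^6 because n log m is at least 2. In the privacy proof two factors exp (eps/2)
  multiply to exp eps, and two additive errors give the factor 2 in the condition on delta.\<close>

definition ends ::
    "machine \<Rightarrow> com list \<Rightarrow> (nat \<Rightarrow> nat) \<Rightarrow> (nat \<Rightarrow> nat) \<Rightarrow> nat \<Rightarrow> ((nat \<Rightarrow> nat) \<Rightarrow> (nat \<Rightarrow> nat) \<Rightarrow> bool) \<Rightarrow> bool" where
  "ends S P \<rho> \<mu> T Q \<longleftrightarrow>
     (\<exists>k \<rho>' \<mu>' t'. t' \<le> T \<and> Q \<rho>' \<mu>' \<and>
        (\<forall>cs t. run S k (P @ cs, \<lparr>reg = \<rho>, mem = \<mu>, clock = t\<rparr>) =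
                return_pmf (cs, \<lparr>reg = \<rho>', mem = \<mu>', clock = t + t'\<rparr>)))"

text \<open>Since the remaining program \<open>cs\<close> is arbitrary, such triples compose sequentially; the clock is kept
  out of \<open>Q\<close> and only bounded by \<open>T\<close>.\<close>

lemma run_add: "run S (j + k) cfg = bind_pmf (run S j cfg) (run S k)"
proof (induction j arbitrary: cfg)
  case (Suc j)
  then have "run S (j + k) = (\<lambda>cfg. bind_pmf (run S j cfg) (run S k))" by blast
  then show ?case by (simp add: bind_assoc_pmf)
qed (simp add: bind_return_pmf)

lemma run_halted: "run S k ([], s) = return_pmf ([], s)"
  by (induction k) (simp_all add: bind_return_pmf)

lemma ends_Nil [simp]: "ends S [] \<rho> \<mu> T Q \<longleftrightarrow> Q \<rho> \<mu>"
proof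
  assume "ends S [] \<rho> \<mu> T Q"
  then obtain k \<rho>' \<mu>' t' where Q: "Q \<rho>' \<mu>'"
    and r: "\<And>cs t. run S k ([] @ cs, \<lparr>reg = \<rho>, mem = \<mu>, clock = t\<rparr>) =
                return_pmf (cs, \<lparr>reg = \<rho>', mem = \<mu>', clock = t + t'\<rparr>)"
    unfolding ends_def by blast
  \<comment> \<open>With nothing left to execute the machine is halted, so the \<open>k\<close>
    steps change nothing, however large \<open>k\<close> is.\<close>
  from r[of "[]"] have "\<rho>' = \<rho>" "\<mu>' = \<mu>" by (simp_all add: run_halted)
  with Q show "Q \<rho> \<mu>" by simp
next
  assume "Q \<rho> \<mu>"
  then show "ends S [] \<rho> \<mu> T Q"
    unfolding ends_def by (intro exI[of _ 0] exI[of _ \<rho>] exI[of _ \<mu>]) simp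
qed

lemma ends_mono:
  assumes "ends S P \<rho> \<mu> T Q" "T \<le> T'" "\<And>\<rho> \<mu>. Q \<rho> \<mu> \<Longrightarrow> Q' \<rho> \<mu>"
  shows "ends S P \<rho> \<mu> T' Q'"
  using assms unfolding ends_def by (meson order_trans)

text \<open>The postcondition of the first piece is the triple of the second with the remaining
  budget, so that programs can be executed symbolically from left to right without naming
  intermediate assertions.\<close>

lemma ends_append:
  assumes "ends S P \<rho> \<mu> T1 (\<lambda>\<rho>' \<mu>'. ends S P' \<rho>' \<mu>' (T - T1) Q)" "T1 \<le> T"
  shows "ends S (P @ P') \<rho> \<mu> T Q"
proof -
  obtain k \<rho>1 \<mu>1 t1 where 1: "t1 \<le> T1" "ends S P' \<rho>1 \<mu>1 (T - T1) Q"
    "\<And>cs t. run S k (P @ cs, \<lparr>reg = \<rho>, mem = \<mu>, clock = t\<rparr>) =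
                return_pmf (cs, \<lparr>reg = \<rho>1, mem = \<mu>1, clock = t + t1\<rparr>)"
    using assms(1) unfolding ends_def[of S P] by blast
  obtain k2 \<rho>2 \<mu>2 t2 where 2: "t2 \<le> T - T1" "Q \<rho>2 \<mu>2"
    "\<And>cs t. run S k2 (P' @ cs, \<lparr>reg = \<rho>1, mem = \<mu>1, clock = t\<rparr>) =
                return_pmf (cs, \<lparr>reg = \<rho>2, mem = \<mu>2, clock = t + t2\<rparr>)"
    using 1(2) unfolding ends_def by blast
  have "t1 + t2 \<le> T" using 1(1) 2(1) assms(2) by linarith
  moreover have "run S (k + k2) ((P @ P') @ cs, \<lparr>reg = \<rho>, mem = \<mu>, clock = t\<rparr>) =
                return_pmf (cs, \<lparr>reg = \<rho>2, mem = \<mu>2, clock = t + (t1 + t2)\<rparr>)" for cs t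
    by (simp add: run_add 1(3) 2(3) bind_return_pmf add.assoc)
  ultimately show ?thesis using 2(2) unfolding ends_def by blast
qed

lemma ends_Cons:
  assumes "ends S [c] \<rho> \<mu> T1 (\<lambda>\<rho>' \<mu>'. ends S P \<rho>' \<mu>' (T - T1) Q)" "T1 \<le> T"
  shows "ends S (c # P) \<rho> \<mu> T Q"
  using ends_append[of S "[c]", OF assms] by simp

text \<open>\<open>P'\<close> need not be \<open>P\<close>: tests push a branch or a loop body in
  front of it.\<close>

lemma ends_single_step:
  assumes step: "\<And>cs t. step S (c # P @ cs, \<lparr>reg = \<rho>, mem = \<mu>, clock = t\<rparr>) =
      return_pmf (P' @ cs, \<lparr>reg = \<rho>', mem = \<mu>', clock = t + t0\<rparr>)" and "t0 \<le> T"
  assumes "ends S P' \<rho>' \<mu>' (T - t0) Q"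
  shows "ends S (c # P) \<rho> \<mu> T Q"
proof -
  obtain k2 \<rho>2 \<mu>2 t2 where 2: "t2 \<le> T - t0" "Q \<rho>2 \<mu>2"
    "\<And>cs t. run S k2 (P' @ cs, \<lparr>reg = \<rho>', mem = \<mu>', clock = t\<rparr>) =
                return_pmf (cs, \<lparr>reg = \<rho>2, mem = \<mu>2, clock = t + t2\<rparr>)"
    using assms(3) unfolding ends_def by blast
  have "t0 + t2 \<le> T" using 2(1) assms(2) by linarith
  moreover have "run S (Suc k2) ((c # P) @ cs, \<lparr>reg = \<rho>, mem = \<mu>, clock = t\<rparr>) =
                return_pmf (cs, \<lparr>reg = \<rho>2, mem = \<mu>2, clock = t + (t0 + t2)\<rparr>)" for cs t
    using step[of cs t] by (simp add: 2(3) bind_return_pmf add.assoc del: step.simps)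
  ultimately show ?thesis using 2(2) unfolding ends_def by blast
qed

lemma ends_Const:
  assumes "0 < T" "ends S P (\<rho>(r := k mod 2 ^ word_size S)) \<mu> (T - 1) Q"
  shows "ends S (Const r k # P) \<rho> \<mu> T Q"
  by (rule ends_single_step[OF _ _ assms(2)]) (use assms(1) in \<open>auto simp: tick_def set_reg_def\<close>)

lemma ends_Bin:
  assumes "0 < T" "ends S P (\<rho>(r := binop_val f (word_size S) (\<rho> r1) (\<rho> r2))) \<mu> (T - 1) Q"
  shows "ends S (Bin f r r1 r2 # P) \<rho> \<mu> T Q"
  by (rule ends_single_step[OF _ _ assms(2)]) (use assms(1) in \<open>auto simp: tick_def set_reg_def\<close>)

lemma ends_Load:
  assumes "0 < T" "ends S P (\<rho>(r := \<mu> (\<rho> ra))) \<mu> (T - 1) Q"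
  shows "ends S (Load r ra # P) \<rho> \<mu> T Q"
  by (rule ends_single_step[OF _ _ assms(2)]) (use assms(1) in \<open>auto simp: tick_def set_reg_def\<close>)

lemma ends_Store:
  assumes "0 < T" "ends S P \<rho> (\<mu>(\<rho> ra := \<rho> r)) (T - 1) Q"
  shows "ends S (Store ra r # P) \<rho> \<mu> T Q"
  by (rule ends_single_step[OF _ _ assms(2)]) (use assms(1) in \<open>auto simp: tick_def\<close>)

lemma ends_Call:
  assumes "u = read_block (word_size S) (seed_words S) \<mu> (\<rho> ra)" "sub_time S (\<rho> rc) u < T"
    "ends S P (\<rho>(r := subroutine S (\<rho> rc) u mod 2 ^ word_size S)) \<mu> (T - (1 + sub_time S (\<rho> rc) u)) Q"
  shows "ends S (Call r rc ra # P) \<rho> \<mu> T Q"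
  by (rule ends_single_step[OF _ _ assms(3)])
     (use assms(1,2) in \<open>auto simp: tick_def set_reg_def Let_def\<close>)

lemma ends_Cond:
  assumes "0 < T" "ends S ((if \<rho> r \<noteq> 0 then ps else qs) @ P) \<rho> \<mu> (T - 1) Q"
  shows "ends S (Cond r ps qs # P) \<rho> \<mu> T Q"
  by (rule ends_single_step[OF _ _ assms(2)]) (use assms(1) in \<open>auto simp: tick_def\<close>)

lemmas ends_basic = ends_Const ends_Bin ends_Load ends_Store

lemma ends_Loop_unfold:
  assumes "0 < T" "ends S (if \<rho> r \<noteq> 0 then ps @ Loop r ps # P else P) \<rho> \<mu> (T - 1) Q"
  shows "ends S (Loop r ps # P) \<rho> \<mu> T Q"
  by (rule ends_single_step[OF _ _ assms(2)]) (use assms(1) in \<open>auto simp: tick_def\<close>)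

text \<open>The invariant is indexed by the round. Every round pays one unit for its test besides
  \<open>t\<close>, and the failing test at the end is the extra 1.\<close>

lemma ends_Loop:
  assumes init: "I 0 \<rho> \<mu>"
    and body: "\<And>i \<rho> \<mu>. i < N \<Longrightarrow> I i \<rho> \<mu> \<Longrightarrow> \<rho> r \<noteq> 0 \<and> ends S ps \<rho> \<mu> t (I (Suc i))"
    and exit: "\<And>\<rho> \<mu>. I N \<rho> \<mu> \<Longrightarrow> \<rho> r = 0 \<and> Q \<rho> \<mu>"
    and time: "N * (t + 1) + 1 \<le> T"
  shows "ends S [Loop r ps] \<rho> \<mu> T Q"
proof -
  have "ends S [Loop r ps] \<rho> \<mu> (n * (t + 1) + 1) Q" if "n \<le> N" "I (N - n) \<rho> \<mu>" for n \<rho> \<mu>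
    using that
  proof (induction n arbitrary: \<rho> \<mu>)
    case 0
    with exit show ?case by (intro ends_Loop_unfold) auto
  next
    case (Suc n)
    then have "\<rho> r \<noteq> 0" and b: "ends S ps \<rho> \<mu> t (I (N - n))"
      using body[of "N - Suc n" \<rho> \<mu>] by (auto simp: Suc_diff_Suc)
    have "ends S (ps @ [Loop r ps]) \<rho> \<mu> (Suc n * (t + 1)) Q"
      by (rule ends_append[OF ends_mono[OF b order_refl]])
         (use Suc in \<open>auto intro: ends_mono[OF Suc.IH]\<close>)
    with \<open>\<rho> r \<noteq> 0\<close> show ?case by (intro ends_Loop_unfold) auto
  qed
  from this[of N \<rho> \<mu>] init have "ends S [Loop r ps] \<rho> \<mu> (N * (t + 1) + 1) Q" by simp
  then show ?thesis using time by (rule ends_mono)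
qed

section \<open>Randomized programs, coupled with the law of their result\<close>

lemma rel_pmf_run_mono:
  assumes "rel_pmf (\<lambda>(cs, s) h. cs = [] \<and> Q s h) (run S k cfg) H" "k \<le> k'"
  shows "rel_pmf (\<lambda>(cs, s) h. cs = [] \<and> Q s h) (run S k' cfg) H"
proof -
  have "run S k' cfg = bind_pmf (run S k cfg) (run S (k' - k))"
    using run_add[of S k "k' - k"] assms(2) by simp
  \<comment> \<open>Every configuration in the support is halted, so the additional steps act as the
    identity. This allows runs of different lengths to be padded to a common length.\<close>
  also have "\<dots> = bind_pmf (run S k cfg) return_pmf"
  proof (rule bind_pmf_cong[OF refl])
    fix c assume "c \<in> set_pmf (run S k cfg)"
    then have "fst c = []"
      using rel_pmf_imp_rel_set[OF assms(1)] by (fastforce simp: rel_set_def)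
    then show "run S (k' - k) c = return_pmf c" by (cases c) (simp add: run_halted)
  qed
  finally show ?thesis using assms(1) by (simp add: bind_return_pmf')
qed

text \<open>In contrast to \<open>ends\<close> there is no continuation: \<open>cs\<close> is
  everything that is left to do, since the law \<open>H\<close> of the final result belongs to the
  complete remaining run. Proofs therefore proceed from the end of the program to its
  beginning.\<close>

definition achieves ::
    "machine \<Rightarrow> com list \<Rightarrow> (nat \<Rightarrow> nat) \<Rightarrow> (nat \<Rightarrow> nat) \<Rightarrow> nat \<Rightarrow> 'a pmf \<Rightarrow>
     ((nat \<Rightarrow> nat) \<Rightarrow> (nat \<Rightarrow> nat) \<Rightarrow> 'a \<Rightarrow> bool) \<Rightarrow> bool" where
  "achieves S cs \<rho> \<mu> T H Q \<longleftrightarrow>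
     (\<exists>k. \<forall>t. rel_pmf (\<lambda>(cs', s) h. cs' = [] \<and> clock s \<le> t + T \<and> Q (reg s) (mem s) h)
        (run S k (cs, \<lparr>reg = \<rho>, mem = \<mu>, clock = t\<rparr>)) H)"

lemma achieves_Nil: "Q \<rho> \<mu> h \<Longrightarrow> achieves S [] \<rho> \<mu> T (return_pmf h) Q"
  unfolding achieves_def by (intro exI[of _ 0]) (simp add: rel_pmf_return_pmf1)

lemma achieves_append:
  assumes "ends S P \<rho> \<mu> T1 (\<lambda>\<rho>' \<mu>'. achieves S cs \<rho>' \<mu>' T2 H Q)" "T1 + T2 \<le> T"
  shows "achieves S (P @ cs) \<rho> \<mu> T H Q"
proof -
  obtain k \<rho>1 \<mu>1 t1 where 1: "t1 \<le> T1" "achieves S cs \<rho>1 \<mu>1 T2 H Q"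
    "\<And>cs t. run S k (P @ cs, \<lparr>reg = \<rho>, mem = \<mu>, clock = t\<rparr>) =
                return_pmf (cs, \<lparr>reg = \<rho>1, mem = \<mu>1, clock = t + t1\<rparr>)"
    using assms(1) unfolding ends_def by blast
  obtain k2 where 2:
    "\<And>t. rel_pmf (\<lambda>(cs', s) h. cs' = [] \<and> clock s \<le> t + T2 \<and> Q (reg s) (mem s) h)
        (run S k2 (cs, \<lparr>reg = \<rho>1, mem = \<mu>1, clock = t\<rparr>)) H"
    using 1(2) unfolding achieves_def by blast
  have "rel_pmf (\<lambda>(cs', s) h. cs' = [] \<and> clock s \<le> t + T \<and> Q (reg s) (mem s) h)
        (run S (k + k2) (P @ cs, \<lparr>reg = \<rho>, mem = \<mu>, clock = t\<rparr>)) H" for t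
    using 1(1) assms(2)
    by (auto simp: run_add 1(3) bind_return_pmf intro!: pmf.rel_mono_strong[OF 2])
  then show ?thesis unfolding achieves_def by blast
qed

lemma achieves_single_step:
  assumes step: "\<And>t. step S (c # P, \<lparr>reg = \<rho>, mem = \<mu>, clock = t\<rparr>) =
      return_pmf (P', \<lparr>reg = \<rho>, mem = \<mu>, clock = t + 1\<rparr>)"
    and "achieves S P' \<rho> \<mu> T' H Q" and "T' < T"
  shows "achieves S (c # P) \<rho> \<mu> T H Q"
proof -
  from assms(2) obtain k where k: "\<And>t. rel_pmf (\<lambda>(cs', s) h. cs' = [] \<and> clock s \<le> t + T' \<and>
      Q (reg s) (mem s) h)
        (run S k (P', \<lparr>reg = \<rho>, mem = \<mu>, clock = t\<rparr>)) H"
    unfolding achieves_def by blast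
  have "rel_pmf (\<lambda>(cs', s) h. cs' = [] \<and> clock s \<le> t + T \<and> Q (reg s) (mem s) h)
        (run S (Suc k) (c # P, \<lparr>reg = \<rho>, mem = \<mu>, clock = t\<rparr>)) H" for t
  proof -
    have "run S (Suc k) (c # P, \<lparr>reg = \<rho>, mem = \<mu>, clock = t\<rparr>) =
        run S k (P', \<lparr>reg = \<rho>, mem = \<mu>, clock = t + 1\<rparr>)"
      unfolding run.simps step bind_return_pmf ..
    then show ?thesis using assms(3) by (auto intro!: pmf.rel_mono_strong[OF k[of "Suc t"]])
  qed
  then show ?thesis unfolding achieves_def by blast
qed

lemma achieves_Cond:
  assumes "achieves S ((if \<rho> r \<noteq> 0 then ps else qs) @ P) \<rho> \<mu> T' H Q" "T' < T"
  shows "achieves S (Cond r ps qs # P) \<rho> \<mu> T H Q"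
  by (rule achieves_single_step[OF _ assms]) (simp add: tick_def)

lemma achieves_Loop:
  assumes "achieves S (if \<rho> r \<noteq> 0 then ps @ Loop r ps # P else P) \<rho> \<mu> T' H Q" "T' < T"
  shows "achieves S (Loop r ps # P) \<rho> \<mu> T H Q"
  by (rule achieves_single_step[OF _ assms]) (simp add: tick_def)

lemma achieves_Rand:
  assumes "seed_range S \<ge> 1"
    and post: "\<And>u. u \<in> {1..seed_range S} \<Longrightarrow>
      achieves S cs \<rho> (write_block (word_size S) (seed_words S) (\<rho> ra) u \<mu>) T' (H u) Q"
    and "1 + seed_words S + T' \<le> T"
  shows "achieves S (Rand ra # cs) \<rho> \<mu> T (bind_pmf (uniform_seed (seed_range S)) H) Q"
proof -
  let ?d = "seed_range S"
  let ?R = "\<lambda>t T. \<lambda>(cs', s) h. cs' = [] \<and> clock s \<le> t + T \<and> Q (reg s) (mem s) h"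
  let ?cfg = "\<lambda>u t. (cs, \<lparr>reg = \<rho>, mem = write_block (word_size S) (seed_words S) (\<rho> ra) u \<mu>,
                            clock = t\<rparr>)"
  have set: "set_pmf (uniform_seed ?d) = {1..?d}"
    using assms(1) unfolding uniform_seed_def by (subst set_pmf_of_set) auto
  have "\<forall>u\<in>{1..?d}. \<exists>k. \<forall>t. rel_pmf (?R t T') (run S k (?cfg u t)) (H u)"
    using post unfolding achieves_def by blast
  from bchoice[OF this] obtain k
    where k: "\<forall>u\<in>{1..?d}. \<forall>t. rel_pmf (?R t T') (run S (k u) (?cfg u t)) (H u)" ..
  \<comment> \<open>Different seeds may lead to runs of different lengths; as there are finitely
    many seeds, all runs are padded to the longest one.\<close>
  define K where "K = Max (k ` {1..?d})"
  have K: "rel_pmf (?R t T') (run S K (?cfg u t)) (H u)" if "u \<in> {1..?d}" for u t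
    by (rule rel_pmf_run_mono[OF k[rule_format, OF that]]) (use that in \<open>auto simp: K_def\<close>)
  have "rel_pmf (?R t T) (run S (Suc K) (Rand ra # cs, \<lparr>reg = \<rho>, mem = \<mu>, clock = t\<rparr>))
          (bind_pmf (uniform_seed ?d) H)" for t
  proof -
    have "rel_pmf (?R t T) (bind_pmf (uniform_seed ?d) (\<lambda>u. run S K (?cfg u (t + (1 + seed_words S)))))
            (bind_pmf (uniform_seed ?d) H)"
    \<comment> \<open>The seed is coupled with itself; its range is recorded because the runs are
      controlled only for seeds in that range.\<close>
    proof (rule rel_pmf_bindI[of "\<lambda>u v. u = v \<and> u \<in> {1..?d}"])
      show "rel_pmf (\<lambda>u v. u = v \<and> u \<in> {1..?d}) (uniform_seed ?d) (uniform_seed ?d)"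
        using set by (intro rel_pmf_reflI) auto
    next
      fix u v assume "u = v \<and> u \<in> {1..?d}"
      with assms(3) show "rel_pmf (?R t T) (run S K (?cfg u (t + (1 + seed_words S)))) (H v)"
        by (auto intro!: pmf.rel_mono_strong[OF K])
    qed
    then show ?thesis by (simp add: bind_map_pmf tick_def)
  qed
  then show ?thesis unfolding achieves_def by blast
qed

section \<open>Sorting the rows\<close>

definition list_at :: "(nat \<Rightarrow> nat) \<Rightarrow> nat \<Rightarrow> nat list \<Rightarrow> bool" where
  "list_at \<mu> a xs \<longleftrightarrow> (\<forall>i < length xs. \<mu> (a + i) = xs ! i)"

lemma list_at_cong:
  assumes "list_at \<mu> a xs" "\<And>x. a \<le> x \<Longrightarrow> x < a + length xs \<Longrightarrow> \<mu>' x = \<mu> x"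
  shows "list_at \<mu>' a xs"
  using assms by (simp add: list_at_def)

lemma list_at_append:
  "list_at \<mu> a (xs @ ys) \<longleftrightarrow> list_at \<mu> a xs \<and> list_at \<mu> (a + length xs) ys"
  unfolding list_at_def
  by (auto simp: nth_append add.assoc not_less dest: spec[of _ "length xs + i" for i])
     (metis add_diff_inverse_nat nat_add_left_cancel_less not_less)

text \<open>As simp rules in place of the defining equations, these make symbolic execution leave
  absence of overflow as a side condition instead of terms modulo \<open>2 ^ w\<close>.\<close>

lemma binop_val_no_overflow:
  "x + y < 2 ^ w \<Longrightarrow> binop_val Add w x y = x + y"
  "y \<le> x \<Longrightarrow> x < 2 ^ w \<Longrightarrow> binop_val Sub w x y = x - y"
  "x * y < 2 ^ w \<Longrightarrow> binop_val Mul w x y = x * y"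
proof -
  assume "y \<le> x" "x < 2 ^ w"
  then have "x + 2 ^ w - y = (x - y) + 2 ^ w" "x - y < 2 ^ w" by simp_all
  then show "binop_val Sub w x y = x - y" by (simp only: binop_val.simps mod_add_self2 mod_less)
qed simp_all

declare One_nat_def [simp del] binop_val.simps(1-3) [simp del] binop_val_no_overflow [simp]

definition copy_prog :: "com list" where
  "copy_prog = [Loop 17 [Load 18 16, Store 15 18, Bin Add 15 15 3, Bin Add 16 16 3, Bin Sub 17 17 3]]"

text \<open>Inner programs use registers with higher numbers, so that a frame condition of the form
  \<open>r < 15\<close> is all that the surrounding programs need. The factor 6 is five commands and
  one test per cell.\<close>

lemma ends_copy_prog:
  assumes "\<rho> 3 = 1" "\<rho> 15 = dst" "\<rho> 16 = src" "\<rho> 17 = N"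
    and bounds: "src + N < 2 ^ word_size S" "dst + N < 2 ^ word_size S"
    and disj: "src + N \<le> dst \<or> dst + N \<le> src"
    and T: "6 * N + 1 \<le> T"
  shows "ends S copy_prog \<rho> \<mu> T (\<lambda>\<rho>' \<mu>'.
    \<mu>' = (\<lambda>x. if dst \<le> x \<and> x < dst + N then \<mu> (src + (x - dst)) else \<mu> x) \<and>
    \<rho>' 15 = dst + N \<and> \<rho>' 16 = src + N \<and> (\<forall>r<15. \<rho>' r = \<rho> r))"
  unfolding copy_prog_def
proof (rule ends_Loop[where N = N and t = 5 and I = "\<lambda>i \<rho>' \<mu>'.
    \<mu>' = (\<lambda>x. if dst \<le> x \<and> x < dst + i then \<mu> (src + (x - dst)) else \<mu> x) \<and>
    \<rho>' 15 = dst + i \<and> \<rho>' 16 = src + i \<and> \<rho>' 17 = N - i \<and> (\<forall>r<15. \<rho>' r = \<rho> r)"], goal_cases)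
  case 1
  show ?case using assms by auto
next
  case (2 i \<rho>' \<mu>')
  then have [simp]: "\<rho>' 15 = dst + i" "\<rho>' 16 = src + i" "\<rho>' 17 = N - i" "\<rho>' 3 = 1"
    using assms(1) by auto
  have "\<mu>' (src + i) = \<mu> (src + i)" using 2 disj by auto
  with 2 bounds show ?case
    apply (simp)
    apply (rule ends_basic, simp)+
    apply (auto simp: fun_eq_iff less_Suc_eq)
    done
qed (use T in auto)


text \<open>Once the rows are nodes, sorting moves only their addresses, so that the cost of a pass
  does not depend on the length of the keys. The three cells in front of a key are those that
  \<open>tree_at\<close> reads as links and count.\<close>

definition init_prog :: "com list" where
  "init_prog =
     [Bin Add 11 0 10, Bin Add 12 4 10, Const 13 3, Bin Add 15 7 10, Const 16 0,
      Loop 11 ([Store 12 15, Bin Add 15 15 13, Bin Add 17 1 10] @ copy_prog @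
        [Bin Add 12 12 3, Bin Sub 11 11 3])]"

lemma ends_init_prog:
  assumes regs: "\<rho> 0 = n" "\<rho> 1 = l" "\<rho> 3 = 1" "\<rho> 4 = A" "\<rho> 7 = Q" "\<rho> 10 = 0"
    and w: "(3 :: nat) < 2 ^ word_size S" and A: "n * l \<le> A" "A + n \<le> Q"
    and Q: "Q + n * (l + 3) < 2 ^ word_size S"
    and T: "n * (6 * l + 8) + 6 \<le> T"
  shows "ends S init_prog \<rho> \<mu> T (\<lambda>\<rho>' \<mu>'. (\<forall>r<11. \<rho>' r = \<rho> r) \<and>
    (\<forall>i<n. \<mu>' (A + i) = Q + i * (l + 3)) \<and>
    (\<forall>i<n. \<forall>j<l. \<mu>' (Q + i * (l + 3) + 3 + j) = \<mu> (i * l + j)) \<and>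
    (\<forall>x. x < A \<or> A + n \<le> x \<and> x < Q \<longrightarrow> \<mu>' x = \<mu> x))"
proof -
  define I where "I = (\<lambda>i \<rho>' \<mu>'. (\<forall>r<11. \<rho>' r = \<rho> r) \<and>
    \<rho>' 11 = n - i \<and> \<rho>' 12 = A + i \<and> \<rho>' 13 = 3 \<and> \<rho>' 15 = Q + i * (l + 3) \<and> \<rho>' 16 = i * l \<and>
    (\<forall>i'<i. \<mu>' (A + i') = Q + i' * (l + 3)) \<and>
    (\<forall>i'<i. \<forall>j<l. \<mu>' (Q + i' * (l + 3) + 3 + j) = \<mu> (i' * l + j)) \<and>
    (\<forall>x. x < A \<or> A + n \<le> x \<and> x < Q \<longrightarrow> \<mu>' x = \<mu> x))"
  have nQ: "n \<le> Q" "Q < 2 ^ word_size S" using A Q by auto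
  have body: "\<rho>1 11 \<noteq> 0 \<and> ends S ([Store 12 15, Bin Add 15 15 13, Bin Add 17 1 10] @ copy_prog @
        [Bin Add 12 12 3, Bin Sub 11 11 3]) \<rho>1 \<mu>1 (6 * l + 6) (I (Suc i))"
    if i: "i < n" and I: "I i \<rho>1 \<mu>1" for i \<rho>1 \<mu>1
  proof -
    have "Suc i * (l + 3) \<le> n * (l + 3)" "Suc i * l \<le> n * l"
      using i by (meson Suc_leI mult_le_mono1)+
    then have il': "i * (l + 3) + l + 3 \<le> n * (l + 3)" "i * l + l \<le> n * l" by simp_all
    have b: "i * l + l \<le> A" "Q + i * (l + 3) + 3 + l < 2 ^ word_size S" "i * l + l < 2 ^ word_size S"
      "Q + i * (l + 3) + 3 < 2 ^ word_size S" "A + i < Q"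
      using il' A Q i by linarith+
    have [simp]: "\<rho>1 11 = n - i" "\<rho>1 12 = A + i" "\<rho>1 13 = 3" "\<rho>1 15 = Q + i * (l + 3)"
      "\<rho>1 16 = i * l" "\<rho>1 1 = l" "\<rho>1 3 = 1" "\<rho>1 10 = 0"
      using I regs by (simp_all add: I_def)
    have lw: "l < 2 ^ word_size S" using b by linarith
    let ?\<mu> = "\<mu>1(A + i := Q + i * (l + 3))"
    let ?\<rho> = "\<rho>1(15 := Q + i * (l + 3) + 3, 17 := l)"
    have "ends S copy_prog ?\<rho> ?\<mu> (6 * l + 1) (\<lambda>\<rho>' \<mu>'.
        ends S [Bin Add 12 12 3, Bin Sub 11 11 3] \<rho>' \<mu>' (6 * l + 3 - (6 * l + 1)) (I (Suc i)))"
    proof (rule ends_mono[OF ends_copy_prog[where N = l and dst = "Q + i * (l + 3) + 3"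
              and src = "i * l", OF _ _ _ _ _ _ _ order_refl]])
      fix \<rho>2 \<mu>2
      assume 2: "\<mu>2 = (\<lambda>x. if Q + i * (l + 3) + 3 \<le> x \<and> x < Q + i * (l + 3) + 3 + l
            then ?\<mu> (i * l + (x - (Q + i * (l + 3) + 3))) else ?\<mu> x) \<and>
         \<rho>2 15 = Q + i * (l + 3) + 3 + l \<and> \<rho>2 16 = i * l + l \<and> (\<forall>r<15. \<rho>2 r = ?\<rho> r)"
      have 3: "\<mu>2 (A + i') = Q + i' * (l + 3)" if "i' < Suc i" for i'
        using 2 b I that by (auto simp: I_def less_Suc_eq)
      have 4: "\<mu>2 (Q + i' * (l + 3) + 3 + j) = \<mu> (i' * l + j)" if "i' < Suc i" "j < l" for i' j
      proof (cases "i' = i")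
        case True
        then have "\<mu>2 (Q + i' * (l + 3) + 3 + j) = ?\<mu> (i * l + j)" using 2 that by simp
        also have "\<dots> = \<mu> (i * l + j)" using I b that by (simp add: I_def)
        finally show ?thesis using True by simp
      next
        case False
        with that have "Suc i' * (l + 3) \<le> i * (l + 3)" by (intro mult_le_mono1) simp
        then have "i' * (l + 3) + 3 + j < i * (l + 3)" using that by simp
        then have "\<mu>2 (Q + i' * (l + 3) + 3 + j) = \<mu>1 (Q + i' * (l + 3) + 3 + j)"
          using 2 b by simp
        then show ?thesis using I that False by (simp add: I_def)
      qed
      have "I (Suc i) (\<rho>2(12 := A + Suc i, 11 := n - Suc i)) \<mu>2"
        using 2 I b i 3 4 by (auto simp: I_def algebra_simps)
      moreover have "\<rho>2 12 = A + i" "\<rho>2 11 = n - i" "\<rho>2 3 = 1" using 2 by simp_all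
      ultimately show "ends S [Bin Add 12 12 3, Bin Sub 11 11 3] \<rho>2 \<mu>2 (6 * l + 3 - (6 * l + 1)) (I (Suc i))"
        using b nQ i
        apply simp
        apply (rule ends_basic, simp)+
        apply (simp add: fun_upd_twist flip: Suc_eq_plus1)
        done
    qed (use b in auto)
    then have "ends S (copy_prog @ [Bin Add 12 12 3, Bin Sub 11 11 3]) ?\<rho> ?\<mu> (6 * l + 3) (I (Suc i))"
      by (rule ends_append) simp
    then show ?thesis using i b lw
      apply simp
      apply (rule ends_basic, simp)+
      apply (simp add: fun_upd_twist add.commute)
      done
  qed
  have "ends S [Loop 11 ([Store 12 15, Bin Add 15 15 13, Bin Add 17 1 10] @ copy_prog @
        [Bin Add 12 12 3, Bin Sub 11 11 3])]
      (\<rho>(11 := n, 12 := A, 13 := 3, 15 := Q, 16 := 0)) \<mu> (T - 5) (\<lambda>\<rho>' \<mu>'. (\<forall>r<11. \<rho>' r = \<rho> r) \<and>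
    (\<forall>i<n. \<mu>' (A + i) = Q + i * (l + 3)) \<and>
    (\<forall>i<n. \<forall>j<l. \<mu>' (Q + i * (l + 3) + 3 + j) = \<mu> (i * l + j)) \<and>
    (\<forall>x. x < A \<or> A + n \<le> x \<and> x < Q \<longrightarrow> \<mu>' x = \<mu> x))"
  proof (rule ends_Loop[where N = n and t = "6 * l + 6" and I = I, OF _ body])
    show "n * (6 * l + 6 + 1) + 1 \<le> T - 5" using T by (simp add: algebra_simps)
  qed (auto simp: I_def)
  then show ?thesis
    unfolding init_prog_def using T regs w A Q nQ
    apply -
    apply (rule ends_basic, simp)+
    apply (simp add: algebra_simps)
    done
qed

section \<open>Radix sort: stable partition by one bit, then all bits of a word, then all
  words\<close>

lemma ends_cong:
  assumes "ends S P \<rho> \<mu> T Q" "\<rho> = \<rho>'" "\<mu> = \<mu>'" "T = T'"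
  shows "ends S P \<rho>' \<mu>' T' Q"
  using assms by simp

lemma list_at_snoc: "list_at \<mu> a (xs @ [x]) \<longleftrightarrow> list_at \<mu> a xs \<and> \<mu> (a + length xs) = x"
  by (simp add: list_at_append) (simp add: list_at_def)

text \<open>The parameter is a register holding the wanted bit. Registers 10 and 3 hold the
  constants 0 and 1, so the same code extracts both halves of a partition.\<close>

definition filter_prog :: "register \<Rightarrow> com list" where
  "filter_prog f =
     [Bin Add 16 4 10, Bin Add 17 0 10,
      Loop 17
        [Load 18 16, Bin Add 19 18 12, Load 19 19, Bin Shr 19 19 14, Bin And 20 19 3,
         Bin Shr 19 19 3, Bin Or 13 13 19, Bin Eq 20 20 f,
         Cond 20 [Store 15 18, Bin Add 15 15 3] [],
         Bin Add 16 16 3, Bin Sub 17 17 3]]"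

text \<open>\<open>Z\<close> separates the output cells from the key words. No key is overwritten
  during the scan, which is why the bits can be stated in terms of the initial memory.\<close>

lemma ends_filter_prog:
  fixes S
  defines "W \<equiv> 2 ^ word_size S"
  assumes regs: "\<rho> 0 = n" "\<rho> 3 = 1" "\<rho> 4 = A" "\<rho> 10 = 0" "\<rho> 12 = off" "\<rho> 14 = i" "\<rho> 15 = T"
    and f: "f < 11" "\<rho> f = g" and ps: "list_at \<mu> A ps" "length ps = n"
    and bounds: "A + n \<le> B" "B \<le> T" "T + length (filter (\<lambda>p. drop_bit i (\<mu> (p + off)) mod 2 =
        g) ps) \<le> Z" "Z < W"
    and addr: "\<And>p. p \<in> set ps \<Longrightarrow> Z \<le> p + off \<and> p + off < W"
    and time: "14 * n + 3 \<le> t"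
  shows "ends S (filter_prog f) \<rho> \<mu> t (\<lambda>\<rho>' \<mu>'.
    (let os = filter (\<lambda>p. drop_bit i (\<mu> (p + off)) mod 2 = g) ps in
     list_at \<mu>' T os \<and> (\<forall>x. x < T \<or> T + length os \<le> x \<longrightarrow> \<mu>' x = \<mu> x) \<and>
     \<rho>' 15 = T + length os \<and> (\<forall>r<13. \<rho>' r = \<rho> r) \<and> \<rho>' 14 = \<rho> 14 \<and>
     (\<rho>' 13 = 0 \<longleftrightarrow> \<rho> 13 = 0 \<and> (\<forall>p\<in>set ps. drop_bit (Suc i) (\<mu> (p + off)) = 0))))"
proof -
  define os where "os = (\<lambda>k. filter (\<lambda>p. drop_bit i (\<mu> (p + off)) mod 2 = g) (take k ps))"
  have os_le: "length (os k) \<le> length (os n)" for k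
  proof -
    have "os n = os k @ filter (\<lambda>p. drop_bit i (\<mu> (p + off)) mod 2 = g) (drop k ps)"
      using ps(2) by (simp add: os_def flip: filter_append)
    then show ?thesis by simp
  qed
  define I where "I = (\<lambda>k \<rho>' \<mu>'. list_at \<mu>' T (os k) \<and>
     (\<forall>x. x < T \<or> T + length (os k) \<le> x \<longrightarrow> \<mu>' x = \<mu> x) \<and>
     \<rho>' 15 = T + length (os k) \<and> \<rho>' 16 = A + k \<and> \<rho>' 17 = n - k \<and>
     (\<forall>r<13. \<rho>' r = \<rho> r) \<and> \<rho>' 14 = \<rho> 14 \<and>
     (\<rho>' 13 = 0 \<longleftrightarrow> \<rho> 13 = 0 \<and> (\<forall>p\<in>set (take k ps). drop_bit (Suc i) (\<mu> (p + off)) = 0)))"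
  have W: "T + length (os k) \<le> Z" for k using bounds(3) os_le[of k] ps(2) by (simp add: os_def)
  have body: "\<rho>1 17 \<noteq> 0 \<and> ends S
        [Load 18 16, Bin Add 19 18 12, Load 19 19, Bin Shr 19 19 14, Bin And 20 19 3,
         Bin Shr 19 19 3, Bin Or 13 13 19, Bin Eq 20 20 f,
         Cond 20 [Store 15 18, Bin Add 15 15 3] [],
         Bin Add 16 16 3, Bin Sub 17 17 3] \<rho>1 \<mu>1 13 (I (Suc k))"
    if k: "k < n" and I: "I k \<rho>1 \<mu>1" for k \<rho>1 \<mu>1
  proof -
    define p where "p = ps ! k"
    define v where "v = \<mu> (p + off)"
    have p: "p \<in> set ps" using k ps by (simp add: p_def)
    have take: "take (Suc k) ps = take k ps @ [p]" using k ps by (simp add: take_Suc_conv_app_nth p_def)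
    have os: "os (Suc k) = os k @ (if drop_bit i v mod 2 = g then [p] else [])"
      by (simp add: os_def take v_def)
    have [simp]: "\<rho>1 15 = T + length (os k)" "\<rho>1 16 = A + k" "\<rho>1 17 = n - k" "\<rho>1 3 = 1"
        "\<rho>1 12 = off" "\<rho>1 14 = i" "\<rho>1 f = g"
      using I regs f by (simp_all add: I_def)
    have [simp]: "\<mu>1 (A + k) = p"
      using I bounds k ps by (simp add: I_def list_at_def p_def)
    have [simp]: "\<mu>1 (p + off) = v" using I W[of k] addr[OF p] by (simp add: I_def v_def)
    have b: "p + off < W" "A + k + 1 < W" "T + length (os (Suc k)) < W" "n < W" "A + k < T"
      using addr[OF p] bounds W[of "Suc k"] k by linarith+
    have W1: "1 < W" using b(2) by linarith
    define \<rho>2 where "\<rho>2 = \<rho>1(18 := p, 19 := drop_bit 1 (drop_bit i v),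
        13 := Bit_Operations.or (\<rho>1 13) (drop_bit 1 (drop_bit i v)),
        20 := if drop_bit i v mod 2 = g then 1 else 0)"
    have \<rho>2: "\<rho>2 20 = (if drop_bit i v mod 2 = g then 1 else 0)" "\<rho>2 15 = T + length (os k)"
       "\<rho>2 18 = p" "\<rho>2 16 = A + k" "\<rho>2 17 = n - k" "\<rho>2 3 = 1" "\<rho>2 14 = i" "\<forall>r<13. \<rho>2 r = \<rho> r"
       "\<rho>2 13 = 0 \<longleftrightarrow> \<rho> 13 = 0 \<and> (\<forall>p\<in>set (take (Suc k) ps). drop_bit (Suc i) (\<mu> (p + off)) = 0)"
      using I by (auto simp: \<rho>2_def I_def take v_def or_eq_0_iff simp flip: Suc_eq_plus1_left)
    have E: "ends S [Cond 20 [Store 15 18, Bin Add 15 15 3] [], Bin Add 16 16 3, Bin Sub 17 17 3]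
        \<rho>2 \<mu>1 5 (I (Suc k))"
    proof (cases "drop_bit i v mod 2 = g")
      case True
      have "I (Suc k) (\<rho>2(15 := T + length (os k) + 1, 16 := A + k + 1, 17 := n - k - 1))
          (\<mu>1(T + length (os k) := p))"
      proof -
        have "list_at (\<mu>1(T + length (os k) := p)) T (os k)"
          using I by (auto simp: I_def intro: list_at_cong[of \<mu>1])
        then show ?thesis using I True \<rho>2 by (simp add: I_def os list_at_snoc)
      qed
      then show ?thesis using \<rho>2 b True k os unfolding W_def
        apply -
        apply (rule ends_Cond, simp, simp)
        apply (rule ends_basic, simp)+
        apply simp
        done
    next
      case False
      have "I (Suc k) (\<rho>2(16 := A + k + 1, 17 := n - k - 1)) \<mu>1"
        using I False \<rho>2 by (auto simp: I_def os regs)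
      then show ?thesis using \<rho>2 b False k os unfolding W_def
        apply -
        apply (rule ends_Cond, simp, simp)
        apply (rule ends_basic, simp)+
        apply simp
        done
    qed
    show ?thesis using k b(1) W1 f unfolding W_def
      apply simp
      apply (rule ends_basic, simp)+
      apply (rule ends_cong[OF E])
      apply (auto simp: \<rho>2_def fun_eq_iff and_one_eq)
      done
  qed
  have "ends S [Loop 17
        [Load 18 16, Bin Add 19 18 12, Load 19 19, Bin Shr 19 19 14, Bin And 20 19 3,
         Bin Shr 19 19 3, Bin Or 13 13 19, Bin Eq 20 20 f,
         Cond 20 [Store 15 18, Bin Add 15 15 3] [],
         Bin Add 16 16 3, Bin Sub 17 17 3]] (\<rho>(16 := A, 17 := n)) \<mu> (t - 2) (I n)"
    by (rule ends_Loop[where N = n and t = 13 and I = I, OF _ body])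
       (use time in \<open>auto simp: I_def os_def regs list_at_def\<close>)
  then have "ends S (filter_prog f) \<rho> \<mu> t (I n)"
    using time regs bounds unfolding filter_prog_def W_def
    apply -
    apply (rule ends_basic, simp)+
    apply simp
    done
  then show ?thesis
    by (rule ends_mono) (auto simp: I_def os_def ps(2) Let_def)
qed


text \<open>Register 15 is not reset between the two scans, so the second one appends the addresses
  with bit 1 behind those with bit 0.\<close>

definition radix_pass_prog :: "com list" where
  "radix_pass_prog =
     [Bin Add 13 10 10, Bin Add 15 5 10] @ filter_prog 10 @ filter_prog 3 @
     [Bin Add 15 4 10, Bin Add 16 5 10, Bin Add 17 0 10] @ copy_prog @ [Bin Add 14 14 3]"

lemma ends_radix_pass_prog:
  fixes S
  defines "W \<equiv> 2 ^ word_size S"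
  assumes regs: "\<rho> 0 = n" "\<rho> 3 = 1" "\<rho> 4 = A" "\<rho> 5 = T" "\<rho> 10 = 0" "\<rho> 12 = off" "\<rho> 14 = i"
    and ps: "list_at \<mu> A ps" "length ps = n"
    and bounds: "A + n \<le> T" "T + n < W" "Suc i < W"
    and addr: "\<And>p. p \<in> set ps \<Longrightarrow> T + n \<le> p + off \<and> p + off < W"
    and time: "34 * n + 13 \<le> t"
  shows "ends S radix_pass_prog \<rho> \<mu> t (\<lambda>\<rho>' \<mu>'.
     list_at \<mu>' A (filter (\<lambda>p. drop_bit i (\<mu> (p + off)) mod 2 = 0) ps @
                 filter (\<lambda>p. drop_bit i (\<mu> (p + off)) mod 2 = 1) ps) \<and>
     (\<forall>x. x < A \<or> A + n \<le> x \<and> x < T \<or> T + n \<le> x \<longrightarrow> \<mu>' x = \<mu> x) \<and>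
     \<rho>' 14 = Suc i \<and> (\<forall>r<13. \<rho>' r = \<rho> r) \<and>
     (\<rho>' 13 = 0 \<longleftrightarrow> (\<forall>p\<in>set ps. drop_bit (Suc i) (\<mu> (p + off)) = 0)))" (is "ends _ _ _ _ _ ?Q")
proof -
  define F where "F = (\<lambda>g. filter (\<lambda>p. drop_bit i (\<mu> (p + off)) mod 2 = g) ps)"
  have "length (F 0) + length (filter (\<lambda>p. \<not> drop_bit i (\<mu> (p + off)) mod 2 = 0) ps) = n"
    unfolding F_def ps(2)[symmetric] by (rule sum_length_filter_compl)
  then have len: "length (F 0) + length (F 1) = n" by (simp add: F_def)
  have W: "n < W" "A + n < W" using bounds by auto
  let ?\<rho> = "\<rho>(13 := 0, 15 := T)"
  have ends2: "ends S (filter_prog 3 @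
     [Bin Add 15 4 10, Bin Add 16 5 10, Bin Add 17 0 10] @ copy_prog @
         [Bin Add 14 14 3]) \<rho>1 \<mu>1 (20 * n + 8) ?Q"
    if 1: "list_at \<mu>1 T (F 0)" "\<And>x. x < T \<or> T + length (F 0) \<le> x \<Longrightarrow> \<mu>1 x = \<mu> x"
      "\<rho>1 15 = T + length (F 0)" "\<forall>r<13. \<rho>1 r = \<rho> r" "\<rho>1 14 = i"
      "\<rho>1 13 = 0 \<longleftrightarrow> (\<forall>p\<in>set ps. drop_bit (Suc i) (\<mu> (p + off)) = 0)" for \<rho>1 \<mu>1
  proof -
    \<comment> \<open>The first scan writes only below \<open>T + n\<close> and the key words lie
      above, so both scans split by the same bits.\<close>
    have eq: "\<mu>1 (p + off) = \<mu> (p + off)" if "p \<in> set ps" for p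
      using addr[OF that] len by (intro 1(2)) simp
    have F1: "filter (\<lambda>p. drop_bit i (\<mu>1 (p + off)) mod 2 = 1) ps = F 1"
      unfolding F_def using eq by (intro filter_cong) simp_all
    have ends3: "ends S ([Bin Add 15 4 10, Bin Add 16 5 10, Bin Add 17 0 10] @ copy_prog @ [Bin Add 14 14 3])
        \<rho>2 \<mu>2 (6 * n + 5) ?Q"
      if 2: "list_at \<mu>2 T (F 0 @ F 1)" "\<And>x. x < T \<or> T + n \<le> x \<Longrightarrow> \<mu>2 x = \<mu> x"
        "\<forall>r<13. \<rho>2 r = \<rho> r" "\<rho>2 14 = i"
        "\<rho>2 13 = 0 \<longleftrightarrow> (\<forall>p\<in>set ps. drop_bit (Suc i) (\<mu> (p + off)) = 0)" for \<rho>2 \<mu>2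
    proof -
      let ?\<rho> = "\<rho>2(15 := A, 16 := T, 17 := n)"
      have "ends S copy_prog ?\<rho> \<mu>2 (6 * n + 1) (\<lambda>\<rho>' \<mu>'.
          ends S [Bin Add 14 14 3] \<rho>' \<mu>' (6 * n + 2 - (6 * n + 1)) ?Q)"
      proof (rule ends_mono[OF ends_copy_prog[where dst = A and src = T and N = n,
          OF _ _ _ _ _ _ _ order_refl]])
        fix \<rho>3 \<mu>3
        assume 3: "\<mu>3 = (\<lambda>x. if A \<le> x \<and> x < A + n then \<mu>2 (T + (x - A)) else \<mu>2 x) \<and>
           \<rho>3 15 = A + n \<and> \<rho>3 16 = T + n \<and> (\<forall>r<15. \<rho>3 r = ?\<rho> r)"
        have "list_at \<mu>3 A (F 0 @ F 1)"
          using 2(1) 3 len by (simp add: list_at_def)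
        moreover have "\<mu>3 x = \<mu> x" if "x < A \<or> A + n \<le> x \<and> x < T \<or> T + n \<le> x" for x
          using 2(2)[of x] 3 that bounds by auto
        moreover have "\<rho>3 r = \<rho> r" if "r < 13" for r
          using 3 2(3) that by simp
        moreover have "\<rho>3 13 = \<rho>2 13" "\<rho>3 14 = i" "\<rho>3 3 = 1" using 3 2 regs by simp_all
        ultimately show "ends S [Bin Add 14 14 3] \<rho>3 \<mu>3 (6 * n + 2 - (6 * n + 1)) ?Q"
          using bounds(3) unfolding W_def
          apply -
          apply (rule ends_basic, simp)
          apply (simp add: F_def 2(5))
          done
      qed (use 2(3) regs bounds W in \<open>auto simp: W_def\<close>)
      then have "ends S (copy_prog @ [Bin Add 14 14 3]) ?\<rho> \<mu>2 (6 * n + 2) ?Q"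
        by (rule ends_append) simp
      then show ?thesis using 2(3) regs bounds W unfolding W_def
        apply simp
        apply (rule ends_basic, simp)+
        apply (simp add: add.commute)
        done
    qed
    show ?thesis
    proof (rule ends_append[OF ends_mono[OF ends_filter_prog[where ps = ps and n = n and A = A and T = "\<rho>1 15"
          and B = T and Z = "T + n" and f = 3 and g = 1 and off = off and i = i,
              OF _ _ _ _ _ _ _ _ _ _ _ _ _ _ _ _ order_refl] order_refl]])
      show "list_at \<mu>1 A ps"
        using ps bounds by (intro list_at_cong[OF ps(1)] 1(2)) simp
      show "\<rho>1 15 + length (filter (\<lambda>p. drop_bit i (\<mu>1 (p + off)) mod 2 = 1) ps) \<le> T + n"
        using len by (simp only: F1 1(3))
      show "p \<in> set ps \<Longrightarrow> T + n \<le> p + off \<and> p + off < 2 ^ word_size S" for p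
        using addr W_def by simp
    next
      fix \<rho>2 \<mu>2
      assume "let os = filter (\<lambda>p. drop_bit i (\<mu>1 (p + off)) mod 2 = 1) ps in
         list_at \<mu>2 (\<rho>1 15) os \<and> (\<forall>x. x < \<rho>1 15 \<or> \<rho>1 15 + length os \<le> x \<longrightarrow> \<mu>2 x = \<mu>1 x) \<and>
         \<rho>2 15 = \<rho>1 15 + length os \<and> (\<forall>r<13. \<rho>2 r = \<rho>1 r) \<and> \<rho>2 14 = \<rho>1 14 \<and>
         (\<rho>2 13 = 0 \<longleftrightarrow> \<rho>1 13 = 0 \<and> (\<forall>p\<in>set ps. drop_bit (Suc i) (\<mu>1 (p + off)) = 0))"
      then have 2: "list_at \<mu>2 (T + length (F 0)) (F 1)"
         "\<And>x. x < T + length (F 0) \<or> T + n \<le> x \<Longrightarrow> \<mu>2 x = \<mu>1 x"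
         "\<And>r. r<13 \<Longrightarrow> \<rho>2 r = \<rho>1 r" "\<rho>2 14 = \<rho>1 14"
         "\<rho>2 13 = 0 \<longleftrightarrow> \<rho>1 13 = 0 \<and> (\<forall>p\<in>set ps. drop_bit (Suc i) (\<mu> (p + off)) = 0)"
        using len by (auto simp: F1 1(3) eq Let_def add.assoc)
      have "list_at \<mu>2 T (F 0)" by (rule list_at_cong[OF 1(1) 2(2)]) simp
      then have "ends S ([Bin Add 15 4 10, Bin Add 16 5 10, Bin Add 17 0 10] @ copy_prog @ [Bin Add 14 14 3])
          \<rho>2 \<mu>2 (6 * n + 5) ?Q"
        using 1 2 len by (intro ends3) (auto simp: list_at_append)
      then show "ends S ([Bin Add 15 4 10, Bin Add 16 5 10, Bin Add 17 0 10] @ copy_prog @ [Bin Add 14 14 3])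
          \<rho>2 \<mu>2 (20 * n + 8 - (14 * n + 3)) ?Q" by (rule ends_mono) simp_all
    qed (use 1 regs ps bounds in \<open>auto simp: W_def\<close>)
  qed
  have "ends S (filter_prog 10 @ filter_prog 3 @
     [Bin Add 15 4 10, Bin Add 16 5 10, Bin Add 17 0 10] @ copy_prog @
         [Bin Add 14 14 3]) ?\<rho> \<mu> (34 * n + 11) ?Q"
  proof (rule ends_append[OF ends_mono[OF ends_filter_prog[where ps = ps and n = n and A = A and T = T
          and B = T and Z = "T + n" and f = 10 and g = 0 and off = off and i = i,
              OF _ _ _ _ _ _ _ _ _ _ _ _ _ _ _ _ order_refl] order_refl]])
    show "list_at \<mu> A ps" by (rule ps)
    show "T + length (filter (\<lambda>p. drop_bit i (\<mu> (p + off)) mod 2 = 0) ps) \<le> T + n"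
      using len by (simp add: F_def)
    show "p \<in> set ps \<Longrightarrow> T + n \<le> p + off \<and> p + off < 2 ^ word_size S" for p
      using addr W_def by simp
  next
    fix \<rho>1 \<mu>1
    assume "let os = filter (\<lambda>p. drop_bit i (\<mu> (p + off)) mod 2 = 0) ps in
         list_at \<mu>1 T os \<and> (\<forall>x. x < T \<or> T + length os \<le> x \<longrightarrow> \<mu>1 x = \<mu> x) \<and>
         \<rho>1 15 = T + length os \<and> (\<forall>r<13. \<rho>1 r = ?\<rho> r) \<and> \<rho>1 14 = ?\<rho> 14 \<and>
         (\<rho>1 13 = 0 \<longleftrightarrow> ?\<rho> 13 = 0 \<and> (\<forall>p\<in>set ps. drop_bit (Suc i) (\<mu> (p + off)) = 0))"
    then have "ends S (filter_prog 3 @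
     [Bin Add 15 4 10, Bin Add 16 5 10, Bin Add 17 0 10] @ copy_prog @
         [Bin Add 14 14 3]) \<rho>1 \<mu>1 (20 * n + 8) ?Q"
      using regs by (intro ends2) (auto simp: F_def Let_def)
    then show "ends S (filter_prog 3 @
     [Bin Add 15 4 10, Bin Add 16 5 10, Bin Add 17 0 10] @ copy_prog @ [Bin Add 14 14 3]) \<rho>1 \<mu>1
       (34 * n + 11 - (14 * n + 3)) ?Q"
      by (rule ends_mono) simp_all
  qed (use regs ps bounds in \<open>auto simp: W_def\<close>)
  then have "ends S (filter_prog 10 @ filter_prog 3 @
     [Bin Add 15 4 10, Bin Add 16 5 10, Bin Add 17 0 10] @ copy_prog @ [Bin Add 14 14 3]) ?\<rho> \<mu> (t - 2) ?Q"
    by (rule ends_mono) (use time in auto)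
  then show ?thesis using bounds regs time unfolding radix_pass_prog_def W_def
    apply simp
    apply (rule ends_basic, simp)+
    apply simp
    done
qed

text \<open>Register 13 accumulates the disjunction of the words shifted by the bits already sorted; it
  starts at 1 so that at least one pass is made.\<close>

definition radix_word_prog :: "com list" where
  "radix_word_prog =
     [Bin Add 13 3 10, Bin Add 14 10 10, Loop 13 radix_pass_prog, Bin Add 12 12 3, Bin Sub 11 11 3]"

definition radix_prog :: "com list" where
  "radix_prog = [Bin Add 11 1 10, Const 12 3, Loop 11 radix_word_prog]"

text \<open>Correctness of one pass of least-significant-digit sorting: filtering preserves the old
  order within each half, and the new digit dominates because \<open>M\<close> exceeds everything
  sorted so far.\<close>

lemma sorted_map_filter_append:
  fixes f :: "'a \<Rightarrow> nat"
  assumes "sorted (map f xs)" "\<And>x. x \<in> set xs \<Longrightarrow> f x < M"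
  shows "sorted (map (\<lambda>x. f x + M * b x) (filter (\<lambda>x. b x = 0) xs @ filter (\<lambda>x. b x = 1) xs))"
proof -
  have "sorted (map (\<lambda>x. f x + M * b x) (filter (\<lambda>x. b x = k) xs))" for k
    using sorted_filter[OF assms(1), of "\<lambda>x. b x = k"]
    unfolding sorted_wrt_map by (rule sorted_wrt_mono_rel[rotated]) simp
  then show ?thesis using assms(2) by (fastforce simp: sorted_append)
qed

lemma mod_power_Suc: "v mod 2 ^ Suc i = v mod 2 ^ i + 2 ^ i * (drop_bit i v mod 2)" for v :: nat
  using mod_mult2_eq[of v "2 ^ i" 2] by (simp add: drop_bit_eq_div mult.commute add.commute)

text \<open>\<open>f\<close> stands for the value of the less significant words, by which the
  addresses are already sorted. After \<open>i\<close> passes they are sorted by \<open>f\<close>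
  together with the low \<open>i\<close> bits of the current word, the next bit having weight
  \<open>M * 2 ^ i\<close>.\<close>

lemma ends_radix_word_prog:
  fixes S and f :: "nat \<Rightarrow> nat"
  defines "W \<equiv> 2 ^ word_size S"
  assumes regs: "\<rho> 0 = n" "\<rho> 3 = 1" "\<rho> 4 = A" "\<rho> 5 = T" "\<rho> 10 = 0" "\<rho> 11 = c" "\<rho> 12 = off"
    and ps: "list_at \<mu> A ps" "length ps = n"
    and bounds: "A + n \<le> T" "T + n < W" "B < W" "1 \<le> B" "off + 1 < W" "0 < c" "c < W"
    and addr: "\<And>p. p \<in> set ps \<Longrightarrow> T + n \<le> p + off \<and> p + off < W"
    and v: "\<And>p. p \<in> set ps \<Longrightarrow> \<mu> (p + off) < 2 ^ B"
    and f: "sorted (map f ps)" "\<And>p. p \<in> set ps \<Longrightarrow> f p < M"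
    and time: "B * (34 * n + 14) + 5 \<le> t"
  shows "ends S radix_word_prog \<rho> \<mu> t (\<lambda>\<rho>' \<mu>'.
     (\<exists>ps'. list_at \<mu>' A ps' \<and> mset ps' = mset ps \<and> sorted (map (\<lambda>p. f p + M * \<mu> (p + off)) ps')) \<and>
     (\<forall>x. x < A \<or> A + n \<le> x \<and> x < T \<or> T + n \<le> x \<longrightarrow> \<mu>' x = \<mu> x) \<and>
     (\<forall>r<11. \<rho>' r = \<rho> r) \<and> \<rho>' 11 = c - 1 \<and> \<rho>' 12 = off + 1)" (is "ends _ _ _ _ _ ?Q")
proof -
  define Z where "Z = (\<lambda>i. \<forall>p\<in>set ps. drop_bit i (\<mu> (p + off)) = 0)"
  have ZB: "1 \<le> B \<and> Z B" using bounds(4) v by (auto simp: Z_def drop_bit_eq_div)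
  \<comment> \<open>The number of passes depends on the data: passes stop once no word has a bit at
    position \<open>N\<close> or above. At least one pass is made, whence the lower bound 1;
    \<open>B\<close> merely bounds \<open>N\<close>.\<close>
  define N where "N = (LEAST i. 1 \<le> i \<and> Z i)"
  have N: "1 \<le> N" "Z N" "N \<le> B"
    using LeastI[of "\<lambda>i. 1 \<le> i \<and> Z i", OF ZB] Least_le[of "\<lambda>i. 1 \<le> i \<and> Z i", OF ZB] by (auto simp: N_def)
  have notZ: "\<not> Z i" if "1 \<le> i" "i < N" for i
    using not_less_Least[of i "\<lambda>i. 1 \<le> i \<and> Z i"] that by (auto simp: N_def)
  define I where "I = (\<lambda>i \<rho>' \<mu>'.
     (\<exists>ps'. list_at \<mu>' A ps' \<and> mset ps' = mset ps \<and> sorted (map (\<lambda>p. f p + M * (\<mu> (p + off) mod 2 ^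
         i)) ps')) \<and>
     (\<forall>x. x < A \<or> A + n \<le> x \<and> x < T \<or> T + n \<le> x \<longrightarrow> \<mu>' x = \<mu> x) \<and>
     (\<forall>r<13. \<rho>' r = \<rho> r) \<and> \<rho>' 14 = i \<and> (\<rho>' 13 = 0 \<longleftrightarrow> 1 \<le> i \<and> Z i))"
  have body: "\<rho>1 13 \<noteq> 0 \<and> ends S radix_pass_prog \<rho>1 \<mu>1 (34 * n + 13) (I (Suc i))"
    if i: "i < N" and I: "I i \<rho>1 \<mu>1" for i \<rho>1 \<mu>1
  proof
    show "\<rho>1 13 \<noteq> 0" using notZ[of i] i I by (auto simp: I_def)
    obtain ps' where ps': "list_at \<mu>1 A ps'" "mset ps' = mset ps"
      "sorted (map (\<lambda>p. f p + M * (\<mu> (p + off) mod 2 ^ i)) ps')"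
      using I by (auto simp: I_def)
    have set: "set ps' = set ps" and len: "length ps' = n"
      using ps'(2) ps(2) mset_eq_setD mset_eq_length by blast+
    have eq: "\<mu>1 (p + off) = \<mu> (p + off)" if "p \<in> set ps" for p
      using I addr[OF that] by (simp add: I_def)
    define g where "g = (\<lambda>p. drop_bit i (\<mu> (p + off)) mod 2)"
    have filter: "filter (\<lambda>p. drop_bit i (\<mu>1 (p + off)) mod 2 = k) ps' = filter (\<lambda>p. g p = k) ps'" for k
      unfolding g_def using eq set by (intro filter_cong) simp_all
    have "sorted (map (\<lambda>p. f p + M * (\<mu> (p + off) mod 2 ^ i) + (M * 2 ^ i) * g p)
       (filter (\<lambda>p. g p = 0) ps' @ filter (\<lambda>p. g p = 1) ps'))"
    proof (rule sorted_map_filter_append[OF ps'(3)])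
      fix p assume "p \<in> set ps'"
      then have "f p + M * (\<mu> (p + off) mod 2 ^ i) < M * (\<mu> (p + off) mod 2 ^ i + 1)"
        using f set by (simp add: algebra_simps)
      also have "\<dots> \<le> M * 2 ^ i"
        by (intro mult_le_mono2) (simp add: Suc_leI flip: Suc_eq_plus1)
      finally show "f p + M * (\<mu> (p + off) mod 2 ^ i) < M * 2 ^ i" .
    qed
    then have sorted: "sorted (map (\<lambda>p. f p + M * (\<mu> (p + off) mod 2 ^ Suc i))
       (filter (\<lambda>p. g p = 0) ps' @ filter (\<lambda>p. g p = 1) ps'))"
      unfolding g_def mod_power_Suc by (simp only: distrib_left mult.assoc add.assoc)
    have mset: "mset (filter (\<lambda>p. g p = 0) ps' @ filter (\<lambda>p. g p = 1) ps') = mset ps"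
    proof -
      have "filter (\<lambda>p. g p = 1) ps' = filter (\<lambda>p. \<not> g p = 0) ps'" by (simp add: g_def)
      then show ?thesis using ps'(2) by (simp flip: multiset_partition)
    qed
    show "ends S radix_pass_prog \<rho>1 \<mu>1 (34 * n + 13) (I (Suc i))"
    proof (rule ends_mono[OF ends_radix_pass_prog[where ps = ps' and n = n and A = A and T = T and off = off
            and i = i, OF _ _ _ _ _ _ _ _ _ _ _ _ _ order_refl] order_refl])
      fix \<rho>2 \<mu>2
      assume 2: "list_at \<mu>2 A (filter (\<lambda>p. drop_bit i (\<mu>1 (p + off)) mod 2 = 0) ps' @
                 filter (\<lambda>p. drop_bit i (\<mu>1 (p + off)) mod 2 = 1) ps') \<and>
         (\<forall>x. x < A \<or> A + n \<le> x \<and> x < T \<or> T + n \<le> x \<longrightarrow> \<mu>2 x = \<mu>1 x) \<and>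
         \<rho>2 14 = Suc i \<and> (\<forall>r<13. \<rho>2 r = \<rho>1 r) \<and>
         (\<rho>2 13 = 0 \<longleftrightarrow> (\<forall>p\<in>set ps'. drop_bit (Suc i) (\<mu>1 (p + off)) = 0))"
      then have "\<rho>2 13 = 0 \<longleftrightarrow> Z (Suc i)" by (simp add: Z_def eq set)
      moreover have "\<exists>ps'. list_at \<mu>2 A ps' \<and> mset ps' = mset ps \<and>
          sorted (map (\<lambda>p. f p + M * (\<mu> (p + off) mod 2 ^ Suc i)) ps')"
        using 2 sorted mset unfolding filter by blast
      ultimately show "I (Suc i) \<rho>2 \<mu>2" using 2 I by (simp add: I_def)
    qed (use I regs ps' bounds addr i N(3) in \<open>auto simp: I_def W_def set len\<close>)
  qed
  have "ends S [Loop 13 radix_pass_prog] (\<rho>(13 := 1, 14 := 0)) \<mu> (t - 4) (\<lambda>\<rho>' \<mu>'.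
      ends S [Bin Add 12 12 3, Bin Sub 11 11 3] \<rho>' \<mu>' 2 ?Q)"
  proof (rule ends_Loop[where N = N and t = "34 * n + 13" and I = I, OF _ body])
    show "I 0 (\<rho>(13 := 1, 14 := 0)) \<mu>" using ps f by (auto simp: I_def)
  next
    fix \<rho>1 \<mu>1 assume I: "I N \<rho>1 \<mu>1"
    obtain ps' where ps': "list_at \<mu>1 A ps'" "mset ps' = mset ps"
      "sorted (map (\<lambda>p. f p + M * (\<mu> (p + off) mod 2 ^ N)) ps')"
      using I by (auto simp: I_def)
    have "\<mu> (p + off) mod 2 ^ N = \<mu> (p + off)" if "p \<in> set ps'" for p
      using N(2) that mset_eq_setD[OF ps'(2)] by (simp add: Z_def drop_bit_eq_div div_eq_0_iff)
    then have "sorted (map (\<lambda>p. f p + M * \<mu> (p + off)) ps')" using ps'(3) by (simp cong: map_cong)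
    with ps' have "\<exists>ps'. list_at \<mu>1 A ps' \<and> mset ps' = mset ps \<and> sorted (map (\<lambda>p. f p + M * \<mu> (p + off)) ps')"
      by blast
    moreover have "\<rho>1 11 = c" "\<rho>1 12 = off" "\<rho>1 3 = 1" using I regs by (simp_all add: I_def)
    ultimately show "\<rho>1 13 = 0 \<and> ends S [Bin Add 12 12 3, Bin Sub 11 11 3] \<rho>1 \<mu>1 2 ?Q"
      using I N bounds unfolding W_def
      apply -
      apply (rule conjI, simp add: I_def)
      apply (rule ends_basic, simp)+
      apply (simp add: I_def)
      done
  next
    have "N * (34 * n + 14) \<le> B * (34 * n + 14)" using N(3) by (rule mult_le_mono1)
    moreover have "34 * n + 13 + 1 = 34 * n + 14" by simp
    ultimately show "N * (34 * n + 13 + 1) + 1 \<le> t - 4" using time by (simp only:)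
  qed
  then have "ends S [Loop 13 radix_pass_prog, Bin Add 12 12 3, Bin Sub 11 11 3] (\<rho>(13 := 1, 14 :=
      0)) \<mu> (t - 2) ?Q"
    by (rule ends_Cons[OF ends_mono[OF _ order_refl]]) (use time in \<open>auto elim: ends_mono\<close>)
  then show ?thesis using regs bounds time unfolding radix_word_prog_def W_def
    apply -
    apply (rule ends_basic, simp)+
    apply simp
    done
qed

text \<open>Iteration over the words: the number formed by the first \<open>j\<close> words is what
  the addresses are already sorted by, and it is below \<open>2 ^ (w * j)\<close>, which serves as
  the weight of the next word.\<close>

lemma ends_radix_prog:
  fixes S
  defines "W \<equiv> 2 ^ word_size S"
  assumes regs: "\<rho> 0 = n" "\<rho> 1 = l" "\<rho> 3 = 1" "\<rho> 4 = A" "\<rho> 5 = T" "\<rho> 10 = 0"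
    and ps: "list_at \<mu> A ps" "length ps = n"
    and bounds: "A + n \<le> T" "T + n < W" "B < W" "1 \<le> B" "l + 3 < W"
    and addr: "\<And>p. p \<in> set ps \<Longrightarrow> T + n \<le> p \<and> p + l + 3 < W"
    and v: "\<And>p j. p \<in> set ps \<Longrightarrow> j < l \<Longrightarrow> \<mu> (p + 3 + j) < 2 ^ B \<and> \<mu> (p + 3 + j) < W"
    and time: "l * (B * (34 * n + 14) + 6) + 3 \<le> t"
  shows "ends S radix_prog \<rho> \<mu> t (\<lambda>\<rho>' \<mu>'.
     (\<exists>ps'. list_at \<mu>' A ps' \<and> mset ps' = mset ps \<and>
        sorted (map (\<lambda>p. read_block (word_size S) l \<mu> (p + 3)) ps')) \<and>
     (\<forall>x. x < A \<or> A + n \<le> x \<and> x < T \<or> T + n \<le> x \<longrightarrow> \<mu>' x = \<mu> x) \<and>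
     (\<forall>r<11. \<rho>' r = \<rho> r))" (is "ends _ _ _ _ _ ?Q")
proof -
  let ?w = "word_size S"
  define key where "key = (\<lambda>j p. read_block ?w j \<mu> (p + 3))"
  have key_Suc: "key (Suc j) p = key j p + 2 ^ (?w * j) * \<mu> (p + 3 + j)" for j p
    by (simp add: key_def read_block_def mult.commute)
  have key_less: "key j p < 2 ^ (?w * j)" if "p \<in> set ps" "j \<le> l" for j p
    using that(2)
  proof (induction j)
    case (Suc j)
    have "key (Suc j) p < 2 ^ (?w * j) * (\<mu> (p + 3 + j) + 1)" using Suc by (simp add: key_Suc algebra_simps)
    also have "\<dots> \<le> 2 ^ (?w * j) * W"
      using v[OF that(1), of j] Suc.prems by (intro mult_le_mono2) simp
    finally show ?case by (simp add: W_def power_add mult.commute)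
  qed (simp add: key_def read_block_def)
  define I where "I = (\<lambda>j \<rho>' \<mu>'.
     (\<exists>ps'. list_at \<mu>' A ps' \<and> mset ps' = mset ps \<and> sorted (map (key j) ps')) \<and>
     (\<forall>x. x < A \<or> A + n \<le> x \<and> x < T \<or> T + n \<le> x \<longrightarrow> \<mu>' x = \<mu> x) \<and>
     (\<forall>r<11. \<rho>' r = \<rho> r) \<and> \<rho>' 11 = l - j \<and> \<rho>' 12 = 3 + j)"
  have body: "\<rho>1 11 \<noteq> 0 \<and> ends S radix_word_prog \<rho>1 \<mu>1 (B * (34 * n + 14) + 5) (I (Suc j))"
    if j: "j < l" and I: "I j \<rho>1 \<mu>1" for j \<rho>1 \<mu>1
  proof
    show "\<rho>1 11 \<noteq> 0" using j I by (simp add: I_def)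
    obtain ps' where ps': "list_at \<mu>1 A ps'" "mset ps' = mset ps" "sorted (map (key j) ps')"
      using I by (auto simp: I_def)
    have set: "set ps' = set ps" and len: "length ps' = n"
      using ps'(2) ps(2) mset_eq_setD mset_eq_length by blast+
    have eq: "\<mu>1 (p + (3 + j)) = \<mu> (p + 3 + j)" if "p \<in> set ps" for p
      using I addr[OF that] by (simp add: I_def add.assoc)
    show "ends S radix_word_prog \<rho>1 \<mu>1 (B * (34 * n + 14) + 5) (I (Suc j))"
    proof (rule ends_mono[OF ends_radix_word_prog[where ps = ps' and n = n and A = A and T =
        T and off = "3 + j"
            and f = "key j" and M = "2 ^ (?w * j)" and c = "l - j" and B = B,
                OF _ _ _ _ _ _ _ _ _ _ _ _ _ _ _ _ _ _ _ _ order_refl] order_refl])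
      fix \<rho>2 \<mu>2
      assume 2: "(\<exists>ps''. list_at \<mu>2 A ps'' \<and> mset ps'' = mset ps' \<and>
            sorted (map (\<lambda>p. key j p + 2 ^ (?w * j) * \<mu>1 (p + (3 + j))) ps'')) \<and>
         (\<forall>x. x < A \<or> A + n \<le> x \<and> x < T \<or> T + n \<le> x \<longrightarrow> \<mu>2 x = \<mu>1 x) \<and>
         (\<forall>r<11. \<rho>2 r = \<rho>1 r) \<and> \<rho>2 11 = l - j - 1 \<and> \<rho>2 12 = 3 + j + 1"
      then obtain ps'' where ps'': "list_at \<mu>2 A ps''" "mset ps'' = mset ps'"
            "sorted (map (\<lambda>p. key j p + 2 ^ (?w * j) * \<mu>1 (p + (3 + j))) ps'')" by blast
      have map: "map (\<lambda>p. key j p + 2 ^ (?w * j) * \<mu>1 (p + (3 + j))) ps'' = map (key (Suc j)) ps''"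
        using eq set mset_eq_setD[OF ps''(2)] by (simp add: key_Suc)
      have "\<exists>ps'. list_at \<mu>2 A ps' \<and> mset ps' = mset ps \<and> sorted (map (key (Suc j)) ps')"
        using ps''[unfolded map] ps'(2) by auto
      then show "I (Suc j) \<rho>2 \<mu>2" using 2 I by (simp add: I_def)
    next
      fix p assume "p \<in> set ps'"
      then have p: "p \<in> set ps" by (simp add: set)
      show "T + n \<le> p + (3 + j) \<and> p + (3 + j) < 2 ^ ?w" using addr[OF p] j by (simp add: W_def)
      show "\<mu>1 (p + (3 + j)) < 2 ^ B" using v[OF p j] eq[OF p] by simp
      show "key j p < 2 ^ (?w * j)" using key_less[OF p] j by simp
    qed (use I regs ps' bounds j in \<open>auto simp: I_def W_def len\<close>)
  qed
  have "ends S [Loop 11 radix_word_prog] (\<rho>(11 := l, 12 := 3)) \<mu> (t - 2) ?Q"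
  proof (rule ends_Loop[where N = l and t = "B * (34 * n + 14) + 5" and I = I, OF _ body])
    \<comment> \<open>Numbers formed from no words are all 0, so any order is sorted at the
      start.\<close>
    have "sorted (map (key 0) ps)" by (simp add: key_def read_block_def sorted_map sorted_wrt_iff_nth_less)
    then show "I 0 (\<rho>(11 := l, 12 := 3)) \<mu>" using ps by (auto simp: I_def)
  next
    show "l * (B * (34 * n + 14) + 5 + 1) + 1 \<le> t - 2" using time by (simp add: algebra_simps)
  qed (auto simp: I_def key_def)
  moreover have "(3 :: nat) < 2 ^ ?w" using bounds by (simp add: W_def)
  ultimately show ?thesis using regs bounds time unfolding radix_prog_def W_def
    apply -
    apply (rule ends_basic, simp)+
    apply simp
    done
qed

section \<open>Building a balanced tree\<close>

text \<open>Round \<open>j\<close> joins the trees of adjacent blocks of \<open>2 ^ j - 1\<close> nodes under the node that separates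
  them. Cell \<open>R + lo\<close> holds the root of the block that follows the first \<open>lo\<close> nodes; the last block of a
  round may be incomplete and is then passed on unchanged.\<close>

definition link_prog :: "com list" where
  "link_prog =
     [Bin Add 18 13 15, Load 19 18, Load 20 16, Store 19 20, Bin Add 21 16 12, Load 20 21,
      Bin Add 22 19 3, Store 22 20, Store 16 19, Bin Add 16 21 12, Bin Add 15 15 12,
      Bin Add 15 15 12, Bin Less 17 15 11]"

definition tree_prog :: "com list" where
  "tree_prog =
     [Bin Sub 11 13 5, Bin Add 11 11 3, Bin Add 12 3 10, Bin Sub 13 5 3, Bin Less 14 12 11,
      Loop 14
        [Bin Add 15 12 10, Bin Add 16 6 10, Bin Less 17 15 11, Loop 17 link_prog,
         Bin Add 12 12 12, Bin Less 14 12 11],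
      Load 0 6]"

text \<open>The tree that the rounds build from the at most \<open>2 ^ j - 1\<close> elements
  beginning at \<open>lo\<close>. When \<open>lo\<close> is a multiple of \<open>2 ^ Suc j\<close>,
  the new root has 1-based position \<open>lo + 2 ^ j\<close>, an odd multiple of
  \<open>2 ^ j\<close>. Each position has this form for exactly one \<open>j\<close>, so every node
  is linked in exactly one round.\<close>

fun built_tree :: "'a list \<Rightarrow> nat \<Rightarrow> nat \<Rightarrow> 'a tree" where
  "built_tree xs 0 lo = \<langle>\<rangle>"
| "built_tree xs (Suc j) lo =
     (if lo + 2 ^ j \<le> length xs
      then \<langle>built_tree xs j lo, xs ! (lo + 2 ^ j - 1), built_tree xs j (lo + 2 ^ j)\<rangle>
      else built_tree xs j lo)"

definition root_addr :: "nat tree \<Rightarrow> nat" where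
  "root_addr t = (case t of \<langle>\<rangle> \<Rightarrow> 0 | \<langle>_, p, _\<rangle> \<Rightarrow> p)"

lemma root_addr_simps [simp]: "root_addr \<langle>\<rangle> = 0" "root_addr \<langle>t1, p, t2\<rangle> = p"
  by (simp_all add: root_addr_def)

lemma inorder_built_tree: "inorder (built_tree xs j lo) = take (2 ^ j - 1) (drop lo xs)"
proof (induction j arbitrary: lo)
  case (Suc j)
  show ?case
  proof (cases "lo + 2 ^ j \<le> length xs")
    case True
    have "0 < (2 :: nat) ^ j" by simp
    then obtain h where h: "2 ^ j = Suc h" using gr0_conv_Suc by blast
    have "take (2 * Suc h - 1) (drop lo xs) =
        take h (drop lo xs) @ take (Suc h) (drop h (drop lo xs))"
      by (simp only: take_add[symmetric]) (simp add: mult_2)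
    also have "drop h (drop lo xs) = xs ! (lo + h) # drop (Suc h) (drop lo xs)"
      using True h Cons_nth_drop_Suc[of "lo + h" xs] by (simp add: add.commute)
    finally show ?thesis using True Suc h by (simp add: add.commute add.left_commute)
  next
    case False
    then show ?thesis using Suc by (simp add: min_def)
  qed
qed simp

lemma height_built_tree: "height (built_tree xs j lo) \<le> j"
proof (induction j arbitrary: lo)
  case (Suc j)
  then show ?case using Suc[of lo] Suc[of "lo + 2 ^ j"] by (simp add: le_SucI)
qed simp

text \<open>Register 15 holds 1-based positions, hence the base \<open>T - 1\<close> in register 13.
  The root cells include \<open>R + k\<close>, because the right block of the last separator may be
  empty and its root 0 is still loaded. The frame condition lists the cells written so precisely
  because the links of earlier rounds must be seen to survive.\<close>

lemma ends_link_loop: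
  fixes S
  defines "W \<equiv> 2 ^ word_size S"
  assumes qs: "list_at \<mu> T qs" "length qs = k"
    and bounds: "0 < T" "T + k \<le> R" "R + 3 * k < W"
    and node: "\<And>p. p \<in> set qs \<Longrightarrow> R + k < p \<and> p + 1 < W"
    and spaced: "\<And>i i'. i < i' \<Longrightarrow> i' < k \<Longrightarrow> qs ! i + 1 < qs ! i' \<or> qs ! i' + 1 < qs ! i"
    and regs: "\<rho> 3 = 1" "\<rho> 11 = k + 1" "\<rho> 12 = 2 ^ j" "\<rho> 13 = T - 1"
      "\<rho> 15 = 2 ^ j" "\<rho> 16 = R" "\<rho> 17 = (if 2 ^ j \<le> k then 1 else 0)"
    and R: "\<And>lo. lo \<le> k \<Longrightarrow> 2 ^ j dvd lo \<Longrightarrow> \<mu> (R + lo) = root_addr (built_tree qs j lo)"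
    and t: "14 * k + 1 \<le> t" 
  shows "ends S [Loop 17 link_prog] \<rho> \<mu> t (\<lambda>\<rho>' \<mu>'.
    (\<forall>r<14. \<rho>' r = \<rho> r) \<and>
    (\<forall>lo \<le> k. 2 ^ Suc j dvd lo \<longrightarrow> \<mu>' (R + lo) = root_addr (built_tree qs (Suc j) lo)) \<and>
    (\<forall>lo. 2 ^ Suc j dvd lo \<longrightarrow> lo + 2 ^ j \<le> k \<longrightarrow>
       \<mu>' (qs ! (lo + 2 ^ j - 1)) = root_addr (built_tree qs j lo) \<and>
       \<mu>' (qs ! (lo + 2 ^ j - 1) + 1) = root_addr (built_tree qs j (lo + 2 ^ j))) \<and>
    (\<forall>x. \<not> (R \<le> x \<and> x \<le> R + k) \<longrightarrow>
       (\<forall>lo. 2 ^ Suc j dvd lo \<longrightarrow> lo + 2 ^ j \<le> k \<longrightarrow> x \<noteq> qs ! (lo + 2 ^ j - 1) \<and> x \<noteq> qs ! (lo + 2 ^ j - 1) + 1) \<longrightarrow>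
       \<mu>' x = \<mu> x))"
proof -
  define h :: nat where "h = 2 ^ j"
  have h: "0 < h" and hS: "2 ^ Suc j = 2 * h" by (simp_all add: h_def)
  \<comment> \<open>The separators have 1-based positions \<open>i * (2 * h) + h\<close>;
    \<open>N\<close> counts the odd multiples of \<open>h\<close> up to \<open>k\<close>.\<close>
  define N where "N = (k + h) div (2 * h)"
  have N: "i < N \<longleftrightarrow> i * (2 * h) + h \<le> k" for i
    using h less_eq_div_iff_mult_less_eq[of "2 * h" "Suc i" "k + h"] unfolding N_def Suc_le_eq by auto
  have N_le: "N \<le> k"
  proof (cases N)
    case (Suc M)
    then have "M * (2 * h) + h \<le> k" using N by blast
    moreover have "M \<le> M * (2 * h)" using h by (cases "2 * h") auto
    ultimately show ?thesis using h Suc by linarith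
  qed simp
  have qs_nth: "\<mu> (T + i) = qs ! i" "R + k < qs ! i" "qs ! i + 1 < W" if "i < k" for i
    using qs node[of "qs ! i"] that by (auto simp: list_at_def)
  define I where "I = (\<lambda>i \<rho>' \<mu>'.
    (\<forall>r<14. \<rho>' r = \<rho> r) \<and> \<rho>' 15 = i * (2 * h) + h \<and> \<rho>' 16 = R + i * (2 * h) \<and>
    \<rho>' 17 = (if i < N then 1 else 0) \<and>
    (\<forall>i' < i. \<mu>' (R + i' * (2 * h)) = qs ! (i' * (2 * h) + h - 1) \<and>
       \<mu>' (qs ! (i' * (2 * h) + h - 1)) = root_addr (built_tree qs j (i' * (2 * h))) \<and>
       \<mu>' (qs ! (i' * (2 * h) + h - 1) + 1) = root_addr (built_tree qs j (i' * (2 * h) + h))) \<and>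
    (\<forall>x. (\<forall>i' < i. x \<noteq> R + i' * (2 * h) \<and> x \<noteq> qs ! (i' * (2 * h) + h - 1) \<and>
        x \<noteq> qs ! (i' * (2 * h) + h - 1) + 1) \<longrightarrow> \<mu>' x = \<mu> x))"
  have body: "\<rho>1 17 \<noteq> 0 \<and> ends S link_prog \<rho>1 \<mu>1 13 (I (Suc i))"
    if i: "i < N" and I: "I i \<rho>1 \<mu>1" for i \<rho>1 \<mu>1
  proof
    show "\<rho>1 17 \<noteq> 0" using i I by (simp add: I_def)
    define lo where "lo = i * (2 * h)"
    define p where "p = qs ! (lo + h - 1)"
    have lo: "lo + h \<le> k" "lo + h - 1 < k" using i N h by (auto simp: lo_def)
    have p: "R + k < p" "p + 1 < W" using qs_nth(2,3)[OF lo(2)] by (simp_all add: p_def)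
    have I': "\<mu>1 x = \<mu> x" if "\<And>i'. i' < i \<Longrightarrow> x \<noteq> R + i' * (2 * h) \<and> x \<noteq> qs ! (i' * (2 * h) + h - 1) \<and>
        x \<noteq> qs ! (i' * (2 * h) + h - 1) + 1" for x
      using I that by (simp add: I_def)
    have prev: "i' * (2 * h) + 2 * h \<le> lo" if "i' < i" for i'
    proof -
      have "Suc i' * (2 * h) \<le> i * (2 * h)" using that by (intro mult_le_mono1) simp
      then show ?thesis by (simp add: lo_def add.commute)
    qed
    have far: "qs ! (i' * (2 * h) + h - 1) + 1 < p \<or> p + 1 < qs ! (i' * (2 * h) + h - 1)" if "i' < i" for i'
      using spaced[of "i' * (2 * h) + h - 1" "lo + h - 1"] prev[OF that] lo h by (auto simp: p_def)
    have prev_addr: "R + k < qs ! (i' * (2 * h) + h - 1)" if "i' < i" for i'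
      using prev[OF that] lo by (intro qs_nth) linarith
    have m1: "\<mu>1 (T + lo + h - 1) = p"
    proof -
      have "\<mu>1 (T + (lo + h - 1)) = \<mu> (T + (lo + h - 1))"
        using prev_addr lo bounds by (intro I') fastforce
      then show ?thesis using qs_nth(1)[OF lo(2)] h by (simp add: p_def add.assoc)
    qed
    have m2: "\<mu>1 (R + lo) = root_addr (built_tree qs j lo)" "\<mu>1 (R + lo + h) =
        root_addr (built_tree qs j (lo + h))"
    proof -
      \<comment> \<open>Earlier iterations changed root cells only to the left of
        \<open>R + lo\<close>, and the nodes lie above all root cells.\<close>
      have "\<mu>1 (R + lo) = \<mu> (R + lo)" "\<mu>1 (R + (lo + h)) = \<mu> (R + (lo + h))"
        using prev_addr prev lo h by (intro I'; fastforce)+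
      moreover have "2 ^ j dvd lo" "2 ^ j dvd lo + h" by (simp_all add: lo_def h_def)
      ultimately show "\<mu>1 (R + lo) = root_addr (built_tree qs j lo)" "\<mu>1 (R + lo + h) =
          root_addr (built_tree qs j (lo + h))"
        using R lo by (simp_all add: add.assoc)
    qed
    have [simp]: "\<rho>1 3 = 1" "\<rho>1 11 = k + 1" "\<rho>1 12 = h" "\<rho>1 13 = T - 1" "\<rho>1 15 = lo + h" "\<rho>1 16 = R + lo"
      using I regs by (simp_all add: I_def lo_def h_def)
    define \<rho>2 where "\<rho>2 = \<rho>1(18 := T + lo + h - 1, 19 := p, 20 := root_addr (built_tree qs j (lo + h)),
       21 := R + lo + h, 22 := p + 1, 16 := R + lo + 2 * h, 15 := lo + 3 * h,
       17 := if Suc i < N then 1 else 0)"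
    define \<mu>2 where "\<mu>2 = \<mu>1(p := root_addr (built_tree qs j lo), p + 1 :=
        root_addr (built_tree qs j (lo + h)),
       R + lo := p)"
    have IS: "I (Suc i) \<rho>2 \<mu>2"
    proof -
      have "\<mu>2 (R + i' * (2 * h)) = qs ! (i' * (2 * h) + h - 1) \<and>
         \<mu>2 (qs ! (i' * (2 * h) + h - 1)) = root_addr (built_tree qs j (i' * (2 * h))) \<and>
         \<mu>2 (qs ! (i' * (2 * h) + h - 1) + 1) = root_addr (built_tree qs j (i' * (2 * h) + h))"
        if "i' < Suc i" for i'
      proof (cases "i' = i")
        case True
        then show ?thesis using p lo by (auto simp: \<mu>2_def simp flip: lo_def p_def)
      next
        case False
        then have "i' < i" using that by simp
        then show ?thesis
          using far[of i'] prev[of i'] prev_addr[of i'] I p lo h by (auto simp: \<mu>2_def I_def)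
      qed
      moreover have "\<mu>2 x = \<mu> x" if "\<forall>i' < Suc i. x \<noteq> R + i' * (2 * h) \<and> x \<noteq> qs ! (i' * (2 * h) + h - 1) \<and>
        x \<noteq> qs ! (i' * (2 * h) + h - 1) + 1" for x
      proof -
        have "x \<noteq> R + lo \<and> x \<noteq> p \<and> x \<noteq> p + 1" using that by (simp add: lo_def p_def)
        then have "\<mu>2 x = \<mu>1 x" by (simp add: \<mu>2_def)
        also have "\<dots> = \<mu> x" using that by (intro I') simp
        finally show ?thesis .
      qed
      moreover have "\<forall>r<14. \<rho>2 r = \<rho> r" using I by (simp add: \<rho>2_def I_def)
      ultimately show ?thesis
        unfolding I_def by (simp add: \<rho>2_def lo_def algebra_simps)
    qed
    have fin: "I (Suc i) \<rho>' \<mu>'" if "\<rho>' = \<rho>2" "\<mu>' = \<mu>2" for \<rho>' \<mu>' using IS that by simp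
    have "lo + 3 * h < k + 1 \<longleftrightarrow> Suc i < N"
      unfolding N by (simp add: lo_def algebra_simps, linarith)
    moreover have b: "T + lo + h < W" "R + lo + h < W" "R + lo + h + h < W" "lo + h + h < W" "lo + h
        + h + h < W"
        "1 < W" "p \<noteq> R + lo" "p \<noteq> R + lo + h" "T - 1 + (lo + h) = T + lo + h - 1"
      using bounds lo p by linarith+
    ultimately show "ends S link_prog \<rho>1 \<mu>1 13 (I (Suc i))"
      using p(2) unfolding link_prog_def W_def
      apply -
      apply (rule ends_basic, simp, (simp add: m1 m2)?)+
      apply (intro conjI impI; rule fin)
      apply (simp_all add: fun_eq_iff \<rho>2_def \<mu>2_def)
      done
  qed
  show ?thesis
  proof (rule ends_Loop[where N = N and t = 13 and I = I, OF _ body])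
    show "I 0 \<rho> \<mu>" using regs N[of 0] by (simp add: I_def h_def)
    show "N * (13 + 1) + 1 \<le> t" using N_le t by simp
  next
    fix \<rho>' \<mu>' assume I: "I N \<rho>' \<mu>'"
    have dvd: "(\<exists>i<N. lo = i * (2 * h)) \<longleftrightarrow> 2 ^ Suc j dvd lo \<and> lo + h \<le> k" for lo
      unfolding hS using N by (auto simp: dvd_def mult.commute)
    have "\<mu>' (R + lo) = root_addr (built_tree qs (Suc j) lo)" if "lo \<le> k" "2 ^ Suc j dvd lo" for lo
    proof (cases "lo + h \<le> k")
      case True
      then obtain i where "i < N" "lo = i * (2 * h)" using dvd[of lo] \<open>2 ^ Suc j dvd lo\<close> by blast
      then show ?thesis using I True qs(2) by (simp add: I_def h_def)
    next
      case False
      have "\<mu>' (R + lo) = \<mu> (R + lo)"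
      proof -
        have "R + lo \<noteq> R + i * (2 * h)" if "i < N" for i using False N[of i] that by auto
        moreover have "R + lo < qs ! (i * (2 * h) + h - 1)" if "i < N" for i
        proof -
          have "i * (2 * h) + h - 1 < k" using N[of i] that h by linarith
          then show ?thesis using qs_nth(2) \<open>lo \<le> k\<close> by fastforce
        qed
        ultimately show ?thesis using I unfolding I_def by (metis add_leD1 less_irrefl not_less)
      qed
      also have "\<dots> = root_addr (built_tree qs j lo)"
        using that by (intro R) (auto intro: dvd_trans[OF le_imp_power_dvd])
      finally show ?thesis using False qs(2) by (simp add: h_def)
    qed
    moreover have "\<mu>' (qs ! (lo + h - 1)) = root_addr (built_tree qs j lo) \<and>
       \<mu>' (qs ! (lo + h - 1) + 1) = root_addr (built_tree qs j (lo + h))" if "2 ^ Suc j dvd lo" "lo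
           + h \<le> k" for lo
      using dvd[of lo] that I by (auto simp: I_def)
    moreover have "\<mu>' x = \<mu> x" if "\<not> (R \<le> x \<and> x \<le> R + k)"
      "\<forall>lo. 2 ^ Suc j dvd lo \<longrightarrow> lo + h \<le> k \<longrightarrow> x \<noteq> qs ! (lo + h - 1) \<and> x \<noteq> qs ! (lo + h - 1) + 1" for x
    proof -
      have "x \<noteq> R + i * (2 * h)" if "i < N" for i using N[of i] that \<open>\<not> (R \<le> x \<and> x \<le> R + k)\<close> by auto
      moreover have "x \<noteq> qs ! (i * (2 * h) + h - 1) \<and> x \<noteq> qs ! (i * (2 * h) + h - 1) + 1" if "i < N" for i
        using dvd[of "i * (2 * h)"] \<open>\<forall>lo. 2 ^ Suc j dvd lo \<longrightarrow> _ lo\<close> that by blast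
      ultimately show ?thesis using I unfolding I_def by blast
    qed
    ultimately show "\<rho>' 17 = 0 \<and> (\<forall>r<14. \<rho>' r = \<rho> r) \<and>
    (\<forall>lo \<le> k. 2 ^ Suc j dvd lo \<longrightarrow> \<mu>' (R + lo) = root_addr (built_tree qs (Suc j) lo)) \<and>
    (\<forall>lo. 2 ^ Suc j dvd lo \<longrightarrow> lo + 2 ^ j \<le> k \<longrightarrow>
       \<mu>' (qs ! (lo + 2 ^ j - 1)) = root_addr (built_tree qs j lo) \<and>
       \<mu>' (qs ! (lo + 2 ^ j - 1) + 1) = root_addr (built_tree qs j (lo + 2 ^ j))) \<and>
    (\<forall>x. \<not> (R \<le> x \<and> x \<le> R + k) \<longrightarrow>
       (\<forall>lo. 2 ^ Suc j dvd lo \<longrightarrow> lo + 2 ^ j \<le> k \<longrightarrow> x \<noteq> qs ! (lo + 2 ^ j - 1) \<and> x \<noteq> qs ! (lo + 2 ^ j - 1) + 1) \<longrightarrow>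
       \<mu>' x = \<mu> x)"
      using I unfolding h_def[symmetric] by (simp add: I_def)
  qed
qed


text \<open>The pointer part of \<open>tree_at\<close>. Counts and keys are not touched by the
  linking and are added back in \<open>tree_at_map_tree\<close>.\<close>

fun links :: "(nat \<Rightarrow> nat) \<Rightarrow> nat tree \<Rightarrow> bool" where
  "links \<mu> \<langle>\<rangle> \<longleftrightarrow> True"
| "links \<mu> \<langle>t1, p, t2\<rangle> \<longleftrightarrow> \<mu> p = root_addr t1 \<and> \<mu> (p + 1) = root_addr t2 \<and> links \<mu> t1 \<and> links \<mu> t2"

lemma links_cong:
  assumes "links \<mu> t" "\<And>p. p \<in> set_tree t \<Longrightarrow> \<mu>' p = \<mu> p \<and> \<mu>' (p + 1) = \<mu> (p + 1)"
  shows "links \<mu>' t"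
  using assms by (induction t) auto

lemma set_built_tree:
  assumes "p \<in> set_tree (built_tree xs j lo)"
  obtains i where "lo \<le> i" "i + 1 < lo + 2 ^ j" "i < length xs" "p = xs ! i"
proof -
  have "p \<in> set (take (2 ^ j - 1) (drop lo xs))"
    using assms by (simp flip: inorder_built_tree)
  then obtain i where "i < 2 ^ j - 1" "lo + i < length xs" "p = xs ! (lo + i)"
    by (auto simp: in_set_conv_nth)
  then show ?thesis by (intro that[of "lo + i"]) auto
qed

text \<open>The number of rounds depends on how many nodes are kept, which is random later on;
  \<open>J\<close> is a bound that can be fixed in advance.\<close>

lemma ends_tree_prog:
  fixes S
  defines "W \<equiv> 2 ^ word_size S"
  assumes qs: "list_at \<mu> T qs" "length qs = k"
    and bounds: "0 < T" "T + k \<le> R" "R + 3 * k + 1 < W"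
    and node: "\<And>p. p \<in> set qs \<Longrightarrow> R + k < p \<and> p + 1 < W"
    and spaced: "\<And>i i'. i < i' \<Longrightarrow> i' < k \<Longrightarrow> qs ! i + 1 < qs ! i' \<or> qs ! i' + 1 < qs ! i"
    and regs: "\<rho> 3 = 1" "\<rho> 5 = T" "\<rho> 6 = R" "\<rho> 10 = 0" "\<rho> 13 = T + k"
    and R: "\<And>i. i \<le> k \<Longrightarrow> \<mu> (R + i) = 0"
    and J: "k < 2 ^ J" and t: "J * (14 * k + 7) + 7 \<le> t"
  shows "ends S tree_prog \<rho> \<mu> t (\<lambda>\<rho>' \<mu>'. \<exists>t.
    inorder t = qs \<and> 2 ^ height t \<le> (k + 1)\<^sup>2 \<and> \<rho>' 0 = root_addr t \<and> links \<mu>' t \<and>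
    (\<forall>x. \<not> (R \<le> x \<and> x \<le> R + k) \<longrightarrow> (\<forall>p\<in>set qs. x \<noteq> p \<and> x \<noteq> p + 1) \<longrightarrow> \<mu>' x = \<mu> x))" (is "ends _ _ _ _ _ ?Q")
proof -
  define N where "N = (LEAST j. k < 2 ^ j)"
  have N: "k < 2 ^ N" "N \<le> J" using LeastI[of "\<lambda>j. k < 2 ^ j", OF J] Least_le[of "\<lambda>j. k < 2 ^ j", OF J]
    by (simp_all add: N_def)
  have less_N: "2 ^ j \<le> k" if "j < N" for j
    using not_less_Least[of j "\<lambda>j. k < 2 ^ j"] that by (simp add: N_def)
  define I where "I = (\<lambda>j \<rho>' \<mu>'.
     (\<forall>r<11. \<rho>' r = \<rho> r) \<and> \<rho>' 11 = k + 1 \<and> \<rho>' 12 = 2 ^ j \<and> \<rho>' 13 = T - 1 \<and>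
     \<rho>' 14 = (if 2 ^ j \<le> k then 1 else 0) \<and>
     (\<forall>lo \<le> k. 2 ^ j dvd lo \<longrightarrow> \<mu>' (R + lo) = root_addr (built_tree qs j lo)) \<and>
     (\<forall>lo. 2 ^ j dvd lo \<longrightarrow> links \<mu>' (built_tree qs j lo)) \<and>
     (\<forall>x. \<not> (R \<le> x \<and> x \<le> R + k) \<longrightarrow> (\<forall>p\<in>set qs. x \<noteq> p \<and> x \<noteq> p + 1) \<longrightarrow> \<mu>' x = \<mu> x))"
  have body: "\<rho>1 14 \<noteq> 0 \<and> ends S [Bin Add 15 12 10, Bin Add 16 6 10, Bin Less 17 15 11, Loop 17 link_prog,
         Bin Add 12 12 12, Bin Less 14 12 11] \<rho>1 \<mu>1 (14 * k + 6) (I (Suc j))"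
    if j: "j < N" and I: "I j \<rho>1 \<mu>1" for j \<rho>1 \<mu>1
  proof
    note jk = less_N[OF j]
    show "\<rho>1 14 \<noteq> 0" using jk I by (simp add: I_def)
    have "(2 :: nat) ^ j < 2 ^ word_size S" using jk bounds unfolding W_def by linarith
    then have jw: "j < word_size S" by simp
    have [simp]: "\<rho>1 3 = 1" "\<rho>1 6 = R" "\<rho>1 10 = 0" "\<rho>1 11 = k + 1" "\<rho>1 12 = 2 ^ j" "\<rho>1 13 = T - 1"
      using I regs by (simp_all add: I_def)
    let ?\<rho> = "\<rho>1(15 := 2 ^ j, 16 := R, 17 := 1)"
    have "ends S [Loop 17 link_prog] ?\<rho> \<mu>1 (14 * k + 1)
        (\<lambda>\<rho>' \<mu>'. ends S [Bin Add 12 12 12, Bin Less 14 12 11] \<rho>' \<mu>' (14 * k + 3 - (14 * k + 1)) (I (Suc j)))"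
    proof (rule ends_mono[OF ends_link_loop[where qs = qs and j = j and k = k and T = T and R = R,
        OF _ _ _ _ _ _ _ _ _ _ _ _ _ _ _ order_refl] order_refl])
      show "list_at \<mu>1 T qs"
      proof (rule list_at_cong[OF qs(1)])
        fix x assume x: "T \<le> x" "x < T + length qs"
        then have "\<forall>p\<in>set qs. x \<noteq> p \<and> x \<noteq> p + 1" using node bounds qs(2) by fastforce
        moreover have "\<not> (R \<le> x \<and> x \<le> R + k)" using x bounds qs(2) by simp
        ultimately show "\<mu>1 x = \<mu> x" using I by (simp add: I_def)
      qed
      show "lo \<le> k \<Longrightarrow> 2 ^ j dvd lo \<Longrightarrow> \<mu>1 (R + lo) = root_addr (built_tree qs j lo)" for lo
        using I by (simp add: I_def)
    next
      fix \<rho>2 \<mu>2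
      assume "(\<forall>r<14. \<rho>2 r = ?\<rho> r) \<and>
    (\<forall>lo \<le> k. 2 ^ Suc j dvd lo \<longrightarrow> \<mu>2 (R + lo) = root_addr (built_tree qs (Suc j) lo)) \<and>
    (\<forall>lo. 2 ^ Suc j dvd lo \<longrightarrow> lo + 2 ^ j \<le> k \<longrightarrow>
       \<mu>2 (qs ! (lo + 2 ^ j - 1)) = root_addr (built_tree qs j lo) \<and>
       \<mu>2 (qs ! (lo + 2 ^ j - 1) + 1) = root_addr (built_tree qs j (lo + 2 ^ j))) \<and>
    (\<forall>x. \<not> (R \<le> x \<and> x \<le> R + k) \<longrightarrow>
       (\<forall>lo. 2 ^ Suc j dvd lo \<longrightarrow> lo + 2 ^ j \<le> k \<longrightarrow> x \<noteq> qs ! (lo + 2 ^ j - 1) \<and> x \<noteq> qs ! (lo + 2 ^ j - 1) + 1) \<longrightarrow>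
       \<mu>2 x = \<mu>1 x)"
      then have 2: "\<And>r. r < 14 \<Longrightarrow> \<rho>2 r = ?\<rho> r"
        "\<And>lo. lo \<le> k \<Longrightarrow> 2 ^ Suc j dvd lo \<Longrightarrow> \<mu>2 (R + lo) = root_addr (built_tree qs (Suc j) lo)"
        "\<And>lo. 2 ^ Suc j dvd lo \<Longrightarrow> lo + 2 ^ j \<le> k \<Longrightarrow>
           \<mu>2 (qs ! (lo + 2 ^ j - 1)) = root_addr (built_tree qs j lo) \<and>
           \<mu>2 (qs ! (lo + 2 ^ j - 1) + 1) = root_addr (built_tree qs j (lo + 2 ^ j))"
        "\<And>x. \<not> (R \<le> x \<and> x \<le> R + k) \<Longrightarrow>
           (\<And>lo. 2 ^ Suc j dvd lo \<Longrightarrow> lo + 2 ^ j \<le> k \<Longrightarrow> x \<noteq> qs ! (lo + 2 ^ j - 1) \<and>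
               x \<noteq> qs ! (lo + 2 ^ j - 1) + 1) \<Longrightarrow>
           \<mu>2 x = \<mu>1 x"
        by blast+
      have sub: "links \<mu>2 (built_tree qs j lo)" if lo: "2 ^ j dvd lo" for lo
      proof (rule links_cong)
        show "links \<mu>1 (built_tree qs j lo)" using I lo by (simp add: I_def)
        fix p assume "p \<in> set_tree (built_tree qs j lo)"
        then obtain i where i: "lo \<le> i" "i + 1 < lo + 2 ^ j" "i < length qs" "p = qs ! i"
          by (rule set_built_tree)
        have pR: "R + k < p" using node[of p] i by simp
        \<comment> \<open>A node inside the block of \<open>lo\<close> has 1-based position strictly
          between two consecutive multiples of \<open>2 ^ j\<close>, whereas the separators of this
          round sit at multiples. So the round leaves the subtrees built before intact.\<close>
        have ne: "i \<noteq> lo' + 2 ^ j - 1" if lo': "2 ^ Suc j dvd lo'" for lo'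
        proof
          assume "i = lo' + 2 ^ j - 1"
          moreover have "0 < (2 :: nat) ^ j" by simp
          ultimately have "i + 1 = lo' + 2 ^ j" by linarith
          then have "2 ^ j dvd i + 1" using lo' by (auto intro: dvd_trans[OF le_imp_power_dvd])
          then have "2 ^ j dvd i + 1 - lo" using lo by (rule dvd_diff_nat)
          then have "2 ^ j \<le> i + 1 - lo" using i(1) by (intro dvd_imp_le) simp_all
          then show False using i(1,2) by linarith
        qed
        have far: "p + 1 < qs ! (lo' + 2 ^ j - 1) \<or> qs ! (lo' + 2 ^ j - 1) + 1 < p"
          if lo': "2 ^ Suc j dvd lo'" "lo' + 2 ^ j \<le> k" for lo'
        proof -
          have "0 < (2 :: nat) ^ j" by simp
          then have "lo' + 2 ^ j - 1 < k" using lo'(2) by linarith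
          then show ?thesis using spaced[of i "lo' + 2 ^ j - 1"] spaced[of "lo' + 2 ^ j - 1" i]
              ne[OF lo'(1)] i(3,4) qs(2)
            by (metis nat_neq_iff)
        qed
        show "\<mu>2 p = \<mu>1 p \<and> \<mu>2 (p + 1) = \<mu>1 (p + 1)"
          by (rule conjI; rule 2(4)) (use pR far in fastforce)+
      qed
      have "links \<mu>2 (built_tree qs (Suc j) lo)" if lo: "2 ^ Suc j dvd lo" for lo
      proof -
        have "2 ^ j dvd lo" using lo by (rule power_le_dvd) simp
        then show ?thesis using sub[of lo] sub[of "lo + 2 ^ j"] 2(3)[OF lo] qs(2) by simp
      qed
      moreover have "\<mu>2 x = \<mu> x" if "\<not> (R \<le> x \<and> x \<le> R + k)" "\<forall>p\<in>set qs. x \<noteq> p \<and> x \<noteq> p + 1" for x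
      proof -
        have "\<mu>2 x = \<mu>1 x"
        proof (rule 2(4)[OF that(1)])
          fix lo :: nat assume "lo + 2 ^ j \<le> k"
          moreover have "0 < (2 :: nat) ^ j" by simp
          ultimately have "lo + 2 ^ j - 1 < k" by linarith
          then show "x \<noteq> qs ! (lo + 2 ^ j - 1) \<and> x \<noteq> qs ! (lo + 2 ^ j - 1) + 1" using that(2) qs(2) by auto
        qed
        then show ?thesis using I that by (simp add: I_def)
      qed
      ultimately have "I (Suc j) (\<rho>2(12 := 2 * 2 ^ j, 14 := if 2 * 2 ^ j \<le> k then 1 else 0)) \<mu>2"
        using 2(1,2) I by (simp add: I_def del: built_tree.simps)
      then have fin: "I (Suc j) \<rho>' \<mu>2" if "\<rho>' = \<rho>2(12 := 2 * 2 ^ j, 14 :=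
          if 2 * 2 ^ j \<le> k then 1 else 0)" for \<rho>'
        using that by simp
      show "ends S [Bin Add 12 12 12, Bin Less 14 12 11] \<rho>2 \<mu>2 (14 * k + 3 - (14 * k + 1)) (I (Suc j))"
        using jk bounds 2(1)[of 12] 2(1)[of 11] unfolding W_def
        apply simp
        apply (rule ends_basic, simp, simp?)+
        apply (intro conjI impI; rule fin)
        apply (auto simp: fun_eq_iff)
        done
    qed (use I regs bounds qs node spaced jk in \<open>auto simp: W_def\<close>)
    then have "ends S [Loop 17 link_prog, Bin Add 12 12 12, Bin Less 14 12 11] ?\<rho> \<mu>1 (14 * k + 3) (I (Suc j))"
      by (rule ends_Cons) simp
    then show "ends S [Bin Add 15 12 10, Bin Add 16 6 10, Bin Less 17 15 11, Loop 17 link_prog,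
         Bin Add 12 12 12, Bin Less 14 12 11] \<rho>1 \<mu>1 (14 * k + 6) (I (Suc j))"
      using jk jw bounds unfolding W_def
      apply -
      apply (rule ends_basic, simp, simp?)+
      apply (simp add: add.commute)
      done
  qed
  have loop: "ends S [Loop 14
        [Bin Add 15 12 10, Bin Add 16 6 10, Bin Less 17 15 11, Loop 17 link_prog,
         Bin Add 12 12 12, Bin Less 14 12 11]]
      (\<rho>(11 := k + 1, 12 := 1, 13 := T - 1, 14 := if 1 \<le> k then 1 else 0)) \<mu> (t - 6)
      (\<lambda>\<rho>' \<mu>'. ends S [Load 0 6] \<rho>' \<mu>' 1 ?Q)" (is "ends _ _ ?\<rho> _ _ _")
  proof (rule ends_Loop[where N = N and t = "14 * k + 6" and I = I, OF _ body])
    show "I 0 ?\<rho> \<mu>" using R by (simp add: I_def)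
    have "N * (14 * k + 7) \<le> J * (14 * k + 7)" using N(2) by (rule mult_le_mono1)
    moreover have "14 * k + 6 + 1 = 14 * k + 7" by simp
    ultimately show "N * (14 * k + 6 + 1) + 1 \<le> t - 6" using t by (simp only:)
  next
    fix \<rho>1 \<mu>1 assume I: "I N \<rho>1 \<mu>1"
    \<comment> \<open>By minimality \<open>2 ^ (N - 1)\<close> is at most \<open>k\<close>. The
      square is the balance condition \<open>height \<le> 2 * log 2 size1\<close> freed of
      logarithms.\<close>
    have "2 ^ N \<le> (k + 1)\<^sup>2"
    proof (cases N)
      case (Suc M)
      then have "2 ^ N \<le> 2 * k" using less_N[of M] by simp
      also have "\<dots> \<le> (k + 1)\<^sup>2" by (simp add: power2_eq_square algebra_simps)
      finally show ?thesis .
    qed simp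
    moreover have "(2 :: nat) ^ height (built_tree qs N 0) \<le> 2 ^ N"
      by (intro power_increasing height_built_tree) simp
    ultimately have "2 ^ height (built_tree qs N 0) \<le> (k + 1)\<^sup>2" by linarith
    moreover have "inorder (built_tree qs N 0) = qs" using N(1) qs(2) by (simp add: inorder_built_tree)
    moreover have "\<mu>1 R = root_addr (built_tree qs N 0)" "links \<mu>1 (built_tree qs N 0)"
      using I by (auto simp: I_def dest: spec[of _ 0])
    ultimately have "?Q (\<rho>1(0 := \<mu>1 R)) \<mu>1" using I by (intro exI[of _ "built_tree qs N 0"]) (simp add: I_def)
    moreover have "\<rho>1 6 = R" using I regs by (simp add: I_def)
    ultimately show "\<rho>1 14 = 0 \<and> ends S [Load 0 6] \<rho>1 \<mu>1 1 ?Q"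
      using I N(1)
      apply -
      apply (rule conjI, simp add: I_def)
      apply (rule ends_Load, simp)
      apply simp
      done
  qed
  have "ends S [Loop 14
        [Bin Add 15 12 10, Bin Add 16 6 10, Bin Less 17 15 11, Loop 17 link_prog,
         Bin Add 12 12 12, Bin Less 14 12 11], Load 0 6] ?\<rho> \<mu> (t - 5) ?Q"
    by (rule ends_Cons[OF ends_mono[OF loop order_refl]]) (use t in \<open>auto elim: ends_mono\<close>)
  moreover have "(1 < k + 1) \<longleftrightarrow> 1 \<le> k" by linarith
  ultimately show ?thesis using regs bounds t unfolding tree_prog_def W_def
    apply -
    apply (rule ends_basic, simp, simp?)+
    done
qed

section \<open>Sampling the noisy counts\<close>

lemma less_num_words:
  assumes "0 < w" shows "x < 2 ^ (w * num_words w x)"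
proof -
  have "x < 2 ^ x" by (rule less_exp)
  also have "(2 :: nat) ^ x \<le> 2 ^ (w * x)" using assms by (intro power_increasing) simp_all
  finally show ?thesis unfolding num_words_def by (rule LeastI)
qed

lemma sum_nth_word: "(\<Sum>j<l. nth_word w x j * 2 ^ (w * j)) = x mod 2 ^ (w * l)"
proof (induction l)
  case (Suc l)
  then show ?case
    using mod_mult2_eq[of x "2 ^ (w * l)" "2 ^ w"] by (simp add: nth_word_def power_add mult.commute
        add.commute)
qed simp

lemma read_write_block:
  "x < 2 ^ (w * l) \<Longrightarrow> read_block w l (write_block w l p x \<mu>) p = x"
  using sum_nth_word[of w x l] by (simp add: read_block_def write_block_def)

lemma read_block_cong:
  "(\<And>j. j < l \<Longrightarrow> \<mu> (p + j) = \<mu>' (p' + j)) \<Longrightarrow> read_block w l \<mu> p = read_block w l \<mu>' p'"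
  by (simp add: read_block_def)

lemma read_block_less:
  assumes "\<And>j. j < l \<Longrightarrow> \<mu> (p + j) < 2 ^ w"
  shows "read_block w l \<mu> p < 2 ^ (w * l)"
  using assms
proof (induction l)
  case (Suc l)
  have "read_block w (Suc l) \<mu> p < 2 ^ (w * l) * (\<mu> (p + l) + 1)"
    using Suc by (simp add: read_block_def algebra_simps)
  also have "\<dots> \<le> 2 ^ (w * l) * 2 ^ w"
    using Suc.prems[of l] by (intro mult_le_mono2) simp
  finally show ?case by (simp add: power_add mult.commute)
qed (simp add: read_block_def)

text \<open>Uniqueness of expansions in base \<open>2 ^ w\<close>; it justifies comparing keys word
  by word.\<close>

lemma read_block_inject:
  assumes "\<And>j. j < l \<Longrightarrow> \<mu> (p + j) < 2 ^ w" "\<And>j. j < l \<Longrightarrow> \<mu>' (p' + j) < 2 ^ w"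
  shows "read_block w l \<mu> p = read_block w l \<mu>' p' \<longleftrightarrow> (\<forall>j<l. \<mu> (p + j) = \<mu>' (p' + j))"
  using assms
proof (induction l)
  case (Suc l)
  let ?X = "2 ^ (w * l) :: nat"
  have "read_block w l \<mu> p < ?X" "read_block w l \<mu>' p' < ?X"
    using Suc.prems by (auto intro: read_block_less)
  moreover have "a + ?X * u = b + ?X * v \<longleftrightarrow> a = b \<and> u = v" if "a < ?X" "b < ?X" for a b u v
  proof
    assume eq: "a + ?X * u = b + ?X * v"
    have "(a + ?X * u) mod ?X = a" "(b + ?X * v) mod ?X = b" using that by simp_all
    with eq show "a = b \<and> u = v" by simp
  qed simp
  moreover have "read_block w (Suc l) \<mu> p = read_block w l \<mu> p + ?X * \<mu> (p + l)" for \<mu> p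
    by (simp add: read_block_def mult.commute)
  ultimately show ?case using Suc by (auto simp: less_Suc_eq)
qed (simp add: read_block_def)

definition compare_prog :: "com list" where
  "compare_prog = [Loop 18 [Load 21 19, Load 22 20, Bin Eq 21 21 22, Bin And 17 17 21,
     Bin Add 19 19 3, Bin Add 20 20 3, Bin Sub 18 18 3]]"

text \<open>For the last row \<open>y\<close> stems from an arbitrary cell and its block may wrap
  around, hence the \<open>mod W\<close> on this side only; then \<open>e\<close> is false and
  forces the answer 0. There is no early exit, so the number of rounds is always
  \<open>l\<close>.\<close>

lemma ends_compare_prog:
  fixes S
  defines "W \<equiv> 2 ^ word_size S"
  assumes regs: "\<rho> 3 = 1" "\<rho> 17 = (if e then 1 else 0)" "\<rho> 18 = l" "\<rho> 19 = x" "\<rho> 20 = y"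
    and bounds: "x + l < W" "y < W" and t: "8 * l + 1 \<le> t"
  shows "ends S compare_prog \<rho> \<mu> t (\<lambda>\<rho>' \<mu>'. \<mu>' = \<mu> \<and> (\<forall>r<17. \<rho>' r = \<rho> r) \<and>
    \<rho>' 17 = (if e \<and> (\<forall>j<l. \<mu> (x + j) = \<mu> ((y + j) mod W)) then 1 else 0))"
proof -
  define I where "I = (\<lambda>j \<rho>' \<mu>'. \<mu>' = \<mu> \<and> (\<forall>r<17. \<rho>' r = \<rho> r) \<and>
    \<rho>' 17 = (if e \<and> (\<forall>j'<j. \<mu> (x + j') = \<mu> ((y + j') mod W)) then 1 else 0) \<and>
    \<rho>' 18 = l - j \<and> \<rho>' 19 = x + j \<and> \<rho>' 20 = (y + j) mod W)"
  have body: "\<rho>1 18 \<noteq> 0 \<and> ends S [Load 21 19, Load 22 20, Bin Eq 21 21 22, Bin And 17 17 21,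
     Bin Add 19 19 3, Bin Add 20 20 3, Bin Sub 18 18 3] \<rho>1 \<mu>1 7 (I (Suc j))"
    if j: "j < l" and I: "I j \<rho>1 \<mu>1" for j \<rho>1 \<mu>1
  proof
    show "\<rho>1 18 \<noteq> 0" using I j by (simp add: I_def)
    have [simp]: "\<rho>1 3 = 1" "\<rho>1 18 = l - j" "\<rho>1 19 = x + j" "\<rho>1 20 = (y + j) mod W" "\<mu>1 = \<mu>"
      using I regs by (simp_all add: I_def)
    have 17: "\<rho>1 17 = (if e \<and> (\<forall>j'<j. \<mu> (x + j') = \<mu> ((y + j') mod W)) then 1 else 0)"
      using I by (simp add: I_def)
    have add: "binop_val Add (word_size S) ((y + j) mod W) 1 = (y + Suc j) mod W"
      by (simp add: binop_val.simps(1) W_def mod_add_left_eq flip: Suc_eq_plus1)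
        (simp add: Suc_eq_plus1 add.assoc[symmetric] mod_simps)
    have "1 < W" using bounds j by linarith
    define eq where "eq = (if \<mu> (x + j) = \<mu> ((y + j) mod W) then 1 else 0 :: nat)"
    have fin: "I (Suc j) \<rho>' \<mu>" if "\<rho>' = \<rho>1(21 := eq, 22 := \<mu> ((y + j) mod W),
        17 := Bit_Operations.and (\<rho>1 17) eq, 19 := x + j + 1, 20 := (y + Suc j) mod W, 18 :=
            l - j - 1)" for \<rho>'
      using I j unfolding that by (auto simp: I_def 17 eq_def less_Suc_eq)
    have eqv: "(if \<mu> (x + j) = \<mu> ((y + j) mod W) then 1 else 0) mod W = eq"
      using \<open>1 < W\<close> by (simp add: eq_def)
    show "ends S [Load 21 19, Load 22 20, Bin Eq 21 21 22, Bin And 17 17 21,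
     Bin Add 19 19 3, Bin Add 20 20 3, Bin Sub 18 18 3] \<rho>1 \<mu>1 7 (I (Suc j))"
      using bounds j
      apply -
      apply (rule ends_basic, simp, (simp add: add eqv flip: W_def split del: if_split)?)+
      apply (rule fin)
      apply (simp add: fun_eq_iff)
      done
  qed
  show ?thesis unfolding compare_prog_def
    by (rule ends_Loop[where N = l and t = 7 and I = I, OF _ body]) (use regs bounds t in \<open>auto simp: I_def\<close>)
qed

text \<open>Allows one coordinate to be drawn now, in step with a \<open>Rand\<close> command, while
  the others stay undrawn.\<close>

lemma Pi_pmf_insert_map:
  assumes "finite B" "x \<notin> B"
  shows "map_pmf F (Pi_pmf (insert x B) dflt p) =
    bind_pmf (p x) (\<lambda>u. map_pmf (\<lambda>f. F (f(x := u))) (Pi_pmf B dflt p))"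
  unfolding Pi_pmf_insert'[OF assms] map_bind_pmf by (simp add: map_pmf_def bind_assoc_pmf bind_return_pmf)

text \<open>At the last row the scan reads one cell past the sorted array and compares with whatever is stored
  at that address; register 17 starts at 0 there, so that the outcome is ignored.\<close>

definition emit_prog :: "com list" where
  "emit_prog =
     [Call 21 14 9, Const 14 0, Bin Less 22 2 21,
      Cond 22 [Const 20 2, Bin Add 19 15 20, Store 19 21, Store 13 15, Bin Add 13 13 3] []]"

definition scan_prog :: "com list" where
  "scan_prog =
     [Bin Add 14 14 3, Load 15 12, Bin Add 12 12 3, Load 16 12, Bin Less 17 3 11, Bin Add 18 1 10,
      Bin Add 19 15 8, Bin Add 20 16 8] @ compare_prog @ [Bin Sub 11 11 3]"

definition group_prog :: "com list" where
  "group_prog =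
     [Bin Add 11 0 10, Bin Add 12 4 10, Bin Add 13 5 10, Const 14 0,
      Loop 11 (scan_prog @ [Cond 17 [] (Rand 9 # emit_prog)])]"

text \<open>Equal entries of a sorted list are adjacent, so the running count of a group is the full
  count as soon as the next entry differs.\<close>

lemma count_list_take_last:
  assumes "sorted xs" "i < length xs" "i + 1 = length xs \<or> xs ! (i + 1) \<noteq> xs ! i"
  shows "count_list (take (i + 1) xs) (xs ! i) = count_list xs (xs ! i)" "xs ! i \<notin> set (drop (i + 1) xs)"
proof -
  show notin: "xs ! i \<notin> set (drop (i + 1) xs)"
  proof
    assume "xs ! i \<in> set (drop (i + 1) xs)"
    then obtain k where k: "i + 1 + k < length xs" "xs ! (i + 1 + k) = xs ! i"
      by (auto simp: in_set_conv_nth less_diff_conv add.commute)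
    then have "xs ! (i + 1) \<le> xs ! i" "xs ! i \<le> xs ! (i + 1)"
      using assms(1) sorted_nth_mono[of xs "i + 1" "i + 1 + k"] sorted_nth_mono[of xs i "i + 1"] by auto
    then show False using assms(3) k by auto
  qed
  have "count_list xs (xs ! i) = count_list (take (i + 1) xs) (xs ! i) + count_list (drop (i + 1)
      xs) (xs ! i)"
    by (metis append_take_drop_id count_list_append)
  then show "count_list (take (i + 1) xs) (xs ! i) = count_list xs (xs ! i)"
    using notin by (simp add: count_list_0_iff)
qed

section \<open>The scan over groups of equal keys\<close>

locale group_stage =
  fixes S :: machine and n l b A T R Z :: nat and ps :: "nat list" and \<mu>0 :: "nat \<Rightarrow> nat"
    and \<rho>0 :: "nat \<Rightarrow> nat" and tb :: nat
  assumes regs: "\<rho>0 0 = n" "\<rho>0 1 = l" "\<rho>0 2 = b" "\<rho>0 3 = 1" "\<rho>0 4 = A" "\<rho>0 5 = T" "\<rho>0 8 = 3" "\<rho>0 9 =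
      Z" "\<rho>0 10 = 0"
    and layout: "A + n \<le> T" "T + n \<le> R" "R + n < Z" "Z < 2 ^ word_size S" "3 < (2 :: nat) ^ word_size S"
    and addr: "\<And>p. p \<in> set ps \<Longrightarrow> R + n < p \<and> p + 3 + l \<le> Z"
    and spaced: "\<And>p p'. p \<in> set ps \<Longrightarrow> p' \<in> set ps \<Longrightarrow> p \<noteq> p' \<Longrightarrow> p + 3 + l \<le> p' \<or> p' + 3 + l \<le> p"
    and ps: "length ps = n" "distinct ps"
    and words: "\<And>p j. p \<in> set ps \<Longrightarrow> j < l \<Longrightarrow> \<mu>0 (p + 3 + j) < 2 ^ word_size S"
    and sorted: "sorted (map (\<lambda>p. read_block (word_size S) l \<mu>0 (p + 3)) ps)"
    and seed: "1 \<le> seed_range S" "0 < word_size S"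
    and mech: "\<And>c u. c \<le> n \<Longrightarrow> u \<in> {1..seed_range S} \<Longrightarrow> subroutine S c u \<le> n"
    and tb: "\<And>c u. c \<le> n \<Longrightarrow> u \<in> {1..seed_range S} \<Longrightarrow> sub_time S c u \<le> tb"
begin

abbreviation "w \<equiv> word_size S"
abbreviation "W \<equiv> (2 :: nat) ^ w"
text \<open>Keys are read in the snapshot \<open>\<mu>0\<close> taken after sorting, so that they
  stay fixed while the memory changes; \<open>mem_ok\<close> ties the current memory to it.\<close>

abbreviation "key p \<equiv> read_block w l \<mu>0 (p + 3)"
abbreviation "xs \<equiv> map key ps"

definition mem_ok :: "(nat \<Rightarrow> nat) \<Rightarrow> bool" where
  "mem_ok \<mu> \<longleftrightarrow> list_at \<mu> A ps \<and> (\<forall>p\<in>set ps. \<forall>j<l. \<mu> (p + 3 + j) = \<mu>0 (p + 3 + j)) \<and>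
     (\<forall>k\<le>n. \<mu> (R + k) = 0)"

text \<open>Strict increase of the keys provides both one node per key and the search-tree order of
  the final tree.\<close>

definition emitted :: "nat list \<Rightarrow> histogram \<Rightarrow> (nat \<Rightarrow> nat) \<Rightarrow> bool" where
  "emitted es h \<mu> \<longleftrightarrow> list_at \<mu> T es \<and> sorted_wrt (\<lambda>e e'. key e < key e') es \<and> set es \<subseteq> set ps \<and>
     (\<forall>e\<in>set es. h (key e) = \<mu> (e + 2) \<and> 0 < \<mu> (e + 2)) \<and> {x. 0 < h x} = key ` set es"

text \<open>\<open>es\<close> lists the nodes kept so far and \<open>h\<close> is the part of the histogram that is already determined;
  \<open>rest\<close> is the conditional distribution of the final histogram.\<close>

definition inv :: "nat \<Rightarrow> nat list \<Rightarrow> histogram \<Rightarrow> (nat \<Rightarrow> nat) \<Rightarrow> (nat \<Rightarrow> nat) \<Rightarrow> bool" where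
  "inv i es h \<rho> \<mu> \<longleftrightarrow> (\<forall>r<11. \<rho> r = \<rho>0 r) \<and> \<rho> 11 = n - i \<and> \<rho> 12 = A + i \<and>
     \<rho> 13 = T + length es \<and> (i < n \<longrightarrow> \<rho> 14 = count_list (take i xs) (xs ! i)) \<and>
     mem_ok \<mu> \<and> emitted es h \<mu> \<and> length es \<le> i \<and> (\<forall>e\<in>set es. key e \<notin> set (drop i xs))"

definition rest :: "nat \<Rightarrow> histogram \<Rightarrow> histogram pmf" where
  "rest i h = map_pmf (\<lambda>u x. if x \<in> set (drop i xs)
       then (let v = subroutine S (count_list xs x) (u x) in if b < v then v else 0) else h x)
     (Pi_pmf (set (drop i xs)) 0 (\<lambda>_. uniform_seed (seed_range S)))"

lemma drop_xs: "i < n \<Longrightarrow> drop i xs = xs ! i # drop (i + 1) xs"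
  using Cons_nth_drop_Suc[of i xs] ps(1) by (simp flip: Suc_eq_plus1)

lemma rest_n: "rest n h = return_pmf h"
  using ps(1) by (simp add: rest_def)

text \<open>The remaining law depends on the rows ahead only through their set of keys, which does
  not shrink inside a group; hence nothing is sampled there.\<close>

lemma rest_same:
  assumes "i + 1 < n" "xs ! (i + 1) = xs ! i"
  shows "rest (i + 1) h = rest i h"
proof -
  have "drop i xs = xs ! i # drop (i + 1) xs" "drop (i + 1) xs = xs ! (i + 1) # drop (i + 1 + 1) xs"
    using assms(1) by (auto intro!: drop_xs simp del: nth_map)
  then have "set (drop i xs) = set (drop (i + 1) xs)" unfolding assms(2) by auto
  then show ?thesis by (simp only: rest_def)
qed

text \<open>At the last row of a group its key leaves the set of undrawn coordinates. Drawing this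
  coordinate first is exactly what \<open>Rand\<close> does.\<close>

lemma rest_new:
  assumes "i < n" "i + 1 = n \<or> xs ! (i + 1) \<noteq> xs ! i"
  shows "rest i h = bind_pmf (uniform_seed (seed_range S))
    (\<lambda>u. rest (i + 1) (h(xs ! i := let v = subroutine S (count_list xs (xs ! i)) u in if b < v then
        v else 0)))"
proof -
  have new: "xs ! i \<notin> set (drop (i + 1) xs)"
    using assms ps(1) sorted by (intro count_list_take_last) auto
  have set: "set (drop i xs) = insert (xs ! i) (set (drop (i + 1) xs))"
    using drop_xs[OF assms(1)] by (simp only: list.set(2))
  show ?thesis unfolding rest_def set
    by (subst Pi_pmf_insert_map) (use new in \<open>auto simp: fun_eq_iff Let_def intro!: bind_pmf_cong
        map_pmf_cong\<close>)
qed

lemma xs_le: "i \<le> i' \<Longrightarrow> i' < n \<Longrightarrow> xs ! i \<le> xs ! i'"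
  using sorted sorted_nth_mono[of xs i i'] ps(1) by simp

lemma ends_scan_prog:
  assumes inv: "inv i es h \<rho> \<mu>" and i: "i < n" and t: "8 * l + 10 \<le> t"
  shows "ends S scan_prog \<rho> \<mu> t (\<lambda>\<rho>' \<mu>'. \<mu>' = \<mu> \<and> (\<forall>r<11. \<rho>' r = \<rho>0 r) \<and> \<rho>' 11 = n - (i + 1) \<and>
    \<rho>' 12 = A + (i + 1) \<and> \<rho>' 13 = T + length es \<and> \<rho>' 14 = count_list (take (i + 1) xs) (xs ! i) \<and>
    \<rho>' 15 = ps ! i \<and> \<rho>' 17 = (if i + 1 < n \<and> xs ! (i + 1) = xs ! i then 1 else 0))"
    (is "ends _ _ _ _ _ ?Q")
proof -
  let ?c = "count_list (take i xs) (xs ! i)"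
  define p where "p = ps ! i"
  define p' where "p' = \<mu> (A + i + 1)"
  have p: "p \<in> set ps" using i ps(1) by (simp add: p_def)
  have mem: "list_at \<mu> A ps" "\<And>p j. p \<in> set ps \<Longrightarrow> j < l \<Longrightarrow> \<mu> (p + 3 + j) = \<mu>0 (p + 3 + j)"
    using inv by (auto simp: inv_def mem_ok_def)
  have c: "count_list (take (i + 1) xs) (xs ! i) = ?c + 1"
    using i ps(1) by (simp add: take_Suc_conv_app_nth flip: Suc_eq_plus1)
  have "?c \<le> length (take i xs)" by (rule count_le_length)
  then have cn: "?c + 1 \<le> n" using i ps(1) by simp
  have [simp]: "\<rho> 11 = n - i" "\<rho> 12 = A + i" "\<rho> 14 = ?c" "\<rho> 3 = 1" "\<rho> 1 = l" "\<rho> 8 = 3" "\<rho> 10 = 0"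
    using inv i regs by (simp_all add: inv_def)
  have [simp]: "\<mu> (A + i) = p" using mem(1) i ps(1) by (simp add: list_at_def p_def)
  have b: "p + 3 < W" "p + 3 + l < W" "A + i + 1 < W" "n < W" "l < W" "1 < W" "?c + 1 < W"
    using addr[OF p] layout cn i by linarith+
  let ?\<rho> = "\<rho>(14 := ?c + 1, 15 := p, 12 := A + i + 1, 16 := p', 17 := if i + 1 < n then 1 else 0, 18 := l,
     19 := p + 3, 20 := binop_val Add w p' 3)"
  have "ends S compare_prog ?\<rho> \<mu> (8 * l + 1) (\<lambda>\<rho>' \<mu>'. ends S [Bin Sub 11 11 3] \<rho>' \<mu>' (8 * l + 2 - (8
      * l + 1)) ?Q)"
  proof (rule ends_mono[OF ends_compare_prog[where e = "i + 1 < n" and l = l and x = "p + 3"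
        and y = "binop_val Add w p' 3", OF _ _ _ _ _ _ _ order_refl] order_refl])
    show "binop_val Add w p' 3 < W" by (simp add: binop_val.simps(1))
  next
    fix \<rho>1 \<mu>1
    assume 1: "\<mu>1 = \<mu> \<and> (\<forall>r<17. \<rho>1 r = ?\<rho> r) \<and> \<rho>1 17 = (if i + 1 < n \<and>
      (\<forall>j<l. \<mu> (p + 3 + j) = \<mu> ((binop_val Add w p' 3 + j) mod W)) then 1 else 0)"
    have "(\<forall>j<l. \<mu> (p + 3 + j) = \<mu> ((binop_val Add w p' 3 + j) mod W)) \<longleftrightarrow> xs ! (i + 1) = xs ! i"
      if i1: "i + 1 < n"
    proof -
      have p': "p' = ps ! (i + 1)" using mem(1) i1 ps(1) by (simp add: list_at_def p'_def add.assoc)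
      then have p'_in: "p' \<in> set ps" using i1 ps(1) by simp
      have "p' + 3 + l < W" using addr[OF p'_in] layout by linarith
      then have "(binop_val Add w p' 3 + j) mod W = p' + 3 + j" if "j < l" for j using that by simp
      then have "(\<forall>j<l. \<mu> (p + 3 + j) = \<mu> ((binop_val Add w p' 3 + j) mod W)) \<longleftrightarrow>
          (\<forall>j<l. \<mu>0 (p + 3 + j) = \<mu>0 (p' + 3 + j))"
        using mem(2)[OF p] mem(2)[OF p'_in] by simp
      also have "\<dots> \<longleftrightarrow> key p = key p'"
        using words[OF p] words[OF p'_in] by (intro read_block_inject[symmetric])
      also have "\<dots> \<longleftrightarrow> xs ! (i + 1) = xs ! i" using i1 ps(1) p' by (auto simp: p_def)
      finally show ?thesis .
    qed
    then have 17: "\<rho>1 17 = (if i + 1 < n \<and> xs ! (i + 1) = xs ! i then 1 else 0)"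
      using 1 by (cases "i + 1 < n") simp_all
    have "?Q (\<rho>1(11 := n - i - 1)) \<mu>1"
      using 1 17 inv unfolding c by (simp add: inv_def p_def)
    moreover have "\<rho>1 11 = n - i" "\<rho>1 3 = 1" using 1 by simp_all
    ultimately show "ends S [Bin Sub 11 11 3] \<rho>1 \<mu>1 (8 * l + 2 - (8 * l + 1)) ?Q"
      using b i
      apply -
      apply (rule ends_basic, simp)
      apply simp
      done
  qed (use b in auto)
  then have E: "ends S (compare_prog @ [Bin Sub 11 11 3]) ?\<rho> \<mu> (8 * l + 2) ?Q"
    by (rule ends_append) simp
  have more: "(if 1 < n - i then 1 else 0) mod W = (if i + 1 < n then 1 else 0)" using b by auto
  have "ends S scan_prog \<rho> \<mu> (8 * l + 10) ?Q"
    using b unfolding scan_prog_def append_Cons append_Nil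
    apply -
    apply (rule ends_basic, simp, (simp add: more flip: p'_def split del: if_split)?)+
    apply (rule ends_cong[OF E])
    apply (simp_all add: fun_eq_iff)
    done
  then show ?thesis by (rule ends_mono) (use t in simp_all)
qed

lemma ends_emit_prog:
  fixes \<mu>1 u
  defines "\<mu> \<equiv> write_block w (seed_words S) Z u \<mu>1"
  assumes u: "u \<in> {1..seed_range S}"
    and regs1: "\<forall>r<11. \<rho> r = \<rho>0 r" "\<rho> 11 = n - (i + 1)" "\<rho> 12 = A + (i + 1)" "\<rho> 13 = T + length es"
      "\<rho> 14 = count_list xs (xs ! i)" "\<rho> 15 = ps ! i"
    and mem: "mem_ok \<mu>1" "emitted es h \<mu>1" "length es \<le> i" "\<forall>e\<in>set es. key e \<notin> set (drop i xs)"
    and i: "i < n" and new: "i + 1 = n \<or> xs ! (i + 1) \<noteq> xs ! i" and h: "h (xs ! i) = 0"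
    and t: "tb + 9 \<le> t"
  shows "ends S emit_prog \<rho> \<mu> t (\<lambda>\<rho>' \<mu>'. \<exists>es'. inv (i + 1) es'
    (h(xs ! i := let v = subroutine S (count_list xs (xs ! i)) u in if b < v then v else 0)) \<rho>' \<mu>')"
    (is "ends _ _ _ _ _ ?Q")
proof -
  define c where "c = count_list xs (xs ! i)"
  define v where "v = subroutine S c u"
  define p where "p = ps ! i"
  have p: "p \<in> set ps" "xs ! i = key p" using i ps(1) by (simp_all add: p_def)
  have "c \<le> length xs" unfolding c_def by (rule count_le_length)
  then have cn: "c \<le> n" using ps(1) by simp
  have v: "v \<le> n" "v < W" using mech[OF cn u] layout by (auto simp: v_def)
  \<comment> \<open>All data of the invariant lie below \<open>Z\<close>, so the seed block
    overwrites none of them, whatever its length.\<close>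
  have below: "\<mu> x = \<mu>1 x" if "x < Z" for x using that by (simp add: \<mu>_def write_block_def)
  have "seed_range S < 2 ^ (w * seed_words S)"
    unfolding seed_words_def using seed by (intro less_num_words)
  then have u_read: "read_block w (seed_words S) \<mu> Z = u"
    unfolding \<mu>_def using u by (intro read_write_block) simp
  have mem': "mem_ok \<mu>"
    unfolding mem_ok_def
  proof (intro conjI ballI allI impI)
    show "list_at \<mu> A ps" using mem(1) layout ps(1) by (auto simp: mem_ok_def list_at_def below)
    show "\<mu> (R + k) = 0" if "k \<le> n" for k using mem(1) layout that by (simp add: mem_ok_def below)
    show "\<mu> (q + 3 + j) = \<mu>0 (q + 3 + j)" if "q \<in> set ps" "j < l" for q j
      using mem(1) addr[OF that(1)] that by (simp add: mem_ok_def below)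
  qed
  have es_sub: "set es \<subseteq> set ps" using mem(2) by (simp add: emitted_def)
  have em': "emitted es h \<mu>"
  proof -
    have "\<mu> (e + 2) = \<mu>1 (e + 2)" if "e \<in> set es" for e
    proof -
      have "e \<in> set ps" using es_sub that by blast
      then show ?thesis using addr[of e] by (intro below) simp
    qed
    then show ?thesis using mem(2,3) layout i by (auto simp: emitted_def list_at_def below)
  qed
  have drop: "drop i xs = xs ! i # drop (i + 1) xs"
    using i by (rule drop_xs)
  have last: "xs ! i \<notin> set (drop (i + 1) xs)"
    using i new ps(1) sorted by (intro count_list_take_last) auto
  \<comment> \<open>The key of a kept node occurs in the sorted list but not from position
    \<open>i\<close> on; so it occurs before, and it differs from the current key.\<close>
  have key_less: "key e < key p" if e: "e \<in> set es" for e
  proof -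
    have "key e \<in> set xs" using e es_sub by auto
    then obtain k where k: "k < n" "key e = xs ! k" using ps(1) by (auto simp: in_set_conv_nth)
    have "k < i"
    proof (rule ccontr)
      assume "\<not> k < i"
      then have "xs ! k \<in> set (drop i xs)" using k(1) ps(1)
        by (auto simp: in_set_conv_nth intro!: exI[of _ "k - i"])
      then have "key e \<in> set (drop i xs)" by (simp only: k(2))
      then show False using mem(4) e by blast
    qed
    then have "key e \<le> key p" using xs_le[of k i] i k(2) p(2) by simp
    moreover have "key e \<noteq> key p" using mem(4) e p(2) drop by auto
    ultimately show ?thesis by simp
  qed
  \<comment> \<open>The counter is reset to 0 at the end of a group; this is the right value
    because, by sortedness, the next key has not occurred yet.\<close>
  have count: "i + 1 < n \<longrightarrow> 0 = count_list (take (i + 1) xs) (xs ! (i + 1))"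
  proof
    assume i1: "i + 1 < n"
    have "xs ! (i + 1) \<notin> set (take (i + 1) xs)"
    proof
      assume "xs ! (i + 1) \<in> set (take (i + 1) xs)"
      then obtain k where k: "k < i + 1" "xs ! (i + 1) = xs ! k"
        by (auto simp: in_set_conv_nth)
      have "xs ! k \<le> xs ! i" "xs ! i \<le> xs ! (i + 1)" using i1 k(1) by (auto intro!: xs_le simp del: nth_map)
      then show False using k(2) new i1 by simp
    qed
    then show "0 = count_list (take (i + 1) xs) (xs ! (i + 1))" by (simp add: count_list_0_iff)
  qed
  have inv0: "inv (i + 1) es (h(xs ! i := 0)) \<rho>' \<mu>"
    if "\<forall>r<11. \<rho>' r = \<rho>0 r" "\<rho>' 11 = n - (i + 1)" "\<rho>' 12 = A + (i + 1)" "\<rho>' 13 =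
        T + length es" "\<rho>' 14 = 0" for \<rho>'
  proof -
    \<comment> \<open>A noisy count that fails the threshold contributes the value 0, which
      \<open>h\<close> already has at this key.\<close>
    have "h(xs ! i := 0) = h" using h by auto
    then show ?thesis
      using that mem' em' mem(3,4) count drop by (simp add: inv_def)
  qed
  have inv1: "inv (i + 1) (es @ [p]) (h(xs ! i := v)) \<rho>' (\<mu>(p + 2 := v, T + length es := p))"
    if "\<forall>r<11. \<rho>' r = \<rho>0 r" "\<rho>' 11 = n - (i + 1)" "\<rho>' 12 = A + (i + 1)" "\<rho>' 13 =
        T + length es + 1" "\<rho>' 14 = 0" "b < v" for \<rho>'
  proof -
    let ?\<mu> = "\<mu>(p + 2 := v, T + length es := p)"
    have lenT: "T + length es < R" using mem(3) i layout by simp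
    have pR: "R + n < p" using addr[OF p(1)] by simp
    have "mem_ok ?\<mu>"
      unfolding mem_ok_def
    proof (intro conjI ballI allI impI)
      show "list_at ?\<mu> A ps"
        using mem' layout pR ps(1) by (auto simp: mem_ok_def list_at_def)
    next
      fix q j assume q: "q \<in> set ps" "j < l"
      have "q + 3 + j \<noteq> p + 2" using spaced[OF p(1) q(1)] q(2) by (cases "p = q") auto
      moreover have "q + 3 + j \<noteq> T + length es" using addr[OF q(1)] lenT by simp
      ultimately show "?\<mu> (q + 3 + j) = \<mu>0 (q + 3 + j)" using mem' q by (simp add: mem_ok_def)
    next
      fix k assume "k \<le> n"
      then show "?\<mu> (R + k) = 0" using mem' pR lenT by (simp add: mem_ok_def)
    qed
    moreover have "emitted (es @ [p]) (h(xs ! i := v)) ?\<mu>"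
      unfolding emitted_def
    proof (intro conjI ballI)
      have "list_at \<mu> T es" using em' by (simp add: emitted_def)
      then have "list_at ?\<mu> T es" by (rule list_at_cong) (use lenT pR mem(3) i layout in auto)
      then show "list_at ?\<mu> T (es @ [p])" by (simp add: list_at_snoc)
      show "sorted_wrt (\<lambda>e e'. key e < key e') (es @ [p])"
        using em' key_less by (simp add: emitted_def sorted_wrt_append)
      show "set (es @ [p]) \<subseteq> set ps" using es_sub p by simp
      have "key ` set (es @ [p]) = insert (key p) {x. 0 < h x}" using em' by (auto simp: emitted_def)
      then show "{x. 0 < (h(xs ! i := v)) x} = key ` set (es @ [p])"
        using \<open>b < v\<close> unfolding p(2) by auto
      fix e assume "e \<in> set (es @ [p])"
      then consider "e = p" | "e \<in> set es" "e \<noteq> p" by auto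
      then have "(h(xs ! i := v)) (key e) = ?\<mu> (e + 2) \<and> 0 < ?\<mu> (e + 2)"
      proof cases
        case 1
        then show ?thesis using \<open>b < v\<close> pR lenT by (simp add: p(2))
      next
        case 2
        have "e \<in> set ps" using 2 es_sub by blast
        then have "e + 2 \<noteq> p + 2" "e + 2 \<noteq> T + length es" using addr[of e] lenT 2 by auto
        then show ?thesis using em' 2 key_less[of e] by (auto simp: emitted_def p(2))
      qed
      then show "(h(xs ! i := v)) (key e) = ?\<mu> (e + 2)" "0 < ?\<mu> (e + 2)" by blast+
    qed
    moreover have "\<forall>e\<in>set (es @ [p]). key e \<notin> set (drop (i + 1) xs)"
      using mem(4) drop last p(2) by auto
    ultimately show ?thesis using that mem(3) count by (simp add: inv_def)
  qed
  have [simp]: "\<rho> 13 = T + length es" "\<rho> 14 = c" "\<rho> 15 = p" "\<rho> 9 = Z" "\<rho> 2 = b" "\<rho> 3 = 1"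
    using regs1 regs by (simp_all add: c_def p_def)
  have b: "p + 2 < W" "T + length es + 1 < W" "b < v \<Longrightarrow> b < W" "1 < W" "2 < W"
    using addr[OF p(1)] layout mem(3) i v by auto
  let ?\<rho> = "\<rho>(21 := v, 14 := 0, 22 := if b < v then 1 else 0)"
  have E: "ends S [Cond 22 [Const 20 2, Bin Add 19 15 20, Store 19 21, Store 13 15, Bin Add 13 13 3] []]
      ?\<rho> \<mu> 6 ?Q"
  proof (cases "b < v")
    case True
    have "?Q (?\<rho>(20 := 2, 19 := p + 2, 13 := T + length es + 1)) (\<mu>(p + 2 := v, T + length es := p))"
      using True inv1[of "?\<rho>(20 := 2, 19 := p + 2, 13 := T + length es + 1)"] regs1
      by (auto simp: v_def c_def Let_def)
    then show ?thesis using True b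
      apply -
      apply (rule ends_Cond, simp, simp)
      apply (rule ends_basic, simp, simp?)+
      done
  next
    case False
    have "?Q ?\<rho> \<mu>" using False inv0[of ?\<rho>] regs1 by (auto simp: v_def c_def Let_def)
    then show ?thesis using False
      apply -
      apply (rule ends_Cond, simp, simp)
      done
  qed
  have "ends S emit_prog \<rho> \<mu> (9 + sub_time S c u) ?Q"
    unfolding emit_prog_def
    apply (rule ends_Call[of u])
      apply (simp add: u_read)
     apply simp
    apply simp
    apply (rule ends_basic, simp, simp)
    apply (rule ends_basic, simp, simp split del: if_split)
    apply (rule ends_cong[OF E])
    using v b apply (simp_all add: fun_eq_iff flip: v_def)
    done
  then show ?thesis by (rule ends_mono) (use t tb[OF cn u] in simp_all)
qed

text \<open>After sampling there is no single final state for \<open>ends\<close> to speak of, so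
  the continuation \<open>cs\<close> is part of the statement and must be known for every possible
  \<open>h\<close>. The 22 collects the loop test, the fixed costs 10 of the scan and 9 of the
  emission, the branch, and the oracle query.\<close>

lemma achieves_group_loop:
  assumes tail: "\<And>\<rho> \<mu> es h. inv n es h \<rho> \<mu> \<Longrightarrow> achieves S cs \<rho> \<mu> t0 (return_pmf h) Q"
    and "inv i es h \<rho> \<mu>" "i \<le> n"
  shows "achieves S (Loop 11 (scan_prog @ [Cond 17 [] (Rand 9 # emit_prog)]) # cs) \<rho> \<mu>
    ((n - i) * (8 * l + tb + seed_words S + 22) + 1 + t0) (rest i h) Q"
  using assms(2,3)
proof (induction "n - i" arbitrary: i es h \<rho> \<mu>)
  case 0
  then have "i = n" "\<rho> 11 = 0" unfolding inv_def by simp_all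
  then show ?case using tail 0 by (intro achieves_Loop[where T' = t0]) (simp_all add: rest_n)
next
  case (Suc k)
  let ?loop = "Loop 11 (scan_prog @ [Cond 17 [] (Rand 9 # emit_prog)])"
  let ?t = "8 * l + tb + seed_words S + 22"
  have i: "i < n" "k = n - (i + 1)" using Suc.hyps by simp_all
  have IH: "achieves S (?loop # cs) \<rho> \<mu> (k * ?t + 1 + t0) (rest (i + 1) h) Q" if "inv (i + 1) es h \<rho>
      \<mu>" for es h \<rho> \<mu>
    using Suc.hyps(1)[OF i(2) that] i by simp
  have inv: "inv i es h \<rho> \<mu>" by (rule Suc.prems)
  have "ends S scan_prog \<rho> \<mu> (8 * l + 10) (\<lambda>\<rho>' \<mu>'.
     achieves S (Cond 17 [] (Rand 9 # emit_prog) # ?loop # cs) \<rho>' \<mu>' (tb + seed_words S + 11 + (k *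
         ?t + 1 + t0)) (rest i h) Q)"
  proof (rule ends_mono[OF ends_scan_prog[OF inv i(1) order_refl] order_refl])
    fix \<rho>1 \<mu>1
    assume 1: "\<mu>1 = \<mu> \<and> (\<forall>r<11. \<rho>1 r = \<rho>0 r) \<and> \<rho>1 11 = n - (i + 1) \<and>
      \<rho>1 12 = A + (i + 1) \<and> \<rho>1 13 = T + length es \<and> \<rho>1 14 = count_list (take (i + 1) xs) (xs ! i) \<and>
      \<rho>1 15 = ps ! i \<and> \<rho>1 17 = (if i + 1 < n \<and> xs ! (i + 1) = xs ! i then 1 else 0)"
    have drop: "drop i xs = xs ! i # drop (i + 1) xs"
      using i(1) by (rule drop_xs)
    show "achieves S (Cond 17 [] (Rand 9 # emit_prog) # ?loop #
        cs) \<rho>1 \<mu>1 (tb + seed_words S + 11 + (k * ?t + 1 + t0)) (rest i h) Q"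
    proof (cases "i + 1 < n \<and> xs ! (i + 1) = xs ! i")
      case True
      have "inv (i + 1) es h \<rho>1 \<mu>1" unfolding inv_def using 1 inv True drop by (auto simp: inv_def)
      from IH[OF this] True 1 rest_same[of i h] show ?thesis
        by (intro achieves_Cond[where T' = "k * ?t + 1 + t0"]) simp_all
    next
      case False
      then have new: "i + 1 = n \<or> xs ! (i + 1) \<noteq> xs ! i" using i by linarith
      have c: "count_list (take (i + 1) xs) (xs ! i) = count_list xs (xs ! i)"
        using i new ps(1) sorted by (intro count_list_take_last) auto
      have "key ` set es = {x. 0 < h x}" using inv by (simp add: inv_def emitted_def)
      moreover have "xs ! i \<notin> key ` set es" using inv drop by (auto simp: inv_def)
      ultimately have "xs ! i \<notin> {x. 0 < h x}" by (rule subst)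
      then have h0: "h (xs ! i) = 0" by (simp del: nth_map)
      have "achieves S (Rand 9 # emit_prog @ ?loop # cs) \<rho>1 \<mu>1 (1 + seed_words S + (tb + 9 + (k * ?t
          + 1 + t0))) (rest i h) Q"
        unfolding rest_new[OF i(1) new]
      proof (rule achieves_Rand[OF seed(1) _ order_refl])
        fix u assume u: "u \<in> {1..seed_range S}"
        have Z: "\<rho>1 9 = Z" using 1 regs by simp
        show "achieves S (emit_prog @ ?loop # cs) \<rho>1 (write_block w (seed_words S) (\<rho>1 9) u \<mu>1)
          (tb + 9 + (k * ?t + 1 + t0)) (rest (i + 1) (h(xs ! i :=
             let v = subroutine S (count_list xs (xs ! i)) u in if b < v then v else 0))) Q"
          unfolding Z
        proof (rule achieves_append[OF ends_mono[OF ends_emit_prog[where h = h and i = i and es =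
            es, OF u _ _ _ _ _ _ _ _ _ _ i(1) new _ order_refl] order_refl] order_refl])
          fix \<rho>' \<mu>'
          assume "\<exists>es'. inv (i + 1) es' (h(xs ! i := let v =
              subroutine S (count_list xs (xs ! i)) u in if b < v then v else 0)) \<rho>' \<mu>'"
          then show "achieves S (?loop # cs) \<rho>' \<mu>' (k * ?t + 1 + t0) (rest (i + 1) (h(xs ! i :=
             let v = subroutine S (count_list xs (xs ! i)) u in if b < v then v else 0))) Q"
            using IH by blast
        qed (use 1 inv c h0 in \<open>auto simp: inv_def\<close>)
      qed
      then show ?thesis using False 1
        by (intro achieves_Cond[where T' = "1 + seed_words S + (tb + 9 + (k * ?t + 1 + t0))"]) auto
    qed
  qed
  then have "achieves S (scan_prog @ [Cond 17 [] (Rand 9 # emit_prog)] @ ?loop # cs) \<rho> \<mu>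
      (8 * l + 10 + (tb + seed_words S + 11 + (k * ?t + 1 + t0))) (rest i h) Q"
    by (intro achieves_append[OF _ order_refl]) simp
  moreover have "\<rho> 11 \<noteq> 0" using inv i by (simp add: inv_def)
  moreover have "n - i = Suc k" using Suc.hyps by simp
  ultimately show ?case
    by (intro achieves_Loop[where T' = "8 * l + 10 + (tb + seed_words S + 11 + (k * ?t + 1 + t0))"]) simp_all
qed

end

section \<open>Privacy and accuracy\<close>

lemma set_uniform_seed: "1 \<le> d \<Longrightarrow> set_pmf (uniform_seed d) = {1..d}"
  unfolding uniform_seed_def by (subst set_pmf_of_set) auto

text \<open>The law of one coordinate. Absent elements receive the point mass at 0, so that the
  product can be taken over the whole universe, an index set common to both datasets.\<close>

definition noisy :: "nat \<Rightarrow> (nat \<Rightarrow> nat \<Rightarrow> nat) \<Rightarrow> nat \<Rightarrow> nat \<Rightarrow> nat pmf" where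
  "noisy d M b c = (if c = 0 then return_pmf 0
     else map_pmf (\<lambda>u. if b < M c u then M c u else 0) (uniform_seed d))"

lemma set_eq_count_list: "{x. 0 < count_list D x} = set D"
  by (auto simp: count_list_0_iff neq0_conv[symmetric] simp del: neq0_conv)

lemma Pi_pmf_map_dependent:
  assumes "finite A"
  shows "map_pmf (\<lambda>u x. if x \<in> A then g x (u x) else dflt) (Pi_pmf A dflt' p) =
    Pi_pmf A dflt (\<lambda>x. map_pmf (g x) (p x))"
  using assms unfolding map_pmf_def by (subst Pi_pmf_bind[where d' = dflt']) simp_all

lemma stability_histogram_eq_Pi_pmf:
  assumes "finite X" "set D \<subseteq> X"
  shows "stability_histogram d M b D = Pi_pmf X 0 (\<lambda>x. noisy d M b (count_list D x))"
proof -
  have "stability_histogram d M b D =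
      map_pmf (\<lambda>u x. if x \<in> set D then if b < M (count_list D x) (u x) then M (count_list D x) (u x)
          else 0 else 0)
        (Pi_pmf (set D) 0 (\<lambda>_. uniform_seed d))"
    unfolding stability_histogram_def set_eq_count_list Let_def by (intro map_pmf_cong) (auto simp:
        fun_eq_iff)
  also have "\<dots> = Pi_pmf (set D) 0
      (\<lambda>x. map_pmf (\<lambda>u. if b < M (count_list D x) u then M (count_list D x) u else 0) (uniform_seed d))"
    by (rule Pi_pmf_map_dependent) simp
  also have "\<dots> = Pi_pmf (set D) 0 (\<lambda>x. noisy d M b (count_list D x))"
    by (intro Pi_pmf_cong) (auto simp: noisy_def count_list_0_iff)
  also have "\<dots> = Pi_pmf X 0 (\<lambda>x. noisy d M b (count_list D x))"
    using assms by (intro Pi_pmf_subset'[symmetric]) (auto simp: noisy_def count_list_0_iff)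
  finally show ?thesis .
qed

section \<open>Privacy: changing one coordinate of a product at a time\<close>

lemma prob_bind_pmf_le:
  assumes le: "\<And>x. measure_pmf.prob (f x) S \<le> e * measure_pmf.prob (g x) S + \<delta>"
    and "0 \<le> e" "0 \<le> \<delta>"
  shows "measure_pmf.prob (bind_pmf p f) S \<le> e * measure_pmf.prob (bind_pmf p g) S + \<delta>"
proof -
  have "emeasure (bind_pmf p f) S = (\<integral>\<^sup>+x. emeasure (f x) S \<partial>p)" by simp
  \<comment> \<open>The bound is averaged over \<open>p\<close> with nonnegative integrals, where no
    integrability has to be shown.\<close>
  also have "\<dots> \<le> (\<integral>\<^sup>+x. ennreal e * emeasure (g x) S + ennreal \<delta> \<partial>p)"
    using le assms(2,3)
    by (intro nn_integral_mono)
      (simp add: measure_pmf.emeasure_eq_measure flip: ennreal_mult ennreal_plus)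
  also have "\<dots> = ennreal e * emeasure (bind_pmf p g) S + ennreal \<delta>"
    by (simp add: nn_integral_add nn_integral_cmult)
  also have "\<dots> = ennreal (e * measure_pmf.prob (bind_pmf p g) S + \<delta>)"
    using assms(2,3) by (simp add: measure_pmf.emeasure_eq_measure flip: ennreal_mult ennreal_plus)
  finally show ?thesis
    using assms(2,3) by (simp add: measure_pmf.emeasure_eq_measure del: ennreal_plus)
qed

text \<open>Conditioning on all other coordinates reduces the product to the single coordinate
  \<open>x\<close>; hence that coordinate is drawn last here.\<close>

lemma prob_Pi_pmf_upd_le:
  assumes "finite X" "x \<in> X"
    and le: "\<And>S. measure_pmf.prob (p x) S \<le> e * measure_pmf.prob q S + \<delta>" and "0 \<le> e" "0 \<le> \<delta>"
  shows "measure_pmf.prob (Pi_pmf X dflt p) S \<le> e * measure_pmf.prob (Pi_pmf X dflt (p(x := q))) S + \<delta>"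
proof -
  define B where "B = X - {x}"
  have B: "finite B" "x \<notin> B" "X = insert x B" using assms(1,2) by (auto simp: B_def)
  have eq: "Pi_pmf X dflt r = bind_pmf (Pi_pmf B dflt r) (\<lambda>f. map_pmf (\<lambda>y. f(x := y)) (r x))" for r
    unfolding B(3) Pi_pmf_insert'[OF B(1,2)] by (subst bind_commute_pmf) (simp add: map_pmf_def)
  have B_eq: "Pi_pmf B dflt (p(x := q)) = Pi_pmf B dflt p"
    using B(2) by (intro Pi_pmf_cong) auto
  show ?thesis unfolding eq B_eq
    by (rule prob_bind_pmf_le) (use assms(3-) in simp_all)
qed

lemma counting_dp_Suc:
  assumes dp: "counting_dp n d \<epsilon> 0 M" and c: "c < n"
  shows "measure_pmf.prob (map_pmf (M c) (uniform_seed d)) S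
      \<le> exp \<epsilon> * measure_pmf.prob (map_pmf (M (Suc c)) (uniform_seed d)) S"
    and "measure_pmf.prob (map_pmf (M (Suc c)) (uniform_seed d)) S
      \<le> exp \<epsilon> * measure_pmf.prob (map_pmf (M c) (uniform_seed d)) S"
proof -
  \<comment> \<open>Datasets with \<open>c\<close> ones followed by the bit \<open>v\<close> and
    zeros: changing \<open>v\<close> moves between the counts \<open>c\<close> and
    \<open>c + 1\<close>.\<close>
  define D where "D = (\<lambda>v. replicate c (1 :: nat) @ v # replicate (n - c - 1) 0)"
  have D: "D 0 \<in> datasets {0, 1} n" "D 1 \<in> datasets {0, 1} n"
    using c by (auto simp: D_def datasets_def)
  have sum: "sum_list (D 0) = c" "sum_list (D 1) = Suc c"
    by (simp_all add: D_def sum_list_replicate)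
  have nb: "neighbors (D u) (D v)" if "u \<noteq> v" for u v
  proof -
    have "{i. i < length (D u) \<and> D u ! i \<noteq> D v ! i} = {c}"
      using that by (auto simp: D_def nth_append nth_Cons' split: if_splits)
    then show ?thesis by (simp add: neighbors_def) (simp add: D_def)
  qed
  have "measure_pmf.prob (map_pmf (M (sum_list (D u))) (uniform_seed d)) S
      \<le> exp \<epsilon> * measure_pmf.prob (map_pmf (M (sum_list (D v))) (uniform_seed d)) S + 0"
    if "D u \<in> datasets {0, 1} n" "D v \<in> datasets {0, 1} n" "u \<noteq> v" for u v
    using dp nb[OF that(3)] that(1,2) unfolding counting_dp_def differentially_private_def by blast
  from this[of 0 1] this[of 1 0] D sum show
    "measure_pmf.prob (map_pmf (M c) (uniform_seed d)) S
      \<le> exp \<epsilon> * measure_pmf.prob (map_pmf (M (Suc c)) (uniform_seed d)) S"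
    "measure_pmf.prob (map_pmf (M (Suc c)) (uniform_seed d)) S
      \<le> exp \<epsilon> * measure_pmf.prob (map_pmf (M c) (uniform_seed d)) S"
    by simp_all
qed

text \<open>For positive counts, thresholding is postprocessing of the private count. Between 0 and
  1 the noisy value can be nonzero only when \<open>M 1 u\<close> exceeds \<open>b\<close>. The
  error is returned as purely multiplicative or purely additive, with the same pair for both
  directions; a mixture would let one coordinate scale the additive error of the other.\<close>

lemma noisy_Suc:
  fixes b :: nat
  assumes dp: "counting_dp n d \<epsilon> 0 M" and r: "Suc r \<le> n"
  defines "\<gamma> \<equiv> measure_pmf.prob (uniform_seed d) {u. b < M 1 u}"
  obtains e \<delta> where "(e = 1 \<and> \<delta> = \<gamma>) \<or> (e = exp \<epsilon> \<and> \<delta> = 0)"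
    "\<And>S. measure_pmf.prob (noisy d M b (Suc r)) S \<le> e * measure_pmf.prob (noisy d M b r) S + \<delta>"
    "\<And>S. measure_pmf.prob (noisy d M b r) S \<le> e * measure_pmf.prob (noisy d M b (Suc r)) S + \<delta>"
proof (cases "r = 0")
  case True
  let ?U = "measure_pmf.prob (uniform_seed d)"
  define F where "F = (\<lambda>u. if b < M 1 u then M 1 u else 0)"
  have N0: "measure_pmf.prob (noisy d M b r) S = (if 0 \<in> S then 1 else 0)" for S
    using True by (simp add: noisy_def indicator_def)
  have N1: "measure_pmf.prob (noisy d M b (Suc r)) S = ?U (F -` S)" for S
    unfolding F_def One_nat_def True by (simp add: noisy_def)
  have "?U (F -` S) \<le> \<gamma>" if "0 \<notin> S" for S
    unfolding \<gamma>_def using that by (intro measure_pmf.finite_measure_mono) (auto simp: F_def split: if_splits)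
  moreover have "1 \<le> ?U (F -` S) + \<gamma>" if "0 \<in> S" for S
  proof -
    \<comment> \<open>When 0 belongs to \<open>S\<close>, the thresholded value can miss
      \<open>S\<close> only if it passed the threshold.\<close>
    have "F -` S \<union> {u. b < M 1 u} = UNIV" using that by (auto simp: F_def)
    then have "1 = ?U (F -` S \<union> {u. b < M 1 u})" by simp
    also have "\<dots> \<le> ?U (F -` S) + \<gamma>" unfolding \<gamma>_def by (intro measure_subadditive) auto
    finally show ?thesis .
  qed
  moreover have "0 \<le> \<gamma>" "?U (F -` S) \<le> 1" for S by (simp_all add: \<gamma>_def)
  ultimately show ?thesis
    by (intro that[of 1 \<gamma>]) (auto simp: N0 N1 intro: add_increasing2)
next
  case False
  define F where "F = (\<lambda>v. if b < v then v else 0)"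
  have N: "measure_pmf.prob (noisy d M b c) S = measure_pmf.prob (map_pmf (M c) (uniform_seed d)) (F -` S)"
    if "c \<noteq> 0" for c S
    using that by (simp add: noisy_def F_def vimage_def)
  show ?thesis
    using counting_dp_Suc[OF dp, of r] r False by (intro that[of "exp \<epsilon>" 0]) (simp_all add: N del:
        measure_map_pmf)
qed

text \<open>\<open>f\<close> counts the rows common to both datasets, so each of the two affected
  coordinates compares \<open>f\<close> with its successor. The bounds keep both counts in the range
  where the mechanism is private.\<close>

lemma neighbors_count_list:
  assumes "neighbors D D'"
  obtains x y f where "x \<in> set D" "y \<in> set D'" "\<And>z. count_list D z = f z + (if z = x then 1 else 0)"
    "\<And>z. count_list D' z = f z + (if z = y then 1 else 0)" "x \<noteq> y"
    "f x + 1 \<le> length D" "f y + 1 \<le> length D"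
proof -
  have len: "length D' = length D" using assms by (simp add: neighbors_def)
  have "card {i. i < length D \<and> D ! i \<noteq> D' ! i} = 1" using assms unfolding neighbors_def by blast
  then obtain i where i: "{i. i < length D \<and> D ! i \<noteq> D' ! i} = {i}" by (rule card_1_singletonE)
  then have iD: "i < length D" "D ! i \<noteq> D' ! i" by auto
  define f where "f = count_list (take i D @ drop (Suc i) D)"
  have eq: "D ! k = D' ! k" if "k < length D" "k \<noteq> i" for k
  proof -
    have "k \<notin> {i. i < length D \<and> D ! i \<noteq> D' ! i}" unfolding i using that by simp
    then show ?thesis using that by simp
  qed
  have "take i D' = take i D" using eq iD len by (intro nth_take_lemma) auto
  moreover have "drop (Suc i) D' = drop (Suc i) D" using eq len by (intro nth_equalityI) auto
  moreover have "D' = take i D' @ D' ! i # drop (Suc i) D'" using iD(1) len by (intro id_take_nth_drop) simp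
  ultimately have D'_eq: "D' = take i D @ D' ! i # drop (Suc i) D" by simp
  have D': "count_list D' z = f z + (if z = D' ! i then 1 else 0)" for z
    by (subst D'_eq) (simp add: f_def)
  have "D = take i D @ D ! i # drop (Suc i) D" using iD(1) by (rule id_take_nth_drop)
  then have D: "count_list D z = f z + (if z = D ! i then 1 else 0)" for z
    by (rule ssubst[where P = "\<lambda>L. count_list L z = _"]) (simp add: f_def)
  have "f z \<le> length (take i D @ drop (Suc i) D)" for z unfolding f_def by (rule count_le_length)
  moreover have "length (take i D @ drop (Suc i) D) + 1 = length D" using iD(1) by simp
  ultimately have "f z + 1 \<le> length D" for z by (metis add_le_mono1)
  with D D' iD len show ?thesis by (intro that[of "D ! i" "D' ! i" f]) auto
qed

lemma differentially_private_stability_histogram: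
  assumes dp: "counting_dp n d (\<epsilon> / 2) 0 M"
    and \<delta>: "2 * measure_pmf.prob (uniform_seed d) {u. b < M 1 u} \<le> \<delta>" and "finite X"
  shows "differentially_private X n \<epsilon> \<delta> (stability_histogram d M b)"
  unfolding differentially_private_def
proof (intro ballI impI allI)
  fix D D' S assume DD: "D \<in> datasets X n" "D' \<in> datasets X n" and "neighbors D D'"
  let ?N = "noisy d M b"
  define \<gamma> where "\<gamma> = measure_pmf.prob (uniform_seed d) {u. b < M 1 u}"
  from \<open>neighbors D D'\<close> obtain x y f where xy: "x \<in> set D" "y \<in> set D'" "x \<noteq> y"
    and D: "\<And>z. count_list D z = f z + (if z = x then 1 else 0)"
    and D': "\<And>z. count_list D' z = f z + (if z = y then 1 else 0)"
    and f: "Suc (f x) \<le> n" "Suc (f y) \<le> n"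
    using DD by (elim neighbors_count_list) (auto simp: datasets_def)
  have X: "x \<in> X" "y \<in> X" using xy DD by (auto simp: datasets_def)
  let ?p = "\<lambda>z. ?N (count_list D z)"
  let ?p' = "\<lambda>z. ?N (count_list D' z)"
  have P: "stability_histogram d M b D = Pi_pmf X 0 ?p" "stability_histogram d M b D' = Pi_pmf X 0 ?p'"
    using DD \<open>finite X\<close> by (auto simp: datasets_def intro!: stability_histogram_eq_Pi_pmf)
  \<comment> \<open>Both orders of the two updates are recorded, as the coordinate to be changed
    first depends on the case.\<close>
  have p': "?p' = ?p(x := ?N (f x), y := ?N (Suc (f y)))" "?p' = ?p(y := ?N (Suc (f y)), x := ?N (f x))"
    using xy(3) by (auto simp: fun_eq_iff D D' Suc_eq_plus1)
  have p: "?p x = ?N (Suc (f x))" "?p y = ?N (f y)" using xy(3) by (simp_all add: D Suc_eq_plus1)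
  let ?\<epsilon> = "exp (\<epsilon> / 2)"
  have e: "?\<epsilon> * ?\<epsilon> = exp \<epsilon>" by (simp flip: exp_add)
  \<comment> \<open>Privacy of the mechanism applied to the sure event forces the exponent to be
    nonnegative.\<close>
  have "1 \<le> ?\<epsilon>" using counting_dp_Suc(1)[OF dp, of "f x" UNIV] f by simp
  then have e': "?\<epsilon> \<le> exp \<epsilon>" "1 \<le> exp \<epsilon>" unfolding e[symmetric] using mult_mono[of 1 ?\<epsilon> 1 ?\<epsilon>] by simp_all
  have \<gamma>: "0 \<le> \<gamma>" "2 * \<gamma> \<le> \<delta>" using \<delta> by (simp_all add: \<gamma>_def)
  obtain e1 \<delta>1 where 1: "(e1 = 1 \<and> \<delta>1 = \<gamma>) \<or> (e1 = ?\<epsilon> \<and> \<delta>1 = 0)"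
    "\<And>S. measure_pmf.prob (?N (Suc (f x))) S \<le> e1 * measure_pmf.prob (?N (f x)) S + \<delta>1"
    using noisy_Suc[OF dp f(1), of b] unfolding \<gamma>_def by metis
  obtain e2 \<delta>2 where 2: "(e2 = 1 \<and> \<delta>2 = \<gamma>) \<or> (e2 = ?\<epsilon> \<and> \<delta>2 = 0)"
    "\<And>S. measure_pmf.prob (?N (f y)) S \<le> e2 * measure_pmf.prob (?N (Suc (f y))) S + \<delta>2"
    using noisy_Suc[OF dp f(2), of b] unfolding \<gamma>_def by metis
  have pos: "0 \<le> e1" "0 \<le> \<delta>1" "0 \<le> e2" "0 \<le> \<delta>2" using 1(1) 2(1) \<gamma> by auto
  define Q where "Q = measure_pmf.prob (Pi_pmf X 0 ?p') S"
  have Q: "0 \<le> Q" by (simp add: Q_def)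
  show "measure_pmf.prob (stability_histogram d M b D) S
      \<le> exp \<epsilon> * measure_pmf.prob (stability_histogram d M b D') S + \<delta>"
    unfolding P Q_def[symmetric]
  \<comment> \<open>A coordinate with an additive error is changed first, so that this error is not scaled by the other one.\<close>
  proof (cases "e1 = 1")
    case True
    let ?q = "?p(x := ?N (f x))"
    have "measure_pmf.prob (Pi_pmf X 0 ?p) S \<le> e1 * measure_pmf.prob (Pi_pmf X 0 ?q) S + \<delta>1"
      using \<open>finite X\<close> X(1) 1(2) pos(1,2) unfolding p(1)[symmetric] by (rule prob_Pi_pmf_upd_le)
    also have "measure_pmf.prob (Pi_pmf X 0 ?q) S \<le> e2 * Q + \<delta>2"
      unfolding Q_def p'(1)
      by (rule prob_Pi_pmf_upd_le) (use \<open>finite X\<close> X xy(3) 2(2) pos p in auto)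
    finally have "measure_pmf.prob (Pi_pmf X 0 ?p) S \<le> e2 * Q + (\<delta>1 + \<delta>2)" using True by simp
    moreover have "e2 \<le> exp \<epsilon>" "\<delta>1 + \<delta>2 \<le> \<delta>" using 1(1) 2(1) \<gamma> e' by auto
    then have "e2 * Q \<le> exp \<epsilon> * Q" using Q by (intro mult_right_mono)
    ultimately show "measure_pmf.prob (Pi_pmf X 0 ?p) S \<le> exp \<epsilon> * Q + \<delta>"
      using \<open>\<delta>1 + \<delta>2 \<le> \<delta>\<close> by linarith
  next
    case False
    then have e1: "e1 = ?\<epsilon>" "\<delta>1 = 0" using 1(1) by auto
    let ?q = "?p(y := ?N (Suc (f y)))"
    have "measure_pmf.prob (Pi_pmf X 0 ?p) S \<le> e2 * measure_pmf.prob (Pi_pmf X 0 ?q) S + \<delta>2"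
      using \<open>finite X\<close> X(2) 2(2) pos(3,4) unfolding p(2)[symmetric] by (rule prob_Pi_pmf_upd_le)
    also have "measure_pmf.prob (Pi_pmf X 0 ?q) S \<le> e1 * Q + \<delta>1"
      unfolding Q_def p'(2)
      by (rule prob_Pi_pmf_upd_le) (use \<open>finite X\<close> X xy(3) 1(2) pos p in auto)
    finally have "measure_pmf.prob (Pi_pmf X 0 ?p) S \<le> e2 * ?\<epsilon> * Q + \<delta>2" using e1 pos(3)
      by (simp add: mult_left_mono mult.assoc)
    moreover have "e2 * ?\<epsilon> \<le> exp \<epsilon>" "\<delta>2 \<le> \<delta>" using 2(1) \<gamma> e e' by auto
    then have "e2 * ?\<epsilon> * Q \<le> exp \<epsilon> * Q" using Q by (intro mult_right_mono)
    ultimately show "measure_pmf.prob (Pi_pmf X 0 ?p) S \<le> exp \<epsilon> * Q + \<delta>"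
      using \<open>\<delta>2 \<le> \<delta>\<close> by linarith
  qed
qed

section \<open>Range and accuracy of the histogram\<close>

lemma set_stability_histogram:
  assumes "1 \<le> d" "\<And>c u. c \<le> n \<Longrightarrow> u \<in> {1..d} \<Longrightarrow> M c u \<le> n" "D \<in> datasets X n"
  shows "set_pmf (stability_histogram d M b D) \<subseteq> histograms n n X"
proof
  fix h assume "h \<in> set_pmf (stability_histogram d M b D)"
  then obtain u where u: "u \<in> set_pmf (Pi_pmf (set D) 0 (\<lambda>_. uniform_seed d))"
    and h: "h = (\<lambda>x. if x \<in> set D \<and> b < M (count_list D x) (u x) then M (count_list D x) (u x) else 0)"
    unfolding stability_histogram_def set_eq_count_list Let_def by auto
  have D: "length D = n" "set D \<subseteq> X" using assms(3) by (auto simp: datasets_def)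
  have "u x \<in> {1..d}" if "x \<in> set D" for x
    using u that assms(1) by (auto simp: set_Pi_pmf PiE_dflt_def set_uniform_seed)
  moreover have "count_list D x \<le> n" for x using D(1) count_le_length by metis
  ultimately have "h x \<le> n" for x unfolding h using assms(2) by simp
  moreover have "card {x \<in> X. h x \<noteq> 0} \<le> n"
  proof -
    have "card {x \<in> X. h x \<noteq> 0} \<le> card (set D)" by (intro card_mono) (auto simp: h)
    then show ?thesis using card_length[of D] D(1) by simp
  qed
  ultimately show "h \<in> histograms n n X" using D(2) by (auto simp: histograms_def h)
qed

lemma per_query_accurate_stability_histogram:
  assumes acc: "counting_accurate n d a \<beta> M" and "0 \<le> a"
  shows "per_query_accurate X n a \<beta> (a + real b) (stability_histogram d M b)"
  unfolding per_query_accurate_def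
proof (intro ballI impI)
  fix D x assume D: "D \<in> datasets X n" and x: "a + real b < real (count_list D x)"
  let ?c = "count_list D x"
  have c0: "?c \<noteq> 0" using x \<open>0 \<le> a\<close> by (intro notI) simp
  then have xD: "x \<in> set D" by (simp add: count_list_0_iff)
  have cn: "?c \<le> n" using D count_le_length[of D x] by (simp add: datasets_def)
  have "1 - \<beta> \<le> measure_pmf.prob (uniform_seed d) {u. \<bar>real (M ?c u) - real ?c\<bar> \<le> a}"
    using acc cn by (simp add: counting_accurate_def)
  \<comment> \<open>A value within \<open>a\<close> of a count larger than \<open>a + b\<close>
    exceeds \<open>b\<close>, so an accurate answer is never suppressed.\<close>
  also have "\<dots> \<le> measure_pmf.prob (noisy d M b ?c) {v. \<bar>real v - real ?c\<bar> \<le> a}"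
    using c0 x by (auto simp: noisy_def intro!: measure_pmf.finite_measure_mono)
  also have "noisy d M b ?c = map_pmf (\<lambda>h. h x) (stability_histogram d M b D)"
    using xD by (simp add: stability_histogram_eq_Pi_pmf[of "set D"] Pi_pmf_component)
  finally show "1 - \<beta> \<le> measure_pmf.prob (stability_histogram d M b D) {h. \<bar>real (h x) - real ?c\<bar> \<le> a}"
    by (simp add: vimage_def)
qed

text \<open>Only the at most \<open>n\<close> elements that are present carry noise, and their
  noises are independent; so the success probabilities multiply, and the size of the universe does
  not enter.\<close>

lemma simultaneously_accurate_stability_histogram:
  assumes acc: "counting_accurate n d a \<beta> M" and "0 \<le> a" "0 \<le> \<beta>" "\<beta> \<le> 1"
  shows "simultaneously_accurate X n (a + real b) (1 - (1 - \<beta>) ^ n) (stability_histogram d M b)"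
  unfolding simultaneously_accurate_def
proof
  fix D assume D: "D \<in> datasets X n"
  define B where "B = (\<lambda>x. {v. \<bar>real v - real (count_list D x)\<bar> \<le> a + real b})"
  have "card (set D) \<le> n" using D card_length[of D] by (simp add: datasets_def)
  then have "1 - (1 - (1 - \<beta>) ^ n) \<le> (1 - \<beta>) ^ card (set D)"
    using assms by (simp add: power_decreasing)
  also have "\<dots> = (\<Prod>x\<in>set D. 1 - \<beta>)" by simp
  also have "\<dots> \<le> (\<Prod>x\<in>set D. measure_pmf.prob (noisy d M b (count_list D x)) (B x))"
  proof (intro prod_mono conjI)
    fix x assume x: "x \<in> set D"
    let ?c = "count_list D x"
    have cn: "?c \<le> n" using D count_le_length[of D x] by (simp add: datasets_def)
    have "1 - \<beta> \<le> measure_pmf.prob (uniform_seed d) {u. \<bar>real (M ?c u) - real ?c\<bar> \<le> a}"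
      using acc cn by (simp add: counting_accurate_def)
    \<comment> \<open>If an accurate answer is suppressed, it was at most \<open>b\<close>, so the
      count is at most \<open>a + b\<close> and 0 is still close enough.\<close>
    also have "\<dots> \<le> measure_pmf.prob (noisy d M b ?c) (B x)"
      using x \<open>0 \<le> a\<close> by (auto simp: noisy_def B_def count_list_0_iff intro!: measure_pmf.finite_measure_mono)
    finally show "1 - \<beta> \<le> measure_pmf.prob (noisy d M b ?c) (B x)" .
  qed (use assms in simp)
  also have "\<dots> = measure_pmf.prob (stability_histogram d M b D) (PiE_dflt (set D) 0 B)"
    by (simp add: stability_histogram_eq_Pi_pmf[of "set D"] measure_Pi_pmf_PiE_dflt)
  also have "\<dots> \<le> measure_pmf.prob (stability_histogram d M b D)
      {h. \<forall>x\<in>X. \<bar>real (h x) - real (count_list D x)\<bar> \<le> a + real b}"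
  proof (intro measure_pmf.finite_measure_mono)
    have "\<bar>real (h x) - real (count_list D x)\<bar> \<le> a + real b" if "h \<in> PiE_dflt (set D) 0 B" for h x
    proof (cases "x \<in> set D")
      case True
      then show ?thesis using that by (auto simp: PiE_dflt_def B_def)
    next
      case False
      then have "h x = 0" "count_list D x = 0" using that by (auto simp: PiE_dflt_def count_list_0_iff)
      then show ?thesis using \<open>0 \<le> a\<close> by simp
    qed
    then show "PiE_dflt (set D) 0 B \<subseteq> {h. \<forall>x\<in>X. \<bar>real (h x) - real (count_list D x)\<bar> \<le> a + real b}" by blast
  qed simp
  finally show "1 - (1 - (1 - \<beta>) ^ n) \<le> measure_pmf.prob (stability_histogram d M b D)
      {h. \<forall>x\<in>X. \<bar>real (h x) - real (count_list D x)\<bar> \<le> a + real b}" .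
qed

section \<open>The complete program\<close>

lemma tree_at_map_tree:
  assumes "links \<mu> t"
    and "\<And>p. p \<in> set_tree t \<Longrightarrow> p \<noteq> 0 \<and> p + 3 + l \<le> 2 ^ w \<and> \<mu> (p + 2) = v p \<and> read_block w l \<mu> (p + 3) = k p"
  shows "tree_at w l \<mu> (root_addr t) (map_tree (\<lambda>p. (k p, v p)) t)"
  using assms by (induction t) auto

text \<open>\<open>stores_histogram\<close> on bare registers and memory, the form of postcondition
  that \<open>achieves\<close> takes.\<close>

definition stores :: "nat \<Rightarrow> nat \<Rightarrow> (nat \<Rightarrow> nat) \<Rightarrow> (nat \<Rightarrow> nat) \<Rightarrow> histogram \<Rightarrow> bool" where
  "stores w l \<rho> \<mu> h \<longleftrightarrow> (\<exists>t. tree_at w l \<mu> (\<rho> 0) t \<and> balanced_search_tree t \<and> set_tree t = {(x,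
      h x) |x. h x > 0})"

context group_stage
begin

lemma achieves_tree_prog:
  assumes inv: "inv n es h \<rho> \<mu>" and R: "\<rho>0 6 = R" "R + 3 * n + 1 < W" "0 < T" and J: "n < 2 ^ J"
  shows "achieves S tree_prog \<rho> \<mu> (J * (14 * n + 7) + 7) (return_pmf h) (stores w l)"
proof -
  have mem: "list_at \<mu> A ps" "\<And>p j. p \<in> set ps \<Longrightarrow> j < l \<Longrightarrow> \<mu> (p + 3 + j) = \<mu>0 (p + 3 + j)"
      "\<And>k. k \<le> n \<Longrightarrow> \<mu> (R + k) = 0"
    and em: "list_at \<mu> T es" "sorted_wrt (\<lambda>e e'. key e < key e') es" "set es \<subseteq> set ps"
      "\<And>e. e \<in> set es \<Longrightarrow> h (key e) = \<mu> (e + 2)" "{x. 0 < h x} = key ` set es"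
    and len: "length es \<le> n"
    and \<rho>: "\<forall>r<11. \<rho> r = \<rho>0 r" "\<rho> 13 = T + length es"
    using inv by (auto simp: inv_def mem_ok_def emitted_def)
  have T: "J * (14 * length es + 7) + 7 \<le> J * (14 * n + 7) + 7" using len by simp
  have es: "R + n < e \<and> e + 3 + l \<le> Z" if "e \<in> set es" for e using addr em(3) that by blast
  have apart: "e + 3 + l \<le> e' \<or> e' + 3 + l \<le> e" if "e \<in> set es" "e' \<in> set es" "e \<noteq> e'" for e e'
    using spaced em(3) that by blast
  have "ends S tree_prog \<rho> \<mu> (J * (14 * n + 7) + 7) (\<lambda>\<rho>' \<mu>'. achieves S [] \<rho>' \<mu>' 0 (return_pmf h)
      (stores w l))"
  proof (rule ends_mono[OF ends_tree_prog[where qs = es and k = "length es" and R = R and T = T and J = J,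
        OF _ _ _ _ _ _ _ _ _ _ _ _ _ _ T] order_refl])
    show "es ! i + 1 < es ! i' \<or> es ! i' + 1 < es ! i" if i: "i < i'" "i' < length es" for i i'
    proof -
      have "key (es ! i) < key (es ! i')" using em(2) i by (simp add: sorted_wrt_iff_nth_less)
      then have "es ! i \<noteq> es ! i'" by auto
      then show ?thesis using apart[of "es ! i" "es ! i'"] i by auto
    qed
    show "p \<in> set es \<Longrightarrow> R + length es < p \<and> p + 1 < 2 ^ word_size S" for p
      using es[of p] len layout by linarith
    show "length es < 2 ^ J" using len J by linarith
  next
    fix \<rho>' \<mu>' :: "nat \<Rightarrow> nat"
    assume "\<exists>t. inorder t = es \<and> 2 ^ height t \<le> (length es + 1)\<^sup>2 \<and> \<rho>' 0 = root_addr t \<and> links \<mu>' t \<and>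
      (\<forall>x. \<not> (R \<le> x \<and> x \<le> R + length es) \<longrightarrow> (\<forall>p\<in>set es. x \<noteq> p \<and> x \<noteq> p + 1) \<longrightarrow> \<mu>' x = \<mu> x)"
    then obtain t where t: "inorder t = es" "2 ^ height t \<le> (length es + 1)\<^sup>2" "\<rho>' 0 =
        root_addr t" "links \<mu>' t"
      and frame: "\<And>x. \<not> (R \<le> x \<and> x \<le> R + length es) \<Longrightarrow> (\<And>p. p\<in>set es \<Longrightarrow> x \<noteq> p \<and> x \<noteq> p + 1) \<Longrightarrow> \<mu>' x = \<mu> x"
      by blast
    have set_t: "set_tree t = set es" using t(1) by (metis set_inorder)
    \<comment> \<open>Linking writes only the first two cells of a node; \<open>j = 0\<close> is the
      count, larger \<open>j\<close> are the words of the key.\<close>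
    have data: "\<mu>' (e + 2 + j) = \<mu> (e + 2 + j)" if "e \<in> set es" "j < l + 1" for e j
    proof (rule frame)
      show "\<not> (R \<le> e + 2 + j \<and> e + 2 + j \<le> R + length es)" using es[OF that(1)] len by simp
      show "e + 2 + j \<noteq> p \<and> e + 2 + j \<noteq> p + 1" if "p \<in> set es" for p
        using apart[OF \<open>e \<in> set es\<close> that] \<open>j < l + 1\<close> by (cases "e = p") auto
    qed
    define t' where "t' = map_tree (\<lambda>p. (key p, h (key p))) t"
    have "tree_at w l \<mu>' (root_addr t) t'"
      unfolding t'_def
    proof (rule tree_at_map_tree[OF t(4)])
      fix p assume "p \<in> set_tree t"
      then have p: "p \<in> set es" "p \<in> set ps" using set_t em(3) by auto
      have "read_block w l \<mu>' (p + 3) = key p"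
      proof (rule read_block_cong)
        show "\<mu>' (p + 3 + j) = \<mu>0 (p + 3 + j)" if "j < l" for j
        proof -
          have "p + 2 + (j + 1) = p + 3 + j" by simp
          then have "\<mu>' (p + 3 + j) = \<mu> (p + 3 + j)" using data[OF p(1),
              of "j + 1"] that by (simp only: add_less_mono1)
          then show ?thesis using mem(2)[OF p(2) that] by (simp only:)
        qed
      qed
      then show "p \<noteq> 0 \<and> p + 3 + l \<le> 2 ^ w \<and> \<mu>' (p + 2) = h (key p) \<and> read_block w l \<mu>' (p + 3) = key p"
        using es[OF p(1)] layout data[OF p(1), of 0] em(4)[OF p(1)] by simp
    qed
    moreover have "balanced_search_tree t'"
      unfolding balanced_search_tree_def
    proof
      have "map_tree fst t' = map_tree key t" by (simp add: t'_def tree.map_comp comp_def)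
      then show "bst (map_tree fst t')"
        using em(2) t(1) by (simp add: bst_iff_sorted_wrt_less inorder_map sorted_wrt_map)
      have "size1 t = length es + 1" using t(1) length_inorder[of t] by (simp add: size1_size)
      moreover have "real (2 ^ height t) \<le> real ((length es + 1)\<^sup>2)" using t(2) by (rule of_nat_mono)
      ultimately have "real (2 ^ height t) \<le> (real (size1 t))\<^sup>2" by simp
      then have "log 2 (real (2 ^ height t)) \<le> log 2 ((real (size1 t))\<^sup>2)" by (subst
          log_le_cancel_iff) simp_all
      then show "real (height t') \<le> 2 * log 2 (real (size1 t'))"
        by (simp add: t'_def log_nat_power size1_size)
    qed
    moreover have "set_tree t' = {(x, h x) |x. h x > 0}"
    proof -
      have "set_tree t' = (\<lambda>x. (x, h x)) ` (key ` set es)" by (simp add: t'_def tree.set_map set_t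
          image_image)
      also have "key ` set es = {x. 0 < h x}" using em(5) by simp
      finally show ?thesis by auto
    qed
    ultimately show "achieves S [] \<rho>' \<mu>' 0 (return_pmf h) (stores w l)"
      using t(3) by (intro achieves_Nil) (auto simp: stores_def)
  qed (use em \<rho> regs layout R J len mem(3) in auto)
  from achieves_append[OF this, of "J * (14 * n + 7) + 7"] show ?thesis by simp
qed

lemma achieves_group_tree_prog:
  assumes R: "\<rho>0 6 = R" "R + 3 * n + 1 < W" "0 < T" and J: "n < 2 ^ J"
    and mem: "list_at \<mu>0 A ps" "\<And>k. k \<le> n \<Longrightarrow> \<mu>0 (R + k) = 0"
  shows "achieves S (group_prog @ tree_prog) \<rho>0 \<mu>0
    (n * (8 * l + tb + seed_words S + 22) + J * (14 * n + 7) + 12) (rest 0 (\<lambda>_. 0)) (stores w l)"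
proof -
  let ?\<rho> = "\<rho>0(11 := n, 12 := A, 13 := T, 14 := 0)"
  have "inv 0 [] (\<lambda>_. 0) ?\<rho> \<mu>0"
    using mem by (simp add: inv_def mem_ok_def emitted_def list_at_def)
  then have loop: "achieves S (Loop 11 (scan_prog @ [Cond 17 [] (Rand 9 # emit_prog)]) # tree_prog) ?\<rho> \<mu>0
    ((n - 0) * (8 * l + tb + seed_words S + 22) + 1 + (J * (14 * n + 7) + 7)) (rest 0 (\<lambda>_. 0)) (stores w l)"
    by (intro achieves_group_loop achieves_tree_prog R J) simp_all
  have "n < W" "A < W" "T < W" using layout by simp_all
  then have "ends S [Bin Add 11 0 10, Bin Add 12 4 10, Bin Add 13 5 10, Const 14 0] \<rho>0 \<mu>0 4
     (\<lambda>\<rho>' \<mu>'. \<rho>' = ?\<rho> \<and> \<mu>' = \<mu>0)"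
    using regs
    apply -
    apply (rule ends_basic, simp, simp?)+
    done
  then have "ends S [Bin Add 11 0 10, Bin Add 12 4 10, Bin Add 13 5 10, Const 14 0] \<rho>0 \<mu>0 4
     (\<lambda>\<rho>' \<mu>'. achieves S (Loop 11 (scan_prog @ [Cond 17 [] (Rand 9 # emit_prog)]) # tree_prog) \<rho>' \<mu>'
    (n * (8 * l + tb + seed_words S + 22) + 1 + (J * (14 * n + 7) + 7)) (rest 0 (\<lambda>_. 0)) (stores w l))"
    by (rule ends_mono) (use loop in auto)
  from achieves_append[OF this, of "n * (8 * l + tb + seed_words S + 22) + J * (14 * n + 7) + 12"]
  show ?thesis by (simp add: group_prog_def)
qed

end

text \<open>
  Registers 0 to 10 are constant after the setup: the number of rows, the words per key, the threshold, 1,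
  the bases \<open>A\<close>, \<open>T\<close>, \<open>R\<close> and \<open>Q\<close> of the sorted array, of the output array (also scratch space for
  sorting), of the array of roots and of the nodes, 3, the address \<open>Z\<close> of the seed block, and 0. The seed
  block comes last, because it may be arbitrarily long.
\<close>

definition setup_prog :: "com list" where
  "setup_prog =
     [Const 3 1, Bin Mul 4 0 1, Bin Add 5 4 0, Bin Add 6 5 0, Bin Add 7 6 0, Bin Add 7 7 3,
      Const 8 3, Bin Add 9 1 8, Bin Mul 9 0 9, Bin Add 9 7 9]"

definition histogram_prog :: "com list" where
  "histogram_prog = setup_prog @ init_prog @ radix_prog @ group_prog @ tree_prog"

text \<open>\<open>Z\<close> is the size of the memory in use: \<open>n * l\<close> cells of input,
  \<open>n\<close> each for the sorted and the output array, \<open>n + 1\<close> roots and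
  \<open>n * (l + 3)\<close> for the nodes. \<open>B\<close> bounds the bits of a single key word,
  either because the whole key has at most \<open>B\<close> bits or because a word has.\<close>

lemma achieves_histogram_prog:
  fixes S and D :: "nat list" and b m :: nat
  defines "w \<equiv> word_size S" and "n \<equiv> length D" and "l \<equiv> num_words (word_size S) m"
    and "Z \<equiv> 2 * (length D * num_words (word_size S) m) + 6 * length D + 1"
  assumes D: "\<And>x. x \<in> set D \<Longrightarrow> x \<le> m" and n: "0 < n"
    and w: "0 < w" "Z < 2 ^ w" and B: "m < 2 ^ B \<or> B = w" "1 \<le> B" "B \<le> w" and J: "n < 2 ^ J"
    and seed: "1 \<le> seed_range S"
    and mech: "\<And>c u. c \<le> n \<Longrightarrow> u \<in> {1..seed_range S} \<Longrightarrow> subroutine S c u \<le> n"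
    and tb: "\<And>c u. c \<le> n \<Longrightarrow> u \<in> {1..seed_range S} \<Longrightarrow> sub_time S c u \<le> tb"
  shows "achieves S histogram_prog (reg (initial_state w l b D)) (mem (initial_state w l b D))
    (10 + (n * (6 * l + 8) + 6) + (l * (B * (34 * n + 14) + 6) + 3) +
     (n * (8 * l + tb + seed_words S + 22) + J * (14 * n + 7) + 12))
    (stability_histogram (seed_range S) (subroutine S) b D) (stores w l)"
proof -
  define A where "A = n * l"
  define T where "T = A + n"
  define R where "R = T + n"
  define Q where "Q = R + n + 1"
  note layout_def = A_def T_def R_def Q_def
  let ?W = "2 ^ w :: nat"
  have Z: "Z = Q + n * (l + 3)" by (simp add: Z_def layout_def n_def l_def algebra_simps)
  \<comment> \<open>The second inequality yields \<open>R + 3 * n + 1 \<le> Z\<close>: linking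
    computes addresses beyond its root array, and these must not overflow.\<close>
  have l_n: "l + 3 \<le> n * (l + 3)" "2 * n \<le> n * (l + 3)" 
    using n mult_le_mono1[of 1 n "l + 3"] mult_le_mono2[of 2 "l + 3" n] by (simp_all add: mult.commute)
  have less: "n < ?W" "l < ?W" "A < ?W" "T < ?W" "R < ?W" "Q < ?W" "Z < ?W" "l + 3 < ?W" "3 < ?W"
      "n * (l + 3) < ?W" "R + 3 * n + 1 < ?W" "R + n + 1 < ?W"
    using w(2) l_n n unfolding Z layout_def by linarith+
  let ?\<rho>i = "reg (initial_state w l b D)" and ?\<mu>i = "mem (initial_state w l b D)"
  have \<rho>i: "?\<rho>i 0 = n" "?\<rho>i 1 = l" "?\<rho>i 2 = b" "\<And>r. 2 < r \<Longrightarrow> ?\<rho>i r = 0"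
    by (simp_all add: initial_state_def n_def)
  have \<mu>i: "?\<mu>i (i * l + j) = nth_word w (D ! i) j" if "i < n" "j < l" for i j
  proof -
    have "Suc i * l \<le> n * l" using that by (intro mult_le_mono1) simp
    then have "i * l + j < n * l" using that by simp
    then show ?thesis using that by (simp add: initial_state_def n_def)
  qed
  have \<mu>i_0: "?\<mu>i x = 0" if "A \<le> x" for x using that by (simp add: initial_state_def layout_def n_def)
  define \<rho>1 where "\<rho>1 = ?\<rho>i(3 := 1, 4 := A, 5 := T, 6 := R, 7 := Q, 8 := 3, 9 := Z)"
  have \<rho>1: "\<rho>1 0 = n" "\<rho>1 1 = l" "\<rho>1 2 = b" "\<rho>1 3 = 1" "\<rho>1 4 = A" "\<rho>1 5 = T" "\<rho>1 6 = R" "\<rho>1 7 = Q"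
    "\<rho>1 8 = 3" "\<rho>1 9 = Z" "\<rho>1 10 = 0"
    using \<rho>i by (simp_all add: \<rho>1_def)
  have prepare: "ends S setup_prog ?\<rho>i ?\<mu>i 10 (\<lambda>\<rho> \<mu>. \<rho> = \<rho>1 \<and> \<mu> = ?\<mu>i)"
  proof -
    have "n * l < ?W" using less(3) by (simp add: A_def)
    then show ?thesis
      using w(1) less \<rho>i(1,2) unfolding setup_prog_def w_def[symmetric] \<rho>1_def
      apply -
      apply (rule ends_basic, simp, (simp add: w_def[symmetric] flip: layout_def Z)?)+
      done
  qed
  define addr where "addr = (\<lambda>i. Q + i * (l + 3))"
  have addr_less: "addr i + (l + 3) \<le> Z" if "i < n" for i
  proof -
    have "Suc i * (l + 3) \<le> n * (l + 3)" using that by (intro mult_le_mono1) simp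
    then show ?thesis by (simp add: addr_def Z)
  qed
  have addr_mono: "addr i + (l + 3) \<le> addr i'" if "i < i'" for i i'
  proof -
    have "Suc i * (l + 3) \<le> i' * (l + 3)" using that by (intro mult_le_mono1) simp
    then show ?thesis by (simp add: addr_def)
  qed
  define ps0 where "ps0 = map addr [0..<n]"
  have ps0: "length ps0 = n" "distinct ps0"
  proof -
    have "strict_mono addr"
    proof (rule strict_monoI)
      show "addr i < addr i'" if "i < i'" for i i' using addr_mono[OF that] by simp
    qed
    then show "distinct ps0" by (simp add: ps0_def distinct_map strict_mono_imp_inj_on)
  qed (simp add: ps0_def)
  have in_ps0: "\<exists>i<n. p = addr i" if "p \<in> set ps0" for p using that by (auto simp: ps0_def)
  have ps0_bounds: "R + n < p \<and> p + 3 + l \<le> Z" if p: "p \<in> set ps0" for p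
  proof -
    obtain i where "i < n" "p = addr i" using in_ps0[OF p] by blast
    then show ?thesis using addr_less[of i] by (simp add: addr_def Q_def)
  qed
  have ps0_spaced: "p + 3 + l \<le> p' \<or> p' + 3 + l \<le> p" if p: "p \<in> set ps0" "p' \<in> set ps0" "p \<noteq> p'" for p p'
  proof -
    obtain i i' where i: "i < n" "p = addr i" "i' < n" "p' = addr i'" using in_ps0 p by meson
    then have "i \<noteq> i'" using p(3) by auto
    then show ?thesis using addr_mono[of i i'] addr_mono[of i' i] i by (cases "i < i'") auto
  qed
  have word: "nth_word w x j < ?W" "x \<le> m \<Longrightarrow> nth_word w x j < 2 ^ B" for x j
  proof -
    show "nth_word w x j < ?W" by (simp add: nth_word_def)
    assume "x \<le> m"
    have "nth_word w x j \<le> x" unfolding nth_word_def by (meson div_le_dividend mod_less_eq_dividend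
        order_trans)
    then show "nth_word w x j < 2 ^ B" using B(1) \<open>x \<le> m\<close> \<open>nth_word w x j < ?W\<close> by auto
  qed
  let ?H = "stability_histogram (seed_range S) (subroutine S) b D"
  let ?t4 = "n * (8 * l + tb + seed_words S + 22) + J * (14 * n + 7) + 12"
  \<comment> \<open>The stages are treated from the last to the first, since \<open>achieves\<close>
    speaks of everything up to the end of the program.\<close>
  have stage4: "achieves S (group_prog @ tree_prog) \<rho> \<mu> ?t4 ?H (stores w l)"
    if \<rho>: "\<forall>r<11. \<rho> r = \<rho>1 r" and perm: "list_at \<mu> A ps" "mset ps = mset ps0"
      and sorted: "sorted (map (\<lambda>p. read_block w l \<mu> (p + 3)) ps)"
      and keys: "\<forall>i<n. \<forall>j<l. \<mu> (addr i + 3 + j) = nth_word w (D ! i) j"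
      and zeros: "\<And>k. k \<le> n \<Longrightarrow> \<mu> (R + k) = 0" for \<rho> \<mu> ps
  proof -
    have set: "set ps = set ps0" and len: "length ps = n" and dist: "distinct ps"
      using mset_eq_setD[OF perm(2)] mset_eq_length[OF perm(2)] mset_eq_imp_distinct_iff[OF perm(2)]
          ps0 by simp_all
    interpret group_stage S n l b A T R Z ps \<mu> \<rho> tb
    proof
      show "\<mu> (p + 3 + j) < 2 ^ word_size S" if "p \<in> set ps" "j < l" for p j
      proof -
        obtain i where "i < n" "p = addr i" using in_ps0 \<open>p \<in> set ps\<close> set by blast
        then show ?thesis using keys that(2) word(1) by (simp add: w_def)
      qed
      show "sorted (map (\<lambda>p. read_block (word_size S) l \<mu> (p + 3)) ps)" using sorted by (simp add: w_def)
    qed (use \<rho> \<rho>1 less ps0_bounds ps0_spaced set len dist seed mech tb w in \<open>auto simp: layout_def w_def Z\<close>)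
    have key: "read_block w l \<mu> (addr i + 3) = D ! i" if "i < n" for i
    proof -
      have "read_block w l \<mu> (addr i + 3) = (\<Sum>j<l. nth_word w (D ! i) j * 2 ^ (w * j))"
        using keys that by (simp add: read_block_def)
      also have "\<dots> = D ! i mod 2 ^ (w * l)" by (rule sum_nth_word)
      also have "m < 2 ^ (w * l)" unfolding l_def w_def using w(1) by (intro less_num_words) (simp add: w_def)
      then have "D ! i mod 2 ^ (w * l) = D ! i" using D[of "D ! i"] that by (simp add: n_def)
      finally show ?thesis .
    qed
    \<comment> \<open>In the original order the nodes spell out \<open>D\<close>; sorting permutes
      them, so all counts, and with them the law of the histogram, are those of
      \<open>D\<close>.\<close>
    have ps0_D: "map (\<lambda>p. read_block w l \<mu> (p + 3)) ps0 = D"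
      using key by (intro nth_equalityI) (simp_all add: ps0_def n_def)
    have mset: "mset (map (\<lambda>p. read_block w l \<mu> (p + 3)) ps) = mset D"
      unfolding ps0_D[symmetric] mset_map using perm(2) by (rule arg_cong)
    let ?xs = "map (\<lambda>p. read_block w l \<mu> (p + 3)) ps"
    have "count_list ?xs x = count_list D x" for x
      by (simp only: count_mset[symmetric] mset)
    moreover have "set ?xs = set D" using mset by (rule mset_eq_setD)
    ultimately have "rest 0 (\<lambda>_. 0) = ?H"
      unfolding rest_def stability_histogram_def set_eq_count_list Let_def w_def[symmetric]
      by (intro map_pmf_cong) (auto simp: fun_eq_iff)
    moreover have "achieves S (group_prog @ tree_prog) \<rho> \<mu> ?t4 (rest 0 (\<lambda>_. 0)) (stores (word_size S) l)"
      by (rule achieves_group_tree_prog) (use \<rho> \<rho>1 less perm zeros J n in \<open>auto simp: layout_def w_def\<close>)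
    ultimately show ?thesis by (simp add: w_def)
  qed
  have B_less: "B < ?W" using B(3) less_exp[of w] by linarith
  let ?t3 = "l * (B * (34 * n + 14) + 6) + 3"
  have stage3: "achieves S (radix_prog @ group_prog @ tree_prog) \<rho> \<mu> (?t3 + ?t4) ?H (stores w l)"
    if \<rho>: "\<forall>r<11. \<rho> r = \<rho>1 r" and ps: "list_at \<mu> A ps0"
      and keys: "\<forall>i<n. \<forall>j<l. \<mu> (addr i + 3 + j) = nth_word w (D ! i) j"
      and zero: "\<And>k. k \<le> n \<Longrightarrow> \<mu> (R + k) = 0" for \<rho> \<mu>
  proof (rule achieves_append[OF ends_mono[OF ends_radix_prog[where n = n and l = l and A =
      A and T = T and ps = ps0
        and B = B, OF _ _ _ _ _ _ _ _ _ _ _ _ _ _ _ order_refl] order_refl] order_refl])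
    fix p assume p: "p \<in> set ps0"
    show "T + n \<le> p \<and> p + l + 3 < 2 ^ word_size S"
      using ps0_bounds[OF p] less by (simp add: R_def w_def)
    fix j assume j: "j < l"
    obtain i where i: "i < n" "p = addr i" using in_ps0[OF p] by blast
    then have "D ! i \<le> m" using D[of "D ! i"] by (simp add: n_def)
    then show "\<mu> (p + 3 + j) < 2 ^ B \<and> \<mu> (p + 3 + j) < 2 ^ word_size S"
      using keys i j word by (simp add: w_def)
  next
    fix \<rho>2 \<mu>2
    assume "(\<exists>ps'. list_at \<mu>2 A ps' \<and> mset ps' = mset ps0 \<and>
        sorted (map (\<lambda>p. read_block (word_size S) l \<mu> (p + 3)) ps')) \<and>
     (\<forall>x. x < A \<or> A + n \<le> x \<and> x < T \<or> T + n \<le> x \<longrightarrow> \<mu>2 x = \<mu> x) \<and> (\<forall>r<11. \<rho>2 r = \<rho> r)"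
    then obtain ps' where ps': "list_at \<mu>2 A ps'" "mset ps' = mset ps0"
        "sorted (map (\<lambda>p. read_block w l \<mu> (p + 3)) ps')"
      and frame: "\<And>x. T + n \<le> x \<Longrightarrow> \<mu>2 x = \<mu> x" and \<rho>2: "\<forall>r<11. \<rho>2 r = \<rho> r"
      unfolding w_def by blast
    have "read_block w l \<mu> (p + 3) = read_block w l \<mu>2 (p + 3)" if "p \<in> set ps'" for p
      using ps0_bounds[of p] that mset_eq_setD[OF ps'(2)]
      by (intro read_block_cong frame[symmetric]) (simp add: R_def)
    then have "map (\<lambda>p. read_block w l \<mu> (p + 3)) ps' = map (\<lambda>p. read_block w l \<mu>2 (p + 3)) ps'" by simp
    with ps'(3) have "sorted (map (\<lambda>p. read_block w l \<mu>2 (p + 3)) ps')" by (simp only:)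
    then show "achieves S (group_prog @ tree_prog) \<rho>2 \<mu>2 ?t4 ?H (stores w l)"
      using \<rho> \<rho>2 ps' keys zero frame by (intro stage4[of _ _ ps']) (simp_all add: R_def addr_def Q_def)
  qed (use \<rho> \<rho>1 ps ps0 less B(2) B_less in \<open>auto simp: layout_def w_def\<close>)
  let ?t2 = "n * (6 * l + 8) + 6"
  have stage2: "achieves S (init_prog @ radix_prog @ group_prog @
      tree_prog) \<rho>1 ?\<mu>i (?t2 + (?t3 + ?t4)) ?H (stores w l)"
  proof (rule achieves_append[OF ends_mono[OF ends_init_prog[where n = n and l = l and A = A and Q = Q,
        OF _ _ _ _ _ _ _ _ _ _ order_refl] order_refl] order_refl])
    fix \<rho>2 \<mu>2
    assume "(\<forall>r<11. \<rho>2 r = \<rho>1 r) \<and> (\<forall>i<n. \<mu>2 (A + i) = Q + i * (l + 3)) \<and>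
      (\<forall>i<n. \<forall>j<l. \<mu>2 (Q + i * (l + 3) + 3 + j) = ?\<mu>i (i * l + j)) \<and>
      (\<forall>x. x < A \<or> A + n \<le> x \<and> x < Q \<longrightarrow> \<mu>2 x = ?\<mu>i x)"
    then show "achieves S (radix_prog @ group_prog @ tree_prog) \<rho>2 \<mu>2 (?t3 + ?t4) ?H (stores w l)"
      using \<mu>i \<mu>i_0 ps0 by (intro stage3) (auto simp: list_at_def ps0_def addr_def layout_def)
  qed (use \<rho>1 less in \<open>auto simp: layout_def w_def Z\<close>)
  have "ends S setup_prog ?\<rho>i ?\<mu>i 10 (\<lambda>\<rho> \<mu>. achieves S (init_prog @ radix_prog @ group_prog @
      tree_prog) \<rho> \<mu> (?t2 + (?t3 + ?t4)) ?H (stores w l))"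
    using prepare by (rule ends_mono) (use stage2 in auto)
  then show ?thesis unfolding histogram_prog_def by (rule achieves_append) simp
qed

section \<open>Sizes in bits and words, and the running time\<close>

lemma ex_power_two_greater:
  fixes x :: nat
  assumes "1 \<le> x"
  obtains k where "x < 2 ^ k" "1 \<le> k" "real k \<le> log 2 (real x) + 1"
proof -
  define k where "k = (LEAST k. x < 2 ^ k)"
  have k: "x < 2 ^ k" unfolding k_def by (rule LeastI[of _ x]) (rule less_exp)
  then have "k \<noteq> 0" using assms by (intro notI) simp
  then have "\<not> x < 2 ^ (k - 1)" unfolding k_def by (intro not_less_Least) simp
  then have "2 ^ (k - 1) \<le> real x" by (simp add: not_less)
  then have "real (k - 1) \<le> log 2 (real x)" using assms by (simp add: le_log_iff powr_realpow)
  moreover have "real (k - 1) = real k - 1" using \<open>k \<noteq> 0\<close> by (simp add: Suc_leI)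
  ultimately show ?thesis using k \<open>k \<noteq> 0\<close> by (intro that[of k]) linarith+
qed

text \<open>By minimality, one word less does not suffice to represent \<open>x\<close>.\<close>

lemma num_words_le:
  assumes "0 < w" "1 \<le> x"
  shows "1 \<le> num_words w x" "real w * (real (num_words w x) - 1) \<le> log 2 (real x)"
proof -
  let ?l = "num_words w x"
  have "?l \<noteq> 0" using less_num_words[OF assms(1), of x] assms(2) by (intro notI) simp
  then show "1 \<le> ?l" by simp
  have "\<not> x < 2 ^ (w * (?l - 1))"
    using \<open>?l \<noteq> 0\<close> not_less_Least[of "?l - 1" "\<lambda>l. x < 2 ^ (w * l)"] by (simp add: num_words_def)
  then have "2 ^ (w * (?l - 1)) \<le> real x" by (simp add: not_less)
  then have "real (w * (?l - 1)) \<le> log 2 (real x)"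
    using assms by (simp add: le_log_iff powr_realpow del: of_nat_mult)
  then show "real w * (real ?l - 1) \<le> log 2 (real x)" using \<open>1 \<le> ?l\<close> by simp
qed

lemma computes_histogramI:
  assumes "achieves S P (reg (initial_state (word_size S) (num_words (word_size S) m) b D))
      (mem (initial_state (word_size S) (num_words (word_size S) m) b D)) T H
      (stores (word_size S) (num_words (word_size S) m))"
    and "real T \<le> B"
  shows "computes_histogram S P m b D H B"
proof -
  let ?l = "num_words (word_size S) m"
  let ?s = "initial_state (word_size S) ?l b D"
  obtain k where k: "rel_pmf (\<lambda>(cs', s) h. cs' = [] \<and> clock s \<le> 0 + T \<and>
      stores (word_size S) ?l (reg s) (mem s) h)
        (run S k (P, \<lparr>reg = reg ?s, mem = mem ?s, clock = 0\<rparr>)) H"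
    using assms(1) unfolding achieves_def by blast
  have s: "\<lparr>reg = reg ?s, mem = mem ?s, clock = 0\<rparr> = ?s" by (simp add: initial_state_def)
  have "rel_pmf (\<lambda>(cs, s) h. cs = [] \<and> real (clock s) \<le> B \<and> stores_histogram (word_size S) ?l s h)
      (run S k (P, ?s)) H"
    using assms(2) by (auto simp: stores_def stores_histogram_def intro!: pmf.rel_mono_strong[OF
        k[unfolded s]])
  then show ?thesis unfolding computes_histogram_def Let_def by blast
qed

lemma runs_in_time_histogram_prog:
  assumes d: "1 \<le> d" and M: "\<And>c u. c \<le> n \<Longrightarrow> u \<in> {1..d} \<Longrightarrow> M c u \<le> n"
  shows "runs_in_time histogram_prog 6 300 n m d M b"
  unfolding runs_in_time_def
proof (intro allI impI ballI)
  fix w \<tau> D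
  assume n: "2 \<le> n" and m: "2 \<le> m" and w: "6 * (log 2 n + log 2 (log 2 m)) \<le> real w"
    and D: "D \<in> datasets {1..m} n"
  define S where "S = \<lparr>word_size = w, seed_range = d, subroutine = M, sub_time = \<tau>\<rparr>"
  have S: "word_size S = w" "seed_range S = d" "subroutine S = M" "sub_time S = \<tau>" by (simp_all add: S_def)
  define N L where "N = log 2 (real n)" and "L = log 2 (real m)"
  define l where "l = num_words w m"
  define tb where "tb = worst_time n d \<tau>"
  have N: "1 \<le> N" and L: "1 \<le> L" using n m by (simp_all add: N_def L_def)
  have nL: "2 \<le> real n * L" using mult_mono[of 2 "real n" 1 L] n L by simp
  have "0 \<le> log 2 L" using L by simp
  then have w6: "6 \<le> real w" using w N by (simp add: N_def L_def)
  then have w0: "0 < w" by simp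
  have l: "1 \<le> l" "real w * (real l - 1) \<le> L" using num_words_le[OF w0, of m] m by (simp_all add: l_def L_def)
  have "1 * (real l - 1) \<le> real w * (real l - 1)" using w6 l(1) by (intro mult_right_mono) simp_all
  then have "1 * (real l - 1) \<le> L" using l(2) by (rule order_trans)
  then have l_le: "real l \<le> 2 * L" using L by simp
  have size: "2 * (n * l) + 6 * n + 1 < 2 ^ w"
  proof -
    have "real n * real l \<le> real n * (2 * L)" using l_le by (intro mult_left_mono) simp_all
    moreover have "real n * 1 \<le> real n * L" using L by (intro mult_left_mono) simp_all
    ultimately have "real (2 * (n * l) + 6 * n + 1) < 32 * (real n * L)" using nL by simp
    also have "\<dots> = 2 ^ 5 * (real n * L)" by simp
    \<comment> \<open>Since \<open>n * L\<close> is at least 2, the constant 32 is absorbed by five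
      more factors; this determines the 6 in the bound on the word size.\<close>
    also have "\<dots> \<le> (real n * L) ^ 5 * (real n * L)" using nL by (intro mult_right_mono power_mono) simp_all
    also have "\<dots> = (real n * L) powr 6" using nL by (simp flip: power_Suc2)
    also have "\<dots> = 2 powr (6 * (N + log 2 L))"
    proof -
      have "real n * L = 2 powr (N + log 2 L)" using n L by (simp add: N_def powr_add)
      then show ?thesis by (simp only: powr_powr mult.commute)
    qed
    also have "\<dots> \<le> 2 powr real w" using w by (simp add: N_def L_def)
    also have "\<dots> = real (2 ^ w)" by (simp add: powr_realpow)
    finally show ?thesis by (simp only: of_nat_less_iff)
  qed
  obtain k where k: "m < 2 ^ k" "1 \<le> k" "real k \<le> L + 1"
    using m unfolding L_def by (elim ex_power_two_greater[of m, rotated]) simp_all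
  obtain J where J: "n < 2 ^ J" "1 \<le> J" "real J \<le> N + 1"
    using n unfolding N_def by (elim ex_power_two_greater[of n, rotated]) simp_all
  define B where "B = min w k"
  have B: "m < 2 ^ B \<or> B = w" "1 \<le> B" "B \<le> w" using k w0 by (auto simp: B_def min_def)
  \<comment> \<open>A single word has at most \<open>k\<close> significant bits; several words together have at most twice the
      bits of \<open>m\<close>.\<close>
  have lB: "real l * real B \<le> 3 * L"
  proof (cases "l = 1")
    case True
    then show ?thesis using k(3) L by (simp add: B_def)
  next
    case False
    then have "real w * real l \<le> real w * (2 * (real l - 1))"
      using l(1) by (intro mult_left_mono) simp_all
    also have "\<dots> = 2 * (real w * (real l - 1))" by simp
    finally have "real w * real l \<le> 2 * L" using l(2) by linarith
    moreover have "real l * real B \<le> real l * real w" using B(3) by (intro mult_left_mono) simp_all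
    ultimately show ?thesis using L by (simp add: mult.commute)
  qed
  have sw: "real (seed_words S) \<le> log 2 d + 1"
  proof -
    have "1 * (real (seed_words S) - 1) \<le> real w * (real (seed_words S) - 1)"
      using w6 num_words_le(1)[OF w0, of d] d by (intro mult_right_mono) (simp_all add: seed_words_def S)
    then show ?thesis using num_words_le(2)[OF w0, of d] d by (simp add: seed_words_def S)
  qed
  have tb: "\<tau> c u \<le> tb" if "c \<le> n" "u \<in> {1..d}" for c u
  proof -
    have "{\<tau> c u |c u. c \<le> n \<and> u \<in> {1..d}} = (\<lambda>(c, u). \<tau> c u) ` ({..n} \<times> {1..d})" by (auto; blast)
    then show ?thesis unfolding tb_def worst_time_def using that by (intro Max_ge) auto
  qed
  have len: "length D = n" and Dm: "\<And>x. x \<in> set D \<Longrightarrow> x \<le> m" using D by (auto simp: datasets_def)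
  let ?T = "10 + (n * (6 * l + 8) + 6) + (l * (B * (34 * n + 14) + 6) + 3) +
     (n * (8 * l + tb + seed_words S + 22) + J * (14 * n + 7) + 12)"
  have ach: "achieves S histogram_prog (reg (initial_state w l b D)) (mem (initial_state w l b D)) ?T
     (stability_histogram d M b D) (stores w l)"
    using achieves_histogram_prog[where S = S and D = D and b = b and m = m and B = B and J = J and tb = tb]
      len Dm n w0 size B J d M tb by (simp add: S l_def)
  have time: "real ?T \<le> 300 * (n * log 2 n * log 2 m + n * log 2 d + n * worst_time n d \<tau>)"
  proof -
    define P where "P = real n * L * N"
    have PnL: "real n * L \<le> P" unfolding P_def using mult_left_mono[of 1 N "real n * L"] N nL by simp
    have PnN: "real n * N \<le> P" unfolding P_def using mult_left_mono[of 1 L "real n * N"] N L by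
        (simp add: mult.commute mult.left_commute)
    have nnL: "real n \<le> real n * L" using mult_left_mono[of 1 L "real n"] L by simp
    have "2 * L \<le> real n * L" using n L by (intro mult_right_mono) simp_all
    then have 1: "real l \<le> P" using l_le PnL by linarith
    have 2: "real n * real l \<le> 2 * P" using mult_left_mono[OF l_le, of "real n"] PnL by simp
    have 3: "real l * (real B * (34 * real n + 14)) \<le> 123 * P"
    proof -
      \<comment> \<open>For \<open>n \<ge> 2\<close> the lower-order term satisfies
        \<open>14 \<le> 7 * n\<close>; the product of 3 and 41 is the 123.\<close>
      have "(real l * real B) * (34 * real n + 14) \<le> (3 * L) * (41 * real n)"
        by (rule mult_mono[OF lB]) (use n L in simp_all)
      also have "\<dots> \<le> 123 * P" using PnL by (simp add: mult.commute)
      finally show ?thesis by (simp add: mult.assoc)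
    qed
    have 4: "real J * (14 * real n + 7) \<le> 36 * P"
    proof -
      have "real J * (14 * real n + 7) \<le> (2 * N) * (18 * real n)"
        by (rule mult_mono) (use J(3) N n in simp_all)
      also have "\<dots> \<le> 36 * P" using PnN by (simp add: mult.commute)
      finally show ?thesis .
    qed
    have 5: "real n * real (seed_words S) \<le> real n * log 2 d + real n"
      using mult_left_mono[OF sw, of "real n"] by (simp add: distrib_left)
    have 6: "1 \<le> P" "0 \<le> real n * log 2 d" "0 \<le> real n * real tb" using PnL nL d by simp_all
    have "real ?T = 31 + 14 * (real n * real l) + 30 * real n + real l * (real B * (34 * real n +
        14)) + 6 * real l +
        real n * real tb + real n * real (seed_words S) + real J * (14 * real n + 7)"
      by (simp add: algebra_simps)
    also have "\<dots> \<le> 300 * (P + real n * log 2 d + real n * real tb)"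
    proof -
      \<comment> \<open>After inserting the bounds, the coefficients of \<open>P\<close> add up to
        255.\<close>
      have "31 + 14 * x + 30 * y + z + 6 * u + v + s + r \<le> 300 * (P + q + v)"
        if "u \<le> P" "x \<le> 2 * P" "z \<le> 123 * P" "r \<le> 36 * P" "s \<le> q + y" "1 \<le> P" "0 \<le> q" "0 \<le> v" "y \<le> P"
        for x y z u v s r q :: real
        using that by simp
      then show ?thesis using 1 2 3 4 5 6 order_trans[OF nnL PnL] by blast
    qed
    finally show ?thesis by (simp add: P_def N_def L_def tb_def mult.commute mult.left_commute)
  qed
  show "computes_histogram \<lparr>word_size = w, seed_range = d, subroutine = M, sub_time = \<tau>\<rparr> histogram_prog m b D
      (stability_histogram d M b D) (300 * (n * log 2 n * log 2 m + n * log 2 d + n * worst_time n d \<tau>))"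
    unfolding S_def[symmetric] using ach time by (intro computes_histogramI[of S histogram_prog m b
        D ?T]) (simp_all only: S l_def)
qed

theorem theorem5p3:
  shows "\<exists>(P :: com list) (K :: real) (C :: real).
    \<forall>(n :: nat) (m :: nat) (d :: nat) (M :: nat \<Rightarrow> nat \<Rightarrow> nat) (b :: nat)
     (\<epsilon> :: real) (a :: real) (\<beta> :: real).
      d \<ge> 1 \<longrightarrow> b \<le> n \<longrightarrow> a \<ge> 0 \<longrightarrow> 0 \<le> \<beta> \<longrightarrow> \<beta> \<le> 1 \<longrightarrow>
      (\<forall>c \<le> n. \<forall>u \<in> {1..d}. M c u \<le> n) \<longrightarrow>
      counting_dp n d (\<epsilon> / 2) 0 M \<longrightarrow>
      counting_accurate n d a \<beta> M \<longrightarrow>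
      (\<forall>D \<in> datasets {1..m} n. set_pmf (stability_histogram d M b D) \<subseteq> histograms n n {1..m}) \<and>
      (\<forall>\<delta>. \<delta> \<ge> 2 * measure_pmf.prob (uniform_seed d) {u. M 1 u > b} \<longrightarrow>
         differentially_private {1..m} n \<epsilon> \<delta> (stability_histogram d M b)) \<and>
      per_query_accurate {1..m} n a \<beta> (a + real b) (stability_histogram d M b) \<and>
      (let \<beta>' = 1 - (1 - \<beta>) ^ n in
         simultaneously_accurate {1..m} n (a + real b) \<beta>' (stability_histogram d M b) \<and>
         \<beta>' \<le> real n * \<beta>) \<and>
      runs_in_time P K C n m d M b"
proof (rule exI[of _ histogram_prog], rule exI[of _ 6], rule exI[of _ 300],
    intro allI impI conjI ballI, goal_cases)
  case (1 n m d M b \<epsilon> a \<beta> D)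
  then show ?case by (intro set_stability_histogram) auto
next
  case (2 n m d M b \<epsilon> a \<beta> \<delta>)
  then show ?case by (intro differentially_private_stability_histogram) auto
next
  case (3 n m d M b \<epsilon> a \<beta>)
  then show ?case by (intro per_query_accurate_stability_histogram)
next
  case (4 n m d M b \<epsilon> a \<beta>)
  then have "1 - (1 - \<beta>) ^ n \<le> real n * \<beta>" using Bernoulli_inequality[of "- \<beta>" n] by simp
  with 4 show ?case unfolding Let_def by (intro conjI simultaneously_accurate_stability_histogram)
next
  case (5 n m d M b \<epsilon> a \<beta>)
  then show ?case by (intro runs_in_time_histogram_prog) auto
qed

end
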